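(* Let $p,p',q,q'\ge 0$ satisfy $p+p'\le1$ and $q+q'\le1$, put $p_0=1-p-p'$ and $q_0=1-q-q'$, and suppose that $$\gamma:=pq_0+qp_0+p_0q_0\neq0.$$ Let $\{e^{tG_\varepsilon}, t\ge 0\}$ be the strongly continuous semigroup in $L^1(S)$ generated by $G_\varepsilon=\frac1\varepsilon A+\frac1{\varepsilon^2}(B-I)$, let $P=\frac12(B+I)$, and let $\widetilde\Delta_0=J\Delta_0J^{-1}$ be the isomorphic image of $\Delta_0$ in $L_0$ (all objects as defined in the context). Then $$\lim_{\varepsilon\to0+}e^{tG_\varepsilon}\varphi=e^{t\frac12\widetilde\Delta_0}P\varphi,\qquad t>0,\ \varphi\in L^1(S),$$ in the norm of $L^1(S)$, and the limit is uniform for $t$ in compact subsets of $(0,\infty)$. For $\varphi\in L_0$, the limit extends to $t=0$ and is uniform for $t$ in compact subsets of $[0,\infty)$.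
   Context: Notation: $\mathbb R_*=\mathbb R\setminus\{0\}$, $\mathbb R_+=(0,\infty)$, $\mathbb R_-=(-\infty,0)$; $[Q]$ is the Iverson bracket, equal to $1$ if $Q$ is true and $0$ otherwise. $S=\mathbb R\times\{-1,1\}$, each copy of $\mathbb R$ carrying Lebesgue measure; $L^1(S)$ is the space of integrable functions on $S$. Operator $A$ in $L^1(S)$: its domain $\mathcal D(A)$ consists of $\varphi\in L^1(S)$ such that for each $i\in\{-1,1\}$, $\varphi(\cdot,i)$ is absolutely continuous on each of $\mathbb R_+$ and $\mathbb R_-$ separately, with integrable derivative there (so that one-sided limits $\varphi(0\pm,i)$ exist and are finite), and $$\varphi(0+,1)=p\,\varphi(0-,1)+q'\varphi(0+,-1),\qquad \varphi(0-,-1)=p'\varphi(0-,1)+q\,\varphi(0+,-1).$$ For such $\varphi$, $A\varphi(x,i)=-i\,\varphi'(x,i)$, $(x,i)\in\mathbb R_*\times\{-1,1\}$. ($A$ generates a strongly continuous semigroup of contractions in $L^1(S)$.) $B$ is the bounded operator $B\varphi(x,i)=\varphi(x,-i)$ on $L^1(S)$ and $I$ is the identity. For $\varepsilon>0$, $G_\varepsilon=\frac1\varepsilon A+\frac1{\varepsilon^2}(B-I)$ with domain $\mathcal D(A)$; as a bounded perturbation of a generator it generates a strongly continuous semigroup. $L_0\subset L^1(S)$ is the subspace of $\varphi$ with $\varphi(x,1)=\varphi(x,-1)$, $x\in\mathbb R$. $J:L^1(\mathbb R)\to L_0$ is the isometric isomorphism $J\phi(x,i)=\frac12\phi(x)$.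 $P\varphi(x,i)=\frac12(\varphi(x,1)+\varphi(x,-1))$ is a projection of $L^1(S)$ onto $L_0$. Operator $\Delta_0$ in $L^1(\mathbb R)$: its domain consists of $\phi\in L^1(\mathbb R)$ of the form $$\phi(x)=\Big(Cx-\int_x^0(x-y)\psi(y)\,dy\Big)[x<0]+\Big(Dx+\int_0^x(x-y)\psi(y)\,dy\Big)[x>0],$$ where $C,D$ are real constants and $\psi\in L^1(\mathbb R)$; for such $\phi$, $\Delta_0\phi=\psi=\phi''$. $\frac12\Delta_0$ generates a strongly continuous semigroup in $L^1(\mathbb R)$ (describing Brownian motion on $\mathbb R_-\cup\mathbb R_+$ killed upon hitting $0$). $\widetilde\Delta_0=J\Delta_0J^{-1}$ has domain $J(\mathcal D(\Delta_0))\subset L_0$, and $e^{t\frac12\widetilde\Delta_0}=Je^{t\frac12\Delta_0}J^{-1}$ on $L_0$. *)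

theory Defs
  imports "HOL-Analysis.Analysis"
begin

text \<open>
  A type with a distinguished measure. Using Borel sets instead of Lebesgue sets on the reals
  does not change the space of classes of integrable functions, since every Lebesgue measurable
  function agrees almost everywhere with a Borel one.
\<close>

class ref_measure =
  fixes ref :: "'a measure"

instantiation real :: ref_measure
begin
definition ref_real :: "real measure" where "ref_real = lborel"
instance ..
end

instantiation prod :: (ref_measure, ref_measure) ref_measure
begin
definition ref_prod :: "('a \<times> 'b) measure" where "ref_prod = ref \<Otimes>\<^sub>M ref"
instance ..
end

quotient_type (overloaded) 'a L1 = "'a::ref_measure \<Rightarrow> real" / partial:
  "\<lambda>f g. integrable ref f \<and> integrable ref g \<and> (AE x in ref. f x = g x)"
  morphisms rep_L1 L1_class
proof (rule part_equivpI)
  show "\<exists>f::'a \<Rightarrow> real. integrable ref f \<and> integrable ref f \<and> (AE x in ref. f x = f x)"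
    by (rule exI[of _ "\<lambda>_. 0"]) simp
  show "symp (\<lambda>f g. integrable ref f \<and> integrable ref g \<and> (AE x in ref. f x = (g x :: real)))"
    by (auto simp: symp_def elim: AE_mp)
  show "transp (\<lambda>f g. integrable ref f \<and> integrable ref g \<and> (AE x in ref. f x = (g x :: real)))"
    by (auto simp: transp_def elim: AE_mp)
qed

instantiation L1 :: (ref_measure) real_vector
begin

lift_definition zero_L1 :: "'a L1" is "\<lambda>_. 0" by simp

lift_definition plus_L1 :: "'a L1 \<Rightarrow> 'a L1 \<Rightarrow> 'a L1" is "\<lambda>f g x. f x + g x"
  by (auto elim: AE_mp)

lift_definition minus_L1 :: "'a L1 \<Rightarrow> 'a L1 \<Rightarrow> 'a L1" is "\<lambda>f g x. f x - g x"
  by (auto elim: AE_mp)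

lift_definition uminus_L1 :: "'a L1 \<Rightarrow> 'a L1" is "\<lambda>f x. - f x"
  by (auto elim: AE_mp)

lift_definition scaleR_L1 :: "real \<Rightarrow> 'a L1 \<Rightarrow> 'a L1" is "\<lambda>c f x. c * f x"
  by (auto elim: AE_mp)

instance
  by standard (transfer; auto simp: algebra_simps)+

end

instantiation L1 :: (ref_measure) real_normed_vector
begin

lift_definition norm_L1 :: "'a L1 \<Rightarrow> real" is "\<lambda>f. \<integral>x. \<bar>f x\<bar> \<partial>ref"
  by (rule integral_cong_AE) (auto elim: AE_mp)

definition dist_L1 :: "'a L1 \<Rightarrow> 'a L1 \<Rightarrow> real" where
  "dist_L1 a b = norm (a - b)"

definition sgn_L1 :: "'a L1 \<Rightarrow> 'a L1" where
  "sgn_L1 a = inverse (norm a) *\<^sub>R a"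

definition uniformity_L1 :: "('a L1 \<times> 'a L1) filter" where
  "uniformity_L1 = (INF e\<in>{0<..}. principal {(x, y). dist x y < e})"

definition open_L1 :: "'a L1 set \<Rightarrow> bool" where
  "open_L1 U \<longleftrightarrow> (\<forall>x\<in>U. \<forall>\<^sub>F (x', y) in uniformity. x' = x \<longrightarrow> y \<in> U)"

instance
proof
  fix a b :: "'a L1" and c :: real
  show "norm a = 0 \<longleftrightarrow> a = 0"
    by transfer (auto simp: integral_nonneg_eq_0_iff_AE)
  show "norm (a + b) \<le> norm a + norm b"
  proof (transfer, goal_cases)
    case (1 f g)
    have "(\<integral>x. \<bar>f x + g x\<bar> \<partial>ref) \<le> (\<integral>x. \<bar>f x\<bar> + \<bar>g x\<bar> \<partial>ref)"
      using 1 by (intro integral_mono) auto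
    then show ?case using 1 by simp
  qed
  show "norm (c *\<^sub>R a) = \<bar>c\<bar> * norm a"
    by transfer (simp add: abs_mult)
qed (simp_all add: dist_L1_def sgn_L1_def uniformity_L1_def open_L1_def)

end

typedef sign = "{- 1, 1 :: int}"
  morphisms int_of_sign Abs_sign
  by auto

instantiation sign :: "{one, uminus, ref_measure}"
begin
definition one_sign :: sign where "one_sign = Abs_sign 1"
definition uminus_sign :: "sign \<Rightarrow> sign" where "uminus_sign i = Abs_sign (- int_of_sign i)"
definition ref_sign :: "sign measure" where "ref_sign = count_space UNIV"
instance ..
end

definition real_of_sign :: "sign \<Rightarrow> real" where
  "real_of_sign i = of_int (int_of_sign i)"

lemma int_of_sign_simps: "int_of_sign 1 = 1" "int_of_sign (- i) = - int_of_sign i"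
  using int_of_sign[of i] by (auto simp: one_sign_def uminus_sign_def Abs_sign_inverse)

lemma sign_cases: "i = 1 \<or> i = - (1::sign)"
  using int_of_sign[of i] by (auto simp: int_of_sign_inject[symmetric] int_of_sign_simps)

lemma sign_minus_minus: "- (- i) = (i::sign)"
  by (simp add: int_of_sign_inject[symmetric] int_of_sign_simps)

lemma one_neq_minus_one_sign: "(1::sign) \<noteq> - 1"
  by (simp add: int_of_sign_inject[symmetric] int_of_sign_simps)

lemma UNIV_sign: "(UNIV :: sign set) = {1, - 1}"
  using sign_cases by auto

instance sign :: finite
  by standard (simp add: UNIV_sign)

lemma bij_uminus_sign: "bij (uminus :: sign \<Rightarrow> sign)"
  by (metis bijI' sign_minus_minus)

type_synonym S = "real \<times> sign"

lemma ref_S: "(ref :: S measure) = lborel \<Otimes>\<^sub>M count_space UNIV"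
  by (simp add: ref_prod_def ref_real_def ref_sign_def)

lemma sigma_finite_sign: "sigma_finite_measure (count_space (UNIV :: sign set))"
  by (simp add: sigma_finite_measure_count_space_finite)

lemma pair_sigma_finite_S: "pair_sigma_finite lborel (count_space (UNIV :: sign set))"
  by (simp add: pair_sigma_finite_def sigma_finite_sign sigma_finite_lborel)

lemma distr_flip: "distr (ref :: S measure) ref (\<lambda>(x, i). (x, - i)) = ref"
proof -
  have d: "distr (count_space UNIV) (count_space UNIV) (uminus :: sign \<Rightarrow> sign) = count_space UNIV"
    using bij_uminus_sign by (rule distr_bij_count_space)
  have "distr lborel lborel (\<lambda>x::real. x) \<Otimes>\<^sub>M
          distr (count_space UNIV) (count_space UNIV) (uminus :: sign \<Rightarrow> sign)
      = distr (lborel \<Otimes>\<^sub>M count_space UNIV) (lborel \<Otimes>\<^sub>M count_space UNIV) (\<lambda>(x, i). (x, - i))"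
    by (rule pair_measure_distr) (auto simp: d sigma_finite_sign)
  then show ?thesis
    by (simp add: ref_S d distr_id2)
qed

lemma measurable_flip: "(\<lambda>(x, i). (x, - i)) \<in> measurable (ref :: S measure) ref"
  by (simp add: ref_S case_prod_beta')

lemma integrable_flip:
  assumes "integrable (ref :: S measure) (f :: S \<Rightarrow> real)"
  shows "integrable ref (\<lambda>(x, i). f (x, - i))"
proof -
  have "integrable (distr (ref :: S measure) ref (\<lambda>(x, i). (x, - i))) f"
    unfolding distr_flip by (rule assms)
  from integrable_distr[OF measurable_flip this] show ?thesis
    by (simp add: case_prod_beta')
qed

lemma AE_flip:
  assumes "AE z in (ref :: S measure). Q z"
  shows "AE (x, i) in (ref :: S measure). Q (x, - i)"
proof -
  have "AE z in distr (ref :: S measure) ref (\<lambda>(x, i). (x, - i)). Q z"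
    unfolding distr_flip by (rule assms)
  from AE_distrD[OF measurable_flip this] show ?thesis
    by (simp add: case_prod_beta')
qed

lift_definition B :: "S L1 \<Rightarrow> S L1" is "\<lambda>f (x, i). f (x, - i)"
proof (goal_cases)
  case (1 f g)
  then show ?case
    using AE_flip[of "\<lambda>z. f z = g z"] integrable_flip[of f] integrable_flip[of g]
    by (auto simp: case_prod_beta')
qed

definition P :: "S L1 \<Rightarrow> S L1" where
  "P \<phi> = (1 / 2) *\<^sub>R (B \<phi> + \<phi>)"

definition L0 :: "S L1 set" where
  "L0 = {L1_class f | f. integrable ref f \<and> (\<forall>x. f (x, 1) = f (x, - 1))}"

lemma integrable_lift_S:
  assumes "integrable lborel (f :: real \<Rightarrow> real)"
  shows "integrable (ref :: S measure) (\<lambda>(x, i). f x / 2)"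
proof -
  interpret pair_sigma_finite lborel "count_space (UNIV :: sign set)"
    by (rule pair_sigma_finite_S)
  have [measurable]: "f \<in> borel_measurable lborel"
    using assms by auto
  show ?thesis
    unfolding ref_S
    using assms
    by (intro Fubini_integrable)
       (auto simp: lebesgue_integral_count_space_finite integrable_count_space case_prod_beta')
qed

lemma AE_lift_S:
  assumes "AE x in lborel. Q (x::real)"
  shows "AE (x, i) in (ref :: S measure). Q x"
proof -
  interpret pair_sigma_finite lborel "count_space (UNIV :: sign set)"
    by (rule pair_sigma_finite_S)
  from assms obtain N where N: "{x. \<not> Q x} \<subseteq> N" "N \<in> sets lborel" "emeasure lborel N = 0"
    by (auto elim!: AE_E)
  have "N \<times> (UNIV :: sign set) \<in> null_sets (ref :: S measure)"
    using N by (auto simp: ref_S null_sets_def M2.emeasure_pair_measure_Times)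
  then show ?thesis
    using N by (auto intro: AE_I')
qed

lift_definition J :: "real L1 \<Rightarrow> S L1" is "\<lambda>\<phi> (x, i). \<phi> x / 2"
proof (goal_cases)
  case (1 f g)
  then show ?case
    unfolding ref_real_def
    using AE_lift_S[of "\<lambda>x. f x = g x"] integrable_lift_S[of f] integrable_lift_S[of g]
    by (auto simp: case_prod_beta')
qed

text \<open>
  An unbounded operator is given by its graph, a set of pairs of an argument in the domain
  and its value.
\<close>

definition absolutely_continuous_fun_on :: "real set \<Rightarrow> (real \<Rightarrow> real) \<Rightarrow> bool" where
  "absolutely_continuous_fun_on I f \<longleftrightarrow>
     (\<forall>e>0. \<exists>d>0. \<forall>(n::nat) (a::nat \<Rightarrow> real) (b::nat \<Rightarrow> real).
        (\<forall>k<n. a k \<le> b k \<and> {a k..b k} \<subseteq> I) \<longrightarrow>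
        disjoint_family_on (\<lambda>k. {a k<..<b k}) {..<n} \<longrightarrow>
        (\<Sum>k<n. b k - a k) < d \<longrightarrow>
        (\<Sum>k<n. \<bar>f (b k) - f (a k)\<bar>) < e)"

text \<open>
  In the next definition \<open>f\<close> is the piecewise absolutely continuous representative of its class
  and \<open>g\<close> its almost everywhere derivative. The one-sided limits at \<open>0\<close> exist by absolute
  continuity, and \<open>f (0, i)\<close> is irrelevant.
\<close>

definition A :: "real \<Rightarrow> real \<Rightarrow> real \<Rightarrow> real \<Rightarrow> (S L1 \<times> S L1) set" where
  "A p p' q q' =
     {(L1_class f, L1_class (\<lambda>(x, i). - real_of_sign i * g (x, i))) | f g.
        integrable ref f \<and> integrable ref g \<and>
        (\<forall>i. absolutely_continuous_fun_on {0<..} (\<lambda>x. f (x, i)) \<and>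
             absolutely_continuous_fun_on {..<0} (\<lambda>x. f (x, i)) \<and>
             (AE x in lborel. ((\<lambda>y. f (y, i)) has_real_derivative g (x, i)) (at x))) \<and>
        Lim (at_right 0) (\<lambda>x. f (x, 1)) =
          p * Lim (at_left 0) (\<lambda>x. f (x, 1)) + q' * Lim (at_right 0) (\<lambda>x. f (x, - 1)) \<and>
        Lim (at_left 0) (\<lambda>x. f (x, - 1)) =
          p' * Lim (at_left 0) (\<lambda>x. f (x, 1)) + q * Lim (at_right 0) (\<lambda>x. f (x, - 1))}"

definition G :: "real \<Rightarrow> real \<Rightarrow> real \<Rightarrow> real \<Rightarrow> real \<Rightarrow> (S L1 \<times> S L1) set" where
  "G p p' q q' \<epsilon> =
     {(\<phi>, (1 / \<epsilon>) *\<^sub>R \<psi> + (1 / \<epsilon>\<^sup>2) *\<^sub>R (B \<phi> - \<phi>)) | \<phi> \<psi>. (\<phi>, \<psi>) \<in> A p p' q q'}"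

definition \<Delta>\<^sub>0 :: "(real L1 \<times> real L1) set" where
  "\<Delta>\<^sub>0 =
     {(L1_class \<phi>, L1_class \<psi>) | \<phi> \<psi>. integrable ref \<phi> \<and> integrable ref \<psi> \<and>
        (\<exists>C D. \<forall>x. \<phi> x =
           (C * x - (LBINT y:{x..0}. (x - y) * \<psi> y)) * of_bool (x < 0) +
           (D * x + (LBINT y:{0..x}. (x - y) * \<psi> y)) * of_bool (x > 0))}"

definition \<Delta>\<^sub>0_tilde :: "(S L1 \<times> S L1) set" where
  "\<Delta>\<^sub>0_tilde = {(J \<phi>, J \<psi>) | \<phi> \<psi>. (\<phi>, \<psi>) \<in> \<Delta>\<^sub>0}"

definition scale_op :: "real \<Rightarrow> ('a::real_vector \<times> 'a) set \<Rightarrow> ('a \<times> 'a) set" where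
  "scale_op c H = {(\<phi>, c *\<^sub>R \<psi>) | \<phi> \<psi>. (\<phi>, \<psi>) \<in> H}"

definition c0_semigroup_on ::
  "'a::real_normed_vector set \<Rightarrow> (real \<Rightarrow> 'a \<Rightarrow> 'a) \<Rightarrow> bool" where
  "c0_semigroup_on X T \<longleftrightarrow>
     subspace X \<and>
     (\<forall>t\<ge>0. (\<forall>\<phi>\<in>X. T t \<phi> \<in> X) \<and>
        (\<forall>\<phi>\<in>X. \<forall>\<psi>\<in>X. T t (\<phi> + \<psi>) = T t \<phi> + T t \<psi>) \<and>
        (\<forall>c. \<forall>\<phi>\<in>X. T t (c *\<^sub>R \<phi>) = c *\<^sub>R T t \<phi>) \<and>
        (\<exists>K. \<forall>\<phi>\<in>X. norm (T t \<phi>) \<le> K * norm \<phi>)) \<and>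
     (\<forall>\<phi>\<in>X. T 0 \<phi> = \<phi>) \<and>
     (\<forall>s\<ge>0. \<forall>t\<ge>0. \<forall>\<phi>\<in>X. T (s + t) \<phi> = T s (T t \<phi>)) \<and>
     (\<forall>\<phi>\<in>X. ((\<lambda>t. T t \<phi>) \<longlongrightarrow> \<phi>) (at_right 0))"

definition generator_on ::
  "'a::real_normed_vector set \<Rightarrow> (real \<Rightarrow> 'a \<Rightarrow> 'a) \<Rightarrow> ('a \<times> 'a) set" where
  "generator_on X T =
     {(\<phi>, \<psi>). \<phi> \<in> X \<and> \<psi> \<in> X \<and> ((\<lambda>h. (1 / h) *\<^sub>R (T h \<phi> - \<phi>)) \<longlongrightarrow> \<psi>) (at_right 0)}"

definition generates_on ::
  "'a::real_normed_vector set \<Rightarrow> ('a \<times> 'a) set \<Rightarrow> (real \<Rightarrow> 'a \<Rightarrow> 'a) \<Rightarrow> bool" where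
  "generates_on X H T \<longleftrightarrow> c0_semigroup_on X T \<and> generator_on X T = H"

end

theory Submission
  imports Defs
begin

text \<open>
  The semigroups \<open>e\<^bsup>tG\<^sub>\<epsilon>\<^esup>\<close> are contractions, because \<open>A\<close> and \<open>B - I\<close> are dissipative. For
  \<open>\<phi> = J f\<close> with \<open>f\<close> in the domain of \<open>\<Delta>\<^sub>0\<close>, the function \<open>f / 2 - \<epsilon> i f' / 4\<close> is mapped by \<open>G\<^sub>\<epsilon>\<close>
  formally to \<open>f'' / 4\<close> exactly, but it misses the interface conditions by a term of order \<open>\<epsilon>\<close>.
  This defect is repaired by replacing \<open>f\<close> with \<open>k = f + \<epsilon> e\<^sub>\<plusminus> / (1 + x\<^sup>2)\<close>, where the constants \<open>e\<^sub>\<plusminus>\<close> solve a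
  linear system with determinant \<open>\<gamma>\<close>. The resulting approximants \<open>E\<^sub>\<epsilon> \<phi>\<close> depend linearly on \<open>\<phi>\<close> and
  satisfy \<open>E\<^sub>\<epsilon> \<phi> - \<phi> = O(\<epsilon>)\<close> and \<open>G\<^sub>\<epsilon> E\<^sub>\<epsilon> \<phi> - J f'' / 2 = O(\<epsilon>)\<close>, so that
  \<open>E\<^sub>\<epsilon> e\<^bsup>t\<Delta>/2\<^esup> \<phi>\<close>, where \<open>\<Delta>\<close> is \<open>J \<Delta>\<^sub>0 J\<^sup>-\<^sup>1\<close>, is an approximate orbit of the contraction semigroup
  \<open>e\<^bsup>tG\<^sub>\<epsilon>\<^esup>\<close>. The odd part of the initial condition is dealt with by the approximate orbit
  \<open>exp (- 2 t / \<epsilon>\<^sup>2) \<eta>\<close> with \<open>\<eta>\<close> odd and in the domain of \<open>A\<close>.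
\<close>

section \<open>Strongly continuous semigroups\<close>

text \<open>The ansatz k/2 - \<epsilon> i k'/4 is dictated by two scales. On its odd part
  \<open>B - I\<close> acts as -2, and this relaxation cancels, at order 1/\<epsilon>, the transport
  of the even part; the transport of the odd part then leaves k''/4. To leading order only even
  parts survive at the interface. With boundary values r on the right and l on the left, the
  conditions become (1 - q') r = p l and (1 - p') l = q r. Since 1 - p' = p + p0 and 1 - q' = q +
  q0, the determinant (1 - q')(1 - p') - p q equals \<gamma>. Hence \<gamma> \<noteq> 0 forces r = l
  = 0, which is the origin of killing at 0; the same matrix reappears at order \<epsilon> and
  determines the two constants of the corrector. The corrector contains f' and the one-sided slopes
  of f at 0, so both must be bounded by the norms of f and f''. Differentiating the approximate
  orbit in time costs one more application of the generator, so the initial value is first taken in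
  the domain of its square and then approximated by density. Contractivity makes an error estimate
  independent of the stiff rate 1/\<epsilon>^2: the error grows no faster than the residual.\<close>

lemma right_continuous_imp_isCont_between:
  fixes u :: "real \<Rightarrow> 'a::metric_space"
  assumes right: "\<And>x. (u \<longlongrightarrow> u x) (at_right x)" and "a < b"
  obtains s where "a < s" "s < b" "isCont u s"
proof -
  \<comment> \<open>Points near which \<open>u\<close> oscillates by less than 1/(n+1). These sets
    are open, right continuity makes them dense, and a point common to all of them is a point of
    continuity; Baire's theorem supplies such points densely.\<close>
  define O' where "O' n = {x. \<exists>d>0. \<forall>y\<in>ball x d. \<forall>z\<in>ball x d. dist (u y) (u z) < 1 / Suc n}" for n
  have op: "open (O' n)" for n
  proof (rule openI)
    fix x assume "x \<in> O' n"
    then obtain d where d: "d > 0" "\<And>y z. y \<in> ball x d \<Longrightarrow> z \<in> ball x d \<Longrightarrow> dist (u y) (u z) < 1 / Suc n"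
      unfolding O'_def by blast
    have "ball x d \<subseteq> O' n"
    proof
      fix y assume "y \<in> ball x d"
      then obtain r where "r > 0" "ball y r \<subseteq> ball x d"
        using openE[OF open_ball] by metis
      then show "y \<in> O' n" using d unfolding O'_def by blast
    qed
    then show "\<exists>d>0. ball x d \<subseteq> O' n" using d(1) by blast
  qed
  have dense: "UNIV \<subseteq> closure (O' n)" for n
  proof
    fix x :: real
    show "x \<in> closure (O' n)"
      unfolding closure_approachable
    proof (intro allI impI)
      fix e :: real assume "e > 0"
      have "\<forall>\<^sub>F y in at_right x. dist (u y) (u x) < 1 / (2 * Suc n)"
        by (intro tendstoD[OF right]) auto
      then obtain c where c: "c > x" "\<And>y. y > x \<Longrightarrow> y < c \<Longrightarrow> dist (u y) (u x) < 1 / (2 * Suc n)"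
        unfolding eventually_at_right_field by blast
      define r where "r = min e (c - x) / 2"
      have r: "r > 0" "r < e" "2 * r \<le> c - x" using c \<open>e > 0\<close> by (auto simp: r_def min_def)
      \<comment> \<open>This ball is the interval from \<open>x\<close> to \<open>x + 2 * r\<close>,
        strictly to the right of \<open>x\<close>, where right continuity controls
        \<open>u\<close>.\<close>
      have "dist (u y) (u z) < 1 / Suc n" if "y \<in> ball (x + r) r" "z \<in> ball (x + r) r" for y z
      proof -
        have "dist (u y) (u x) < 1 / (2 * Suc n)" "dist (u z) (u x) < 1 / (2 * Suc n)"
          using that r by (intro c(2); auto simp: dist_real_def abs_if split: if_splits)+
        then have "dist (u y) (u z) < 1 / (2 * Suc n) + 1 / (2 * Suc n)"
          using dist_triangle2[of "u y" "u z" "u x"] by linarith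
        also have "\<dots> = 1 / Suc n" by (simp add: field_simps)
        finally show ?thesis .
      qed
      then have "x + r \<in> O' n" using r unfolding O'_def by blast
      then show "\<exists>y\<in>O' n. dist y x < e" using r by (intro bexI[of _ "x + r"]) (auto simp: dist_real_def)
    qed
  qed
  have "UNIV \<subseteq> closure (\<Inter>(range O'))"
    by (rule Baire) (use op dense in auto)
  then have "(a + b) / 2 \<in> closure (\<Inter>(range O'))" by auto
  then obtain s where s: "s \<in> \<Inter>(range O')" "dist s ((a + b) / 2) < (b - a) / 2"
    using \<open>a < b\<close> unfolding closure_approachable by (metis diff_gt_0_iff_gt half_gt_zero)
  have "isCont u s"
    unfolding continuous_at_eps_delta
  proof (intro allI impI)
    fix e :: real assume "e > 0"
    then obtain n where n: "1 / Suc n < e" using nat_approx_posE by (metis)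
    from s(1) have "s \<in> O' n" by auto
    then obtain d where d: "d > 0" "\<And>y z. y \<in> ball s d \<Longrightarrow> z \<in> ball s d \<Longrightarrow> dist (u y) (u z) < 1 / Suc n"
      unfolding O'_def by blast
    show "\<exists>d>0. \<forall>y. dist y s < d \<longrightarrow> dist (u y) (u s) < e"
    proof (intro exI conjI allI impI)
      fix y assume "dist y s < d"
      then have "dist (u y) (u s) < 1 / Suc n" using d(1) by (intro d(2)) (auto simp: dist_commute)
      with n show "dist (u y) (u s) < e" by linarith
    qed (rule d(1))
  qed
  moreover have "a < s" "s < b" using s(2) unfolding dist_real_def abs_less_iff by (simp_all add: field_simps)
  ultimately show ?thesis by (intro that)
qed

text \<open>Orbits are differentiated only from the right, so this replaces the mean value theorem.
  The supremum of the times up to which the bound with slope \<open>d + e\<close> holds cannot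
  precede \<open>t\<close>, because the Dini hypothesis at that supremum extends the bound beyond
  it.\<close>

lemma right_Dini_bound:
  fixes g :: "real \<Rightarrow> real"
  assumes cont: "continuous_on {0..} g"
    and Dini: "\<And>s e. s \<ge> 0 \<Longrightarrow> s < t \<Longrightarrow> e > 0 \<Longrightarrow> \<forall>\<^sub>F h in at_right 0. g (s + h) \<le> g s + h * (d + e)"
    and "t \<ge> 0"
  shows "g t \<le> g 0 + d * t"
proof -
  have *: "g t \<le> g 0 + (d + e) * t" if "e > 0" for e
  proof -
    define S where "S = {s \<in> {0..t}. \<forall>r\<in>{0..s}. g r \<le> g 0 + (d + e) * r}"
    have "0 \<in> S" using \<open>t \<ge> 0\<close> by (auto simp: S_def)
    have bdd: "bdd_above S" unfolding S_def by (rule bdd_aboveI[of _ t]) auto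
    define z where "z = Sup S"
    have "z \<le> t"
      unfolding z_def using \<open>0 \<in> S\<close> by (intro cSup_least) (auto simp: S_def)
    moreover have "0 \<le> z"
      unfolding z_def by (rule cSup_upper[OF \<open>0 \<in> S\<close> bdd])
    ultimately have z: "0 \<le> z" "z \<le> t" by auto
    have lt: "g r \<le> g 0 + (d + e) * r" if r: "0 \<le> r" "r < z" for r
    proof -
      obtain s where "s \<in> S" "r < s" using r(2) less_cSup_iff[OF _ bdd, of r] \<open>0 \<in> S\<close> unfolding z_def by (metis empty_iff)
      then show ?thesis using r unfolding S_def by auto
    qed
    have zz: "g z \<le> g 0 + (d + e) * z"
    proof (cases "z = 0")
      case False
      with z have "z > 0" by simp
      have lim: "((\<lambda>r. g 0 + (d + e) * r - g r) \<longlongrightarrow> g 0 + (d + e) * z - g z) (at_left z)"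
      proof (intro tendsto_intros)
        have "(g \<longlongrightarrow> g z) (at z within {0..})" using cont z by (auto simp: continuous_on_def)
        moreover have "at z within {0..} = at z"
          using \<open>z > 0\<close> by (intro at_within_interior) (auto simp: interior_Ici[of "-1"])
        ultimately show "(g \<longlongrightarrow> g z) (at_left z)"
          by (simp add: filterlim_at_split)
      qed
      have "\<forall>\<^sub>F r in at_left z. 0 < r \<and> r < z"
        using eventually_at_left[OF \<open>z > 0\<close>] \<open>z > 0\<close> by blast
      then have "\<forall>\<^sub>F r in at_left z. 0 \<le> g 0 + (d + e) * r - g r"
        by eventually_elim (use lt in force)
      from tendsto_lowerbound[OF lim this] show ?thesis by simp
    qed simp
    have "z = t"
    proof (rule ccontr)
      assume "z \<noteq> t"
      then have "z < t" using z by simp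
      have ev: "\<forall>\<^sub>F h in at_right 0. g (z + h) \<le> g z + h * (d + e)" using Dini z \<open>z < t\<close> \<open>e > 0\<close> by auto
      then obtain b where b: "b > 0" "\<And>h. h > 0 \<Longrightarrow> h < b \<Longrightarrow> g (z + h) \<le> g z + h * (d + e)"
        unfolding eventually_at_right_field by auto
      define h where "h = min (b / 2) (t - z)"
      have h: "0 < h" "h < b" "z + h \<le> t" using b \<open>z < t\<close> by (auto simp: h_def)
      have "z + h \<in> S"
        unfolding S_def
      proof (safe)
        show "z + h \<in> {0..t}" using h z by auto
        fix r assume r: "r \<in> {0..z + h}"
        show "g r \<le> g 0 + (d + e) * r"
        proof (cases "r \<le> z")
          case True then show ?thesis using lt[of r] zz r by (cases "r = z") auto
        next
          case False
          have "g (z + (r - z)) \<le> g z + (r - z) * (d + e)" using False r h by (intro b) auto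
          then show ?thesis using zz by (simp add: algebra_simps)
        qed
      qed
      from cSup_upper[OF this bdd] show False using h by (simp add: z_def)
    qed
    with zz show ?thesis by simp
  qed
  show ?thesis
  proof (rule field_le_epsilon)
    fix e :: real assume "e > 0"
    \<comment> \<open>The slack \<open>e / (t + 1)\<close> adds up to at most \<open>e\<close> over
      a time \<open>t\<close>, and the denominator is safe at \<open>t = 0\<close>.\<close>
    have "g t \<le> g 0 + (d + e / (t + 1)) * t" using * \<open>e > 0\<close> \<open>t \<ge> 0\<close> by simp
    also have "\<dots> = g 0 + d * t + e * (t / (t + 1))" by (simp add: algebra_simps)
    also have "e * (t / (t + 1)) \<le> e * 1" using \<open>e > 0\<close> \<open>t \<ge> 0\<close> by (intro mult_left_mono) auto
    finally show "g t \<le> g 0 + d * t + e" by simp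
  qed
qed

lemma tendsto_at_right_0_cong:
  fixes f g :: "real \<Rightarrow> 'a::topological_space"
  assumes "(f \<longlongrightarrow> l) (at_right 0)" "\<And>h. h > 0 \<Longrightarrow> f h = g h"
  shows "(g \<longlongrightarrow> l) (at_right 0)"
  using assms(1)
  by (rule Lim_transform_eventually)
     (use assms(2) in \<open>auto intro: eventually_mono[OF eventually_at_right_less]\<close>)

lemma c0_semigroup_onD:
  assumes "c0_semigroup_on X T"
  shows "t \<ge> 0 \<Longrightarrow> \<phi> \<in> X \<Longrightarrow> T t \<phi> \<in> X"
    and "t \<ge> 0 \<Longrightarrow> \<phi> \<in> X \<Longrightarrow> \<psi> \<in> X \<Longrightarrow> T t (\<phi> + \<psi>) = T t \<phi> + T t \<psi>"
    and "t \<ge> 0 \<Longrightarrow> \<phi> \<in> X \<Longrightarrow> T t (c *\<^sub>R \<phi>) = c *\<^sub>R T t \<phi>"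
    and "t \<ge> 0 \<Longrightarrow> \<exists>K. \<forall>\<phi>\<in>X. norm (T t \<phi>) \<le> K * norm \<phi>"
    and "\<phi> \<in> X \<Longrightarrow> T 0 \<phi> = \<phi>"
    and "s \<ge> 0 \<Longrightarrow> t \<ge> 0 \<Longrightarrow> \<phi> \<in> X \<Longrightarrow> T (s + t) \<phi> = T s (T t \<phi>)"
    and "\<phi> \<in> X \<Longrightarrow> ((\<lambda>t. T t \<phi>) \<longlongrightarrow> \<phi>) (at_right 0)"
proof -
  note * = assms[unfolded c0_semigroup_on_def, THEN conjunct2]
  show "\<phi> \<in> X \<Longrightarrow> T 0 \<phi> = \<phi>" using *[THEN conjunct2, THEN conjunct1] by simp
  show "s \<ge> 0 \<Longrightarrow> t \<ge> 0 \<Longrightarrow> \<phi> \<in> X \<Longrightarrow> T (s + t) \<phi> = T s (T t \<phi>)"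
    using *[THEN conjunct2, THEN conjunct2, THEN conjunct1] by simp
  show "\<phi> \<in> X \<Longrightarrow> ((\<lambda>t. T t \<phi>) \<longlongrightarrow> \<phi>) (at_right 0)"
    using *[THEN conjunct2, THEN conjunct2, THEN conjunct2] by simp
  assume t: "t \<ge> 0"
  note ** = *[THEN conjunct1, rule_format, OF t]
  show "\<phi> \<in> X \<Longrightarrow> T t \<phi> \<in> X" using **[THEN conjunct1] by simp
  show "\<phi> \<in> X \<Longrightarrow> \<psi> \<in> X \<Longrightarrow> T t (\<phi> + \<psi>) = T t \<phi> + T t \<psi>"
    using **[THEN conjunct2, THEN conjunct1] by simp
  show "\<phi> \<in> X \<Longrightarrow> T t (c *\<^sub>R \<phi>) = c *\<^sub>R T t \<phi>"
    using **[THEN conjunct2, THEN conjunct2, THEN conjunct1] by simp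
  show "\<exists>K. \<forall>\<phi>\<in>X. norm (T t \<phi>) \<le> K * norm \<phi>"
    by (rule **[THEN conjunct2, THEN conjunct2, THEN conjunct2])
qed

section \<open>Orbits of a strongly continuous semigroup and its generator\<close>

locale c0_semigroup =
  fixes T :: "real \<Rightarrow> 'a::real_normed_vector \<Rightarrow> 'a"
  assumes c0: "c0_semigroup_on UNIV T"
begin

lemma bounded_linear:
  assumes "t \<ge> 0" shows "bounded_linear (T t)"
proof -
  obtain K where "\<And>\<phi>. norm (T t \<phi>) \<le> K * norm \<phi>"
    using c0_semigroup_onD(4)[OF c0 assms] by auto
  then show ?thesis
    using c0_semigroup_onD(2,3)[OF c0 assms]
    by (intro bounded_linear_intro[where K = K]) (simp_all add: mult.commute)
qed

lemma zero [simp]: "T 0 \<phi> = \<phi>"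
  and add: "s \<ge> 0 \<Longrightarrow> t \<ge> 0 \<Longrightarrow> T (s + t) \<phi> = T s (T t \<phi>)"
  and tendsto_zero: "((\<lambda>t. T t \<phi>) \<longlongrightarrow> \<phi>) (at_right 0)"
  using c0_semigroup_onD(5-7)[OF c0] by simp_all

lemma diff: "t \<ge> 0 \<Longrightarrow> T t (\<phi> - \<psi>) = T t \<phi> - T t \<psi>"
  and scaleR: "t \<ge> 0 \<Longrightarrow> T t (c *\<^sub>R \<phi>) = c *\<^sub>R T t \<phi>"
  and plus: "t \<ge> 0 \<Longrightarrow> T t (\<phi> + \<psi>) = T t \<phi> + T t \<psi>"
  using bounded_linear[of t] by (simp_all add: linear_simps)

lemma tendsto_right:
  assumes "t \<ge> 0" shows "((\<lambda>h. T (t + h) \<phi>) \<longlongrightarrow> T t \<phi>) (at_right 0)"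
  using bounded_linear.tendsto[OF bounded_linear[OF assms] tendsto_zero]
  by (rule tendsto_at_right_0_cong) (simp add: add assms)

text \<open>
  Local boundedness of the semigroup is not assumed, so left continuity is not immediate. An orbit, being
  right continuous, has continuity points arbitrarily close to \<open>0\<close>, and the bounded
  operator \<open>T (t - s)\<close> carries continuity at \<open>s\<close> over to \<open>t\<close>.
\<close>

lemma continuous_on_orbit: "continuous_on {0..} (\<lambda>t. T t \<phi>)"
proof -
  define u where "u t = T (max 0 t) \<phi>" for t
  have right: "(u \<longlongrightarrow> u t) (at_right t)" for t
  proof (cases "t \<ge> 0")
    case True
    have "((\<lambda>h. u (h + t)) \<longlongrightarrow> T t \<phi>) (at_right 0)"
      using tendsto_right[OF True]
      by (rule tendsto_at_right_0_cong) (use True in \<open>simp add: u_def add.commute\<close>)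
    then show ?thesis using True by (simp add: filterlim_at_right_to_0[of _ _ t] u_def)
  next
    case False
    have "\<forall>\<^sub>F s in at_right t. u s = u t"
      using False unfolding eventually_at_right_field by (intro exI[of _ 0]) (auto simp: u_def)
    then show ?thesis by (rule tendsto_eventually)
  qed
  have "isCont u t" if "t > 0" for t
  proof -
    obtain s where s: "0 < s" "s < t" "isCont u s"
      using right_continuous_imp_isCont_between[OF right \<open>t > 0\<close>] by blast
    have eq: "T (t - s) (u (s + h)) = u (t + h)" if "s + h > 0" for h
    proof -
      have "T (t - s) (u (s + h)) = T ((t - s) + (s + h)) \<phi>"
        using that s add[of "t - s" "s + h"] by (simp add: u_def)
      then show ?thesis using that s by (simp add: u_def)
    qed
    have "((\<lambda>h. T (t - s) (u (s + h))) \<longlongrightarrow> T (t - s) (u s)) (at 0)"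
      using s by (intro bounded_linear.tendsto[OF bounded_linear]) (auto simp: isCont_iff)
    moreover have "\<forall>\<^sub>F h in at 0. T (t - s) (u (s + h)) = u (t + h)"
      using s unfolding eventually_at by (intro exI[of _ s]) (auto simp: dist_real_def intro!: eq)
    ultimately show ?thesis
      using eq[of 0] s unfolding isCont_iff by (auto elim: Lim_transform_eventually)
  qed
  moreover have "continuous (at 0 within {0..}) u"
  proof -
    have "{0..} - {0} = {0<..} - {0::real}" by auto
    then have "at 0 within {0..} = at_right (0::real)" unfolding at_within_def by simp
    then show ?thesis using right by (simp add: continuous_within)
  qed
  ultimately have "continuous (at t within {0..}) u" if "t \<ge> 0" for t
    using that by (cases "t = 0") (auto intro: continuous_at_imp_continuous_at_within)
  then have "continuous_on {0..} u" by (auto simp: continuous_on_eq_continuous_within)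
  then show ?thesis by (rule continuous_on_eq) (auto simp: u_def)
qed

lemma orbit_bounded: "\<exists>K. \<forall>s\<in>{0..t}. norm (T s \<phi>) \<le> K"
proof -
  have "compact ((\<lambda>s. T s \<phi>) ` {0..t})"
    by (intro compact_continuous_image continuous_on_subset[OF continuous_on_orbit]) auto
  from compact_imp_bounded[OF this] show ?thesis unfolding bounded_iff by auto
qed

lemma generatorD:
  "(\<phi>, \<psi>) \<in> generator_on UNIV T \<Longrightarrow> ((\<lambda>h. (1 / h) *\<^sub>R (T h \<phi> - \<phi>)) \<longlongrightarrow> \<psi>) (at_right 0)"
  by (simp add: generator_on_def)

text \<open>Being bounded and commuting with \<open>T h\<close>, the operator \<open>T t\<close> can
  be moved through the difference quotient.\<close>

lemma generator_orbit:
  assumes "(\<phi>, \<psi>) \<in> generator_on UNIV T" "t \<ge> 0"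
  shows "(T t \<phi>, T t \<psi>) \<in> generator_on UNIV T"
    and "((\<lambda>h. (1 / h) *\<^sub>R (T (t + h) \<phi> - T t \<phi>)) \<longlongrightarrow> T t \<psi>) (at_right 0)"
proof -
  interpret bl: bounded_linear "T t" by (rule bounded_linear) fact
  have *: "((\<lambda>h. T t ((1 / h) *\<^sub>R (T h \<phi> - \<phi>))) \<longlongrightarrow> T t \<psi>) (at_right 0)"
    by (intro bl.tendsto generatorD assms)
  then show "((\<lambda>h. (1 / h) *\<^sub>R (T (t + h) \<phi> - T t \<phi>)) \<longlongrightarrow> T t \<psi>) (at_right 0)"
    by (rule tendsto_at_right_0_cong) (use assms in \<open>simp add: add bl.scaleR bl.diff\<close>)
  have "T t (T h \<phi>) = T h (T t \<phi>)" if "h > 0" for h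
    using add[of t h \<phi>] add[of h t \<phi>] assms that by (simp add: add.commute)
  with * have "((\<lambda>h. (1 / h) *\<^sub>R (T h (T t \<phi>) - T t \<phi>)) \<longlongrightarrow> T t \<psi>) (at_right 0)"
    by (elim tendsto_at_right_0_cong) (simp add: bl.scaleR bl.diff)
  then show "(T t \<phi>, T t \<psi>) \<in> generator_on UNIV T"
    by (simp add: generator_on_def)
qed

lemma generator_subspace: "subspace (generator_on UNIV T)"
proof (rule subspaceI)
  have "T h 0 = 0" if "h > 0" for h
    using scaleR[of h 0 0] that by simp
  then have "((\<lambda>h. (1 / h) *\<^sub>R (T h 0 - 0)) \<longlongrightarrow> 0) (at_right 0)"
    by (intro tendsto_at_right_0_cong[OF tendsto_const]) auto
  then show "0 \<in> generator_on UNIV T" by (simp add: generator_on_def zero_prod_def)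
next
  fix x y assume "x \<in> generator_on UNIV T" "y \<in> generator_on UNIV T"
  then obtain \<phi> \<psi> \<phi>' \<psi>' where xy: "x = (\<phi>, \<psi>)" "y = (\<phi>', \<psi>')"
    "(\<phi>, \<psi>) \<in> generator_on UNIV T" "(\<phi>', \<psi>') \<in> generator_on UNIV T"
    by (cases x, cases y) auto
  have "((\<lambda>h. (1 / h) *\<^sub>R (T h (\<phi> + \<phi>') - (\<phi> + \<phi>'))) \<longlongrightarrow> \<psi> + \<psi>') (at_right 0)"
    using tendsto_add[OF generatorD[OF xy(3)] generatorD[OF xy(4)]]
    by (rule tendsto_at_right_0_cong) (simp add: plus algebra_simps)
  then show "x + y \<in> generator_on UNIV T" by (simp add: generator_on_def xy)
next
  fix x and c :: real assume "x \<in> generator_on UNIV T"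
  then obtain \<phi> \<psi> where xy: "x = (\<phi>, \<psi>)" "(\<phi>, \<psi>) \<in> generator_on UNIV T" by (cases x) auto
  have "((\<lambda>h. (1 / h) *\<^sub>R (T h (c *\<^sub>R \<phi>) - c *\<^sub>R \<phi>)) \<longlongrightarrow> c *\<^sub>R \<psi>) (at_right 0)"
    using tendsto_scaleR[OF tendsto_const[of c] generatorD[OF xy(2)]]
    by (rule tendsto_at_right_0_cong) (simp add: scaleR algebra_simps)
  then show "c *\<^sub>R x \<in> generator_on UNIV T" by (simp add: generator_on_def xy)
qed

text \<open>A Duhamel estimate without integrals. The error at \<open>s + h\<close> splits into the
  defect \<open>w (s + h) - T h (w s)\<close>, which is \<open>h * (w' s - v s)\<close> up to o(h),
  and the image under \<open>T h\<close> of the error at \<open>s\<close>, which a contraction does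
  not enlarge. Giving the residual bound \<open>d\<close> through a primitive \<open>D\<close>
  reduces the claim to the Dini bound.\<close>

lemma approximate_orbit:
  assumes contr: "\<And>t \<phi>. t \<ge> 0 \<Longrightarrow> norm (T t \<phi>) \<le> norm \<phi>"
    and w: "continuous_on {0..} w"
    and gen: "\<And>s. 0 \<le> s \<Longrightarrow> s < t \<Longrightarrow> (w s, v s) \<in> generator_on UNIV T"
    and deriv: "\<And>s. 0 \<le> s \<Longrightarrow> s < t \<Longrightarrow>
      ((\<lambda>h. (1 / h) *\<^sub>R (w (s + h) - w s)) \<longlongrightarrow> w' s) (at_right 0)"
    and D: "continuous_on {0..} D"
      "\<And>s. 0 \<le> s \<Longrightarrow> s < t \<Longrightarrow> (D has_real_derivative d s) (at s)"
    and d: "\<And>s. 0 \<le> s \<Longrightarrow> s < t \<Longrightarrow> norm (w' s - v s) \<le> d s"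
    and "t \<ge> 0"
  shows "norm (w t - T t (w 0)) \<le> D t - D 0"
proof -
  define g where "g s = norm (w s - T s (w 0)) - D s" for s
  have "g t \<le> g 0 + 0 * t"
  proof (rule right_Dini_bound)
    show "continuous_on {0..} g"
      unfolding g_def by (intro continuous_intros w continuous_on_orbit D)
    show "\<forall>\<^sub>F h in at_right 0. g (s + h) \<le> g s + h * (0 + e)" if s: "s \<ge> 0" "s < t" "e > 0" for s e
    proof -
      have "((\<lambda>h. norm ((1 / h) *\<^sub>R (w (s + h) - w s) - (1 / h) *\<^sub>R (T h (w s) - w s))
          - (D (s + h) - D s) / h) \<longlongrightarrow> norm (w' s - v s) - d s) (at_right 0)"
        using D(2)[OF s(1,2)] unfolding DERIV_def filterlim_at_split
        by (intro tendsto_intros deriv generatorD gen s) auto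
      moreover have "norm (w' s - v s) - d s < e" using d[OF s(1,2)] s(3) by simp
      ultimately have "\<forall>\<^sub>F h in at_right 0. norm ((1 / h) *\<^sub>R (w (s + h) - w s) - (1 / h) *\<^sub>R (T h (w s) - w s))
          - (D (s + h) - D s) / h < e"
        by (rule order_tendstoD)
      moreover have "\<forall>\<^sub>F h in at_right 0. (0::real) < h" by (rule eventually_at_right_less)
      ultimately show ?thesis
      proof eventually_elim
        case (elim h)
        have "(1 / h) *\<^sub>R (w (s + h) - w s) - (1 / h) *\<^sub>R (T h (w s) - w s) = (1 / h) *\<^sub>R (w (s + h) - T h (w s))"
          by (simp add: algebra_simps)
        then have "norm (w (s + h) - T h (w s)) / h - (D (s + h) - D s) / h < e"
          using elim by simp
        then have 1: "norm (w (s + h) - T h (w s)) - (D (s + h) - D s) \<le> h * e"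
          using elim(2) by (simp add: field_simps)
        have "T (s + h) (w 0) = T h (T s (w 0))"
          using add[of h s] elim(2) s by (simp add: add.commute)
        then have "w (s + h) - T (s + h) (w 0) = (w (s + h) - T h (w s)) + T h (w s - T s (w 0))"
          using elim(2) by (simp add: diff)
        then have "norm (w (s + h) - T (s + h) (w 0))
            \<le> norm (w (s + h) - T h (w s)) + norm (T h (w s - T s (w 0)))"
          by (metis norm_triangle_ineq)
        also have "norm (T h (w s - T s (w 0))) \<le> norm (w s - T s (w 0))"
          using contr elim(2) by simp
        finally show ?case using 1 by (simp add: g_def)
      qed
    qed
  qed (rule \<open>t \<ge> 0\<close>)
  then show ?thesis by (simp add: g_def)
qed

end

lemma tendsto_average_at_right:
  fixes u :: "real \<Rightarrow> 'a::banach"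
  assumes u: "continuous_on {0..} u" and "a \<ge> 0"
  shows "((\<lambda>r. (1 / r) *\<^sub>R integral {a..a + r} u) \<longlongrightarrow> u a) (at_right 0)"
proof (rule tendstoI)
  fix e :: real assume "e > 0"
  then obtain d where d: "d > 0" "\<And>s. s \<ge> 0 \<Longrightarrow> dist s a < d \<Longrightarrow> dist (u s) (u a) < e / 2"
    using u \<open>a \<ge> 0\<close> unfolding continuous_on_iff by (metis atLeast_iff half_gt_zero)
  have "dist ((1 / r) *\<^sub>R integral {a..a + r} u) (u a) < e" if r: "0 < r" "r < d" for r
  proof -
    have c: "continuous_on {a..a + r} u" by (rule continuous_on_subset[OF u]) (use \<open>a \<ge> 0\<close> in auto)
    have "norm (u s - u a) \<le> e / 2" if "s \<in> {a..a + r}" for s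
      using d(2)[of s] that r \<open>a \<ge> 0\<close> by (simp add: dist_norm)
    then have "norm (integral {a..a + r} (\<lambda>s. u s - u a)) \<le> e / 2 * (a + r - a)"
      using r by (intro integral_bound continuous_intros c) auto
    also have "integral {a..a + r} (\<lambda>s. u s - u a) = integral {a..a + r} u - r *\<^sub>R u a"
      using r by (subst integral_diff) (auto intro!: integrable_continuous_real c)
    finally have *: "norm (integral {a..a + r} u - r *\<^sub>R u a) \<le> e / 2 * r" by simp
    have "(1 / r) *\<^sub>R integral {a..a + r} u - u a = (1 / r) *\<^sub>R (integral {a..a + r} u - r *\<^sub>R u a)"
      using r by (simp add: algebra_simps)
    then have "dist ((1 / r) *\<^sub>R integral {a..a + r} u) (u a) = norm (integral {a..a + r} u - r *\<^sub>R u a) / r"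
      using r by (simp add: dist_norm)
    also have "\<dots> \<le> e / 2" using * r by (simp add: field_simps)
    finally show ?thesis using \<open>e > 0\<close> by simp
  qed
  then show "\<forall>\<^sub>F r in at_right 0. dist ((1 / r) *\<^sub>R integral {a..a + r} u) (u a) < e"
    using d(1) unfolding eventually_at_right_field by auto
qed

text \<open>One implicit Euler step: up to o(h), \<open>T s \<phi>\<close> equals
  \<open>T (s + h) \<phi> - h *\<^sub>R T (s + h) \<psi>\<close>. Dissipativity at the later time
  \<open>s + h\<close> therefore shows that the norm grows by at most o(h).\<close>

lemma (in c0_semigroup) dissipative_imp_contraction:
  assumes diss: "\<And>\<phi> \<psi> h. (\<phi>, \<psi>) \<in> generator_on UNIV T \<Longrightarrow> h > 0 \<Longrightarrow> norm \<phi> \<le> norm (\<phi> - h *\<^sub>R \<psi>)"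
    and gen: "(\<phi>, \<psi>) \<in> generator_on UNIV T" and "t \<ge> 0"
  shows "norm (T t \<phi>) \<le> norm \<phi>"
proof -
  have "norm (T t \<phi>) \<le> norm (T 0 \<phi>) + 0 * t"
  proof (rule right_Dini_bound)
    show "continuous_on {0..} (\<lambda>s. norm (T s \<phi>))" by (intro continuous_intros continuous_on_orbit)
    show "\<forall>\<^sub>F h in at_right 0. norm (T (s + h) \<phi>) \<le> norm (T s \<phi>) + h * (0 + e)"
      if s: "s \<ge> 0" "s < t" "e > 0" for s e
    proof -
      have "((\<lambda>h. norm ((1 / h) *\<^sub>R (T (s + h) \<phi> - T s \<phi>) - T (s + h) \<psi>)) \<longlongrightarrow> norm (T s \<psi> - T s \<psi>)) (at_right 0)"
        by (intro tendsto_intros generator_orbit gen s tendsto_right)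
      then have "\<forall>\<^sub>F h in at_right 0. norm ((1 / h) *\<^sub>R (T (s + h) \<phi> - T s \<phi>) - T (s + h) \<psi>) < e"
        by (rule order_tendstoD) (use s in simp)
      then show ?thesis using eventually_at_right_less[of 0]
      proof eventually_elim
        case (elim h)
        have "T (s + h) \<phi> - h *\<^sub>R T (s + h) \<psi> = T s \<phi> + h *\<^sub>R ((1 / h) *\<^sub>R (T (s + h) \<phi> - T s \<phi>) - T (s + h) \<psi>)"
          using elim by (simp add: algebra_simps)
        then have "norm (T (s + h) \<phi> - h *\<^sub>R T (s + h) \<psi>)
            \<le> norm (T s \<phi>) + norm (h *\<^sub>R ((1 / h) *\<^sub>R (T (s + h) \<phi> - T s \<phi>) - T (s + h) \<psi>))"
          by (metis norm_triangle_ineq)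
        also have "\<dots> \<le> norm (T s \<phi>) + h * e" using elim by simp
        finally show ?case
          using diss[OF generator_orbit(1)[OF gen, of "s + h"] elim(2)] s elim by simp
      qed
    qed
  qed (rule \<open>t \<ge> 0\<close>)
  then show ?thesis by simp
qed

section \<open>Orbit averages and density of the domain in a Banach space\<close>

locale banach_c0_semigroup = c0_semigroup T for T :: "real \<Rightarrow> 'a::banach \<Rightarrow> 'a"
begin

lemma integrable_orbit: "0 \<le> a \<Longrightarrow> (\<lambda>s. T s \<phi>) integrable_on {a..b}"
  by (intro integrable_continuous_real continuous_on_subset[OF continuous_on_orbit]) auto

text \<open>Applying \<open>T r\<close> shifts the interval of integration by \<open>r\<close>, so
  only the pieces over \<open>{h..h + r}\<close> and \<open>{0..r}\<close> fail to cancel; divided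
  by \<open>r\<close>, they converge to the endpoint values of the orbit.\<close>

lemma generator_integral:
  assumes "h \<ge> 0"
  shows "(integral {0..h} (\<lambda>s. T s \<phi>), T h \<phi> - \<phi>) \<in> generator_on UNIV T"
proof -
  let ?u = "\<lambda>s. T s \<phi>"
  have *: "(1 / r) *\<^sub>R integral {h..h + r} ?u - (1 / r) *\<^sub>R integral {0..0 + r} ?u
      = (1 / r) *\<^sub>R (T r (integral {0..h} ?u) - integral {0..h} ?u)" if "r > 0" for r
  proof -
    have "T r (integral {0..h} ?u) = integral {0..h} (\<lambda>s. T r (T s \<phi>))"
      using integral_linear[OF integrable_orbit bounded_linear, of 0 r h \<phi>] that by (simp add: o_def)
    also have "\<dots> = integral {0..h} (\<lambda>s. ?u (s + r))"
      by (intro integral_cong) (use that in \<open>simp add: add[symmetric] add.commute\<close>)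
    also have "\<dots> = integral {r..h + r} ?u"
      using integral_shift_Icc_real[of 0 h ?u r] by (simp add: o_def add.commute)
    finally have 1: "T r (integral {0..h} ?u) = integral {r..h + r} ?u" .
    have 2: "integral {0..r} ?u + integral {r..h + r} ?u = integral {0..h} ?u + integral {h..h + r} ?u"
      using Henstock_Kurzweil_Integration.integral_combine[of 0 r "h + r" ?u]
        Henstock_Kurzweil_Integration.integral_combine[of 0 h "h + r" ?u] that assms
        integrable_orbit[of 0] by simp
    have "integral {h..h + r} ?u - integral {0..r} ?u = T r (integral {0..h} ?u) - integral {0..h} ?u"
      using 2 unfolding 1 by (simp add: algebra_simps)
    then show ?thesis by (simp flip: scaleR_right_diff_distrib)
  qed
  have "((\<lambda>r. (1 / r) *\<^sub>R integral {h..h + r} ?u - (1 / r) *\<^sub>R integral {0..0 + r} ?u)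
      \<longlongrightarrow> T h \<phi> - T 0 \<phi>) (at_right 0)"
    by (intro tendsto_diff tendsto_average_at_right continuous_on_orbit assms) auto
  then have "((\<lambda>r. (1 / r) *\<^sub>R (T r (integral {0..h} ?u) - integral {0..h} ?u)) \<longlongrightarrow> T h \<phi> - T 0 \<phi>) (at_right 0)"
    by (rule tendsto_at_right_0_cong) (rule *)
  then show ?thesis by (simp add: generator_on_def)
qed

lemma generator_average:
  assumes "h > 0"
  shows "((1 / h) *\<^sub>R integral {0..h} (\<lambda>s. T s \<phi>), (1 / h) *\<^sub>R (T h \<phi> - \<phi>)) \<in> generator_on UNIV T"
  using subspace_scale[OF generator_subspace generator_integral[of h \<phi>], of "1 / h"] assms by simp

lemma average_close:
  assumes "e > 0"
  shows "\<exists>h>0. dist ((1 / h) *\<^sub>R integral {0..h} (\<lambda>s. T s \<phi>)) \<phi> < e"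
proof -
  have "((\<lambda>r. (1 / r) *\<^sub>R integral {0..0 + r} (\<lambda>s. T s \<phi>)) \<longlongrightarrow> T 0 \<phi>) (at_right 0)"
    by (intro tendsto_average_at_right continuous_on_orbit) simp
  from tendstoD[OF this assms]
  have "\<forall>\<^sub>F h in at_right 0. 0 < h \<and> dist ((1 / h) *\<^sub>R integral {0..h} (\<lambda>s. T s \<phi>)) \<phi> < e"
    using eventually_at_right_less[of 0] by eventually_elim simp
  from eventually_happens'[OF trivial_limit_at_right_real this] show ?thesis by auto
qed

lemma generator_dense:
  assumes "e > 0"
  obtains \<phi>' \<psi> where "(\<phi>', \<psi>) \<in> generator_on UNIV T" "dist \<phi>' \<phi> < e"
  using average_close[OF assms, of \<phi>] generator_average by blast

text \<open>Averaging a second time: if \<open>\<phi>1\<close> is already in the domain, the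
  generator sends its average to a difference quotient of its orbit, which is again in the domain.
  Such elements have orbits along which correctors can be both differentiated in time and inserted
  into \<open>G\<close>.\<close>

lemma generator_square_dense:
  assumes "e > 0"
  obtains \<phi>' \<psi> \<theta> where "(\<phi>', \<psi>) \<in> generator_on UNIV T" "(\<psi>, \<theta>) \<in> generator_on UNIV T" "dist \<phi>' \<phi> < e"
proof -
  obtain \<phi>1 \<psi>1 where 1: "(\<phi>1, \<psi>1) \<in> generator_on UNIV T" "dist \<phi>1 \<phi> < e / 2"
    using generator_dense[of "e / 2" \<phi>] assms by auto
  obtain h where h: "h > 0" "dist ((1 / h) *\<^sub>R integral {0..h} (\<lambda>s. T s \<phi>1)) \<phi>1 < e / 2"
    using average_close[of "e / 2"] assms by auto
  have "((1 / h) *\<^sub>R (T h \<phi>1 - \<phi>1), (1 / h) *\<^sub>R (T h \<psi>1 - \<psi>1)) \<in> generator_on UNIV T"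
    using subspace_scale[OF generator_subspace
        subspace_diff[OF generator_subspace generator_orbit(1)[OF 1(1), of h] 1(1)], of "1 / h"] h by simp
  moreover have "dist ((1 / h) *\<^sub>R integral {0..h} (\<lambda>s. T s \<phi>1)) \<phi> < e"
    using dist_triangle_half_l h(2) 1(2) by (metis dist_commute)
  ultimately show thesis using that generator_average[OF h(1)] by blast
qed

text \<open>The estimate on the dense domain extends because \<open>T t\<close> is continuous at the
  fixed time \<open>t\<close>.\<close>

lemma dissipative_imp_contractive:
  assumes diss: "\<And>\<phi> \<psi> h. (\<phi>, \<psi>) \<in> generator_on UNIV T \<Longrightarrow> h > 0 \<Longrightarrow> norm \<phi> \<le> norm (\<phi> - h *\<^sub>R \<psi>)"
    and "t \<ge> 0"
  shows "norm (T t \<phi>) \<le> norm \<phi>"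
proof -
  have "\<exists>\<phi>'. (\<exists>\<psi>. (\<phi>', \<psi>) \<in> generator_on UNIV T) \<and> dist \<phi>' \<phi> < 1 / Suc n" for n
  proof -
    have "1 / real (Suc n) > 0" by simp
    from generator_dense[OF this, of \<phi>] show ?thesis by metis
  qed
  then have "\<exists>f. \<forall>n. (\<exists>\<psi>. (f n, \<psi>) \<in> generator_on UNIV T) \<and> dist (f n) \<phi> < 1 / Suc n"
    by (intro choice) blast
  then obtain f where f: "\<And>n. (\<exists>\<psi>. (f n, \<psi>) \<in> generator_on UNIV T)" "\<And>n. dist (f n) \<phi> < 1 / Suc n"
    by blast
  have lim: "f \<longlonglongrightarrow> \<phi>"
    unfolding tendsto_dist_iff[of f]
  proof (rule real_tendsto_sandwich[where f = "\<lambda>_. 0" and h = "\<lambda>n. 1 / Suc n"])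
    show "(\<lambda>n. 1 / real (Suc n)) \<longlonglongrightarrow> 0"
      using LIMSEQ_inverse_real_of_nat by (simp add: inverse_eq_divide)
  qed (use f(2) in \<open>auto intro!: always_eventually less_imp_le\<close>)
  show ?thesis
  proof (rule LIMSEQ_le)
    show "(\<lambda>n. norm (T t (f n))) \<longlonglongrightarrow> norm (T t \<phi>)"
      by (intro tendsto_norm bounded_linear.tendsto[OF bounded_linear] lim) fact
    show "(\<lambda>n. norm (f n)) \<longlonglongrightarrow> norm \<phi>" by (intro tendsto_norm lim)
    show "\<exists>N. \<forall>n\<ge>N. norm (T t (f n)) \<le> norm (f n)"
      using f(1) dissipative_imp_contraction[OF diss] \<open>t \<ge> 0\<close> by blast
  qed
qed

end

section \<open>The spaces \<open>L\<^sup>1\<close>\<close>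

lemma L1_exhaust:
  obtains f where "integrable ref f" "a = L1_class f"
proof -
  have "\<exists>f. integrable ref f \<and> a = L1_class f"
    using Quotient_L1 unfolding Quotient_def by (metis)
  then show thesis using that by blast
qed

lemma L1_class_eq_iff:
  "integrable ref f \<Longrightarrow> integrable ref g \<Longrightarrow> L1_class f = L1_class g \<longleftrightarrow> (AE x in ref. f x = g x)"
  using Quotient_rel_abs[OF Quotient_L1] Quotient_rel[OF Quotient_L1, of f g] by auto


lemma
  assumes "integrable ref f"
  shows norm_L1_class: "norm (L1_class f) = (\<integral>x. \<bar>f x\<bar> \<partial>ref)"
    and L1_class_scale: "c *\<^sub>R L1_class f = L1_class (\<lambda>x. c * f x)"
    and L1_class_uminus: "- L1_class f = L1_class (\<lambda>x. - f x)"
    and L1_class_plus: "integrable ref g \<Longrightarrow> L1_class f + L1_class g = L1_class (\<lambda>x. f x + g x)"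
    and L1_class_minus: "integrable ref g \<Longrightarrow> L1_class f - L1_class g = L1_class (\<lambda>x. f x - g x)"
  using assms by (simp_all add: norm_L1.abs_eq scaleR_L1.abs_eq uminus_L1.abs_eq plus_L1.abs_eq minus_L1.abs_eq)

lemma B_class: "integrable ref f \<Longrightarrow> B (L1_class f) = L1_class (\<lambda>(x, i). f (x, - i))"
  by (simp add: B.abs_eq)

lemma J_class: "integrable ref f \<Longrightarrow> J (L1_class f) = L1_class (\<lambda>(x, i). f x / 2)"
  by (simp add: J.abs_eq)

lemma L1_class_sum:
  assumes "\<And>n. integrable ref (f n)"
  shows "(\<Sum>n<N. L1_class (f n)) = L1_class (\<lambda>x. \<Sum>n<(N::nat). f n x)"
proof (induction N)
  case 0 show ?case by (simp add: zero_L1_def)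
next
  case (Suc N) then show ?case by (simp add: L1_class_plus assms)
qed

section \<open>Completeness of \<open>L1\<close>\<close>

lemma AE_summable_of_summable_integral:
  fixes f :: "nat \<Rightarrow> 'a \<Rightarrow> real"
  assumes f: "\<And>n. integrable M (f n)" and s: "summable (\<lambda>n. \<integral>x. \<bar>f n x\<bar> \<partial>M)"
  shows "AE x in M. summable (\<lambda>n. \<bar>f n x\<bar>)"
proof -
  have [measurable]: "f n \<in> borel_measurable M" for n using f by auto
  have "(\<integral>\<^sup>+x. (\<Sum>n. ennreal \<bar>f n x\<bar>) \<partial>M) = (\<Sum>n. \<integral>\<^sup>+x. ennreal \<bar>f n x\<bar> \<partial>M)"
    by (rule nn_integral_suminf) auto
  also have "\<dots> = (\<Sum>n. ennreal (\<integral>x. \<bar>f n x\<bar> \<partial>M))"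
    using f by (intro suminf_cong nn_integral_eq_integral) auto
  also have "\<dots> = ennreal (\<Sum>n. \<integral>x. \<bar>f n x\<bar> \<partial>M)"
    using s by (intro suminf_ennreal2) auto
  finally have "(\<integral>\<^sup>+x. (\<Sum>n. ennreal \<bar>f n x\<bar>) \<partial>M) \<noteq> \<infinity>" by simp
  then have "AE x in M. (\<Sum>n. ennreal \<bar>f n x\<bar>) \<noteq> \<infinity>"
    by (intro nn_integral_noteq_infinite) auto
  then show ?thesis
    by eventually_elim (auto intro: summable_suminf_not_top)
qed

lemma Cauchy_geometric_subsequence:
  fixes X :: "nat \<Rightarrow> 'a::metric_space"
  assumes "Cauchy X"
  obtains r :: "nat \<Rightarrow> nat" where "strict_mono r" "\<And>n. dist (X (r (Suc n))) (X (r n)) < (1 / 2) ^ n"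
proof -
  have ex: "\<exists>N. \<forall>m\<ge>N. \<forall>k\<ge>N. dist (X m) (X k) < (1 / 2) ^ n" for n
    using assms unfolding Cauchy_def by simp
  have "\<exists>r. \<forall>n. (\<forall>m\<ge>r n. \<forall>k\<ge>r n. dist (X m) (X k) < (1 / 2) ^ n) \<and> r n < r (Suc n)"
  proof (rule dependent_nat_choice[where P = "\<lambda>n N. \<forall>m\<ge>N. \<forall>k\<ge>N. dist (X m) (X k) < (1 / 2) ^ n" and Q = "\<lambda>_ x y. x < y"])
    fix x :: nat and n
    obtain N where "\<forall>m\<ge>N. \<forall>k\<ge>N. dist (X m) (X k) < (1 / 2) ^ Suc n" using ex by blast
    then show "\<exists>y. (\<forall>m\<ge>y. \<forall>k\<ge>y. dist (X m) (X k) < (1 / 2) ^ Suc n) \<and> x < y"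
      by (intro exI[of _ "max N (Suc x)"]) auto
  qed (rule ex)
  then obtain r where r: "\<And>n m k. m \<ge> r n \<Longrightarrow> k \<ge> r n \<Longrightarrow> dist (X m) (X k) < (1 / 2) ^ n" "\<And>n. r n < r (Suc n)"
    by blast
  show thesis
  proof
    show "strict_mono r" using r(2) by (simp add: strict_mono_Suc_iff)
    show "dist (X (r (Suc n))) (X (r n)) < (1 / 2) ^ n" for n
      using r(2)[of n] by (intro r(1)) auto
  qed
qed

text \<open>The Riesz-Fischer argument: along a subsequence with geometrically small increments the
  series of increments converges absolutely almost everywhere, and the sum of absolute values serves
  as the dominating function. Completeness is what gives orbit integrals a meaning.\<close>

instance L1 :: (ref_measure) banach
proof
  fix X :: "nat \<Rightarrow> 'a L1"
  assume "Cauchy X"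
  then obtain r where r: "strict_mono r" "\<And>n. dist (X (r (Suc n))) (X (r n)) < (1 / 2) ^ n"
    using Cauchy_geometric_subsequence by blast
  have "\<exists>f. integrable ref f \<and> X (r (Suc n)) - X (r n) = L1_class f" for n
    using L1_exhaust by metis
  then obtain f where f: "\<And>n. integrable ref (f n)" "\<And>n. X (r (Suc n)) - X (r n) = L1_class (f n)"
    by metis
  have "norm (L1_class (f n)) \<le> (1 / 2) ^ n" for n
    using r(2)[of n] by (simp add: dist_norm f(2))
  then have "summable (\<lambda>n. \<integral>x. \<bar>f n x\<bar> \<partial>ref)"
    using f(1) by (intro summable_comparison_test[OF _ summable_geometric[of "1 / 2"]]) (auto simp: norm_L1_class)
  note sm = this AE_summable_of_summable_integral[OF f(1) this]
  define g where "g x = (\<Sum>n. f n x)" for x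
  define h where "h x = (\<Sum>n. \<bar>f n x\<bar>)" for x
  have g: "integrable ref g" and h: "integrable ref h"
    unfolding g_def[abs_def] h_def[abs_def]
    by (rule integrable_suminf; use f sm in simp)+
  have [measurable]: "f n \<in> borel_measurable ref" for n using f by auto
  have "(\<lambda>N. \<integral>x. \<bar>(\<Sum>n<N. f n x) - g x\<bar> \<partial>ref) \<longlonglongrightarrow> (\<integral>x. \<bar>g x - g x\<bar> \<partial>ref)"
  proof (rule integral_dominated_convergence)
    show "integrable ref (\<lambda>x. h x + \<bar>g x\<bar>)" using g h by simp
    show "AE x in ref. (\<lambda>N. \<bar>(\<Sum>n<N. f n x) - g x\<bar>) \<longlonglongrightarrow> \<bar>g x - g x\<bar>"
      using sm(2)
    proof eventually_elim
      case (elim x)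
      show ?case
        using summable_LIMSEQ[OF summable_rabs_cancel[OF elim]] by (intro tendsto_intros) (simp add: g_def)
    qed
    fix N
    show "AE x in ref. norm \<bar>(\<Sum>n<N. f n x) - g x\<bar> \<le> h x + \<bar>g x\<bar>"
      using sm(2)
    proof eventually_elim
      case (elim x)
      have "\<bar>\<Sum>n<N. f n x\<bar> \<le> (\<Sum>n<N. \<bar>f n x\<bar>)" by (rule sum_abs)
      also have "\<dots> \<le> h x" unfolding h_def by (intro sum_le_suminf elim) auto
      finally show ?case by simp
    qed
  qed (use f g in auto)
  then have "(\<lambda>N. dist (L1_class (\<lambda>x. \<Sum>n<N. f n x)) (L1_class g)) \<longlonglongrightarrow> 0"
    using f g by (simp add: dist_norm L1_class_minus norm_L1_class)
  then have "(\<lambda>N. L1_class (\<lambda>x. \<Sum>n<N. f n x)) \<longlonglongrightarrow> L1_class g"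
    by (simp add: tendsto_dist_iff[of _ "L1_class g"])
  then have "(\<lambda>N. X (r 0) + L1_class (\<lambda>x. \<Sum>n<N. f n x)) \<longlonglongrightarrow> X (r 0) + L1_class g"
    by (intro tendsto_intros)
  moreover have "X (r 0) + L1_class (\<lambda>x. \<Sum>n<N. f n x) = (X \<circ> r) N" for N
    using sum_lessThan_telescope[of "\<lambda>n. X (r n)" N] by (simp add: f(2) flip: L1_class_sum[of f, OF f(1)])
  ultimately have "(X \<circ> r) \<longlonglongrightarrow> X (r 0) + L1_class g" by (simp add: o_def)
  then show "convergent X"
    using Cauchy_converges_subseq[OF \<open>Cauchy X\<close> r(1)] unfolding convergent_def by blast
qed

section \<open>Functions on \<open>S\<close> and the operators \<open>B\<close>, \<open>J\<close>
  and \<open>P\<close>\<close>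

lemma sum_UNIV_sign: "(\<Sum>i\<in>(UNIV :: sign set). f i) = f 1 + f (- 1)"
  by (simp add: UNIV_sign one_neq_minus_one_sign)

lemma borel_measurable_S:
  assumes "\<And>i. (\<lambda>x. f (x, i)) \<in> borel_measurable lborel"
  shows "(f :: S \<Rightarrow> real) \<in> borel_measurable ref"
proof -
  have "f = (\<lambda>(x, i). \<Sum>j\<in>UNIV. f (x, j) * of_bool (i = j))"
    by (auto simp: of_bool_def fun_eq_iff if_distrib cong: if_cong)
  also have "\<dots> \<in> borel_measurable ref"
    unfolding ref_S case_prod_beta'
  proof (intro borel_measurable_sum borel_measurable_times)
    fix j
    show "(\<lambda>z. f (fst z, j)) \<in> borel_measurable (lborel \<Otimes>\<^sub>M count_space UNIV)"
      by (rule measurable_compose[OF measurable_fst assms])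
    show "(\<lambda>z. of_bool (snd z = j) :: real) \<in> borel_measurable (lborel \<Otimes>\<^sub>M count_space (UNIV :: sign set))"
      using measurable_compose[OF measurable_snd, of "\<lambda>i. of_bool (i = j) :: real" "count_space UNIV" borel lborel] by simp
  qed
  finally show ?thesis .
qed

lemma integrable_S_section:
  assumes "integrable ref (f :: S \<Rightarrow> real)"
  shows "integrable lborel (\<lambda>x. f (x, i))"
proof -
  interpret pair_sigma_finite lborel "count_space (UNIV :: sign set)" by (rule pair_sigma_finite_S)
  have f: "integrable (lborel \<Otimes>\<^sub>M count_space UNIV) f" using assms by (simp add: ref_S)
  then have [measurable]: "f \<in> borel_measurable (lborel \<Otimes>\<^sub>M count_space UNIV)" by auto
  have "integrable lborel (\<lambda>x. \<integral>i. norm (f (x, i)) \<partial>count_space UNIV)"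
    using integrable_fst'[OF integrable_norm[OF f]] by simp
  then have "integrable lborel (\<lambda>x. \<Sum>j\<in>UNIV. \<bar>f (x, j)\<bar>)"
    by (simp add: lebesgue_integral_count_space_finite)
  moreover have "\<bar>f (x, i)\<bar> \<le> (\<Sum>j\<in>UNIV. \<bar>f (x, j)\<bar>)" for x
    by (rule member_le_sum) auto
  ultimately show ?thesis
    by (rule_tac Bochner_Integration.integrable_bound) (auto simp: sum_nonneg)
qed

lemma integrable_S_iff:
  fixes f :: "S \<Rightarrow> real"
  shows "integrable ref f \<longleftrightarrow> (\<forall>i. integrable lborel (\<lambda>x. f (x, i)))"
proof safe
  interpret pair_sigma_finite lborel "count_space (UNIV :: sign set)" by (rule pair_sigma_finite_S)
  assume *: "\<forall>i. integrable lborel (\<lambda>x. f (x, i))"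
  have "f \<in> borel_measurable ref" by (rule borel_measurable_S) (use * borel_measurable_integrable in blast)
  then show "integrable ref f"
    unfolding ref_S using *
    by (intro Fubini_integrable)
       (auto simp: lebesgue_integral_count_space_finite integrable_count_space)
qed (rule integrable_S_section)

lemma integral_S:
  fixes f :: "S \<Rightarrow> real"
  assumes "integrable ref f"
  shows "(\<integral>z. f z \<partial>ref) = (\<integral>x. f (x, 1) \<partial>lborel) + (\<integral>x. f (x, - 1) \<partial>lborel)"
proof -
  interpret pair_sigma_finite lborel "count_space (UNIV :: sign set)" by (rule pair_sigma_finite_S)
  have "(\<integral>z. f z \<partial>ref) = (\<integral>x. \<integral>i. f (x, i) \<partial>count_space UNIV \<partial>lborel)"
    using integral_fst'[of f] assms by (simp add: ref_S)
  also have "\<dots> = (\<integral>x. f (x, 1) + f (x, - 1) \<partial>lborel)"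
    by (simp add: lebesgue_integral_count_space_finite sum_UNIV_sign)
  finally show ?thesis using assms by (simp add: integrable_S_section)
qed

lemma norm_S_class:
  fixes f :: "S \<Rightarrow> real"
  assumes "integrable ref f"
  shows "norm (L1_class f) = (\<integral>x. \<bar>f (x, 1)\<bar> \<partial>lborel) + (\<integral>x. \<bar>f (x, - 1)\<bar> \<partial>lborel)"
  using assms by (simp add: norm_L1_class integral_S)

lemma bounded_linear_B: "bounded_linear B"
  and norm_B [simp]: "norm (B \<phi>) = norm \<phi>"
  and B_B [simp]: "B (B \<phi>) = \<phi>"
proof -
  show n: "norm (B \<phi>) = norm \<phi>" for \<phi>
  proof -
    obtain f where f: "integrable ref f" "\<phi> = L1_class f" by (rule L1_exhaust)
    from f(1) integrable_flip[OF f(1)] show ?thesis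
      by (simp add: f(2) B_class norm_S_class sign_minus_minus)
  qed
  show "bounded_linear B"
  proof (rule bounded_linear_intro[where K = 1])
    fix \<phi> \<psi> :: "S L1" and c :: real
    obtain f g where f: "integrable ref f" "\<phi> = L1_class f" and g: "integrable ref g" "\<psi> = L1_class g"
      by (metis L1_exhaust)
    note i = integrable_flip[OF f(1)] integrable_flip[OF g(1)]
    show "B (\<phi> + \<psi>) = B \<phi> + B \<psi>"
      using f(1) g(1) i by (simp add: f(2) g(2) B_class L1_class_plus case_prod_beta')
    show "B (c *\<^sub>R \<phi>) = c *\<^sub>R B \<phi>"
      using f(1) i by (simp add: f(2) B_class L1_class_scale case_prod_beta')
  qed (simp add: n)
  show "B (B \<phi>) = \<phi>" by transfer (simp add: sign_minus_minus case_prod_beta')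
qed

lemma bounded_linear_J: "bounded_linear J"
  and norm_J [simp]: "norm (J \<phi>) = norm \<phi>"
proof -
  show n: "norm (J \<phi>) = norm \<phi>" for \<phi>
  proof -
    obtain f where f: "integrable ref f" "\<phi> = L1_class f" by (rule L1_exhaust)
    from f(1) integrable_lift_S[of f] show ?thesis
      by (simp add: f(2) J_class norm_S_class norm_L1_class ref_real_def)
  qed
  show "bounded_linear J"
  proof (rule bounded_linear_intro[where K = 1])
    fix \<phi> \<psi> :: "real L1" and c :: real
    obtain f g where f: "integrable ref f" "\<phi> = L1_class f" and g: "integrable ref g" "\<psi> = L1_class g"
      by (metis L1_exhaust)
    note i = integrable_lift_S[of f] integrable_lift_S[of g]
    show "J (\<phi> + \<psi>) = J \<phi> + J \<psi>"
      using f(1) g(1) i by (simp add: f(2) g(2) J_class L1_class_plus ref_real_def case_prod_beta' add_divide_distrib)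
    show "J (c *\<^sub>R \<phi>) = c *\<^sub>R J \<phi>" 
      using f(1) i by (simp add: f(2) J_class L1_class_scale ref_real_def case_prod_beta')
  qed (simp add: n)
qed

lemma inj_J: "J \<phi> = J \<psi> \<longleftrightarrow> \<phi> = \<psi>"
proof
  assume "J \<phi> = J \<psi>"
  then have "J (\<phi> - \<psi>) = 0" by (simp add: linear_simps[OF bounded_linear_J])
  then show "\<phi> = \<psi>" by (metis norm_J norm_eq_zero right_minus_eq)
qed simp

lemma L0_eq_range_J: "L0 = range J"
proof (intro subset_antisym subsetI)
  fix \<phi> assume "\<phi> \<in> L0"
  then obtain f where f: "\<phi> = L1_class f" "integrable ref f" "\<And>x. f (x, 1) = f (x, - 1)"
    by (auto simp: L0_def)
  have "f = (\<lambda>(x, i). 2 * f (x, 1) / 2)"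
    using f(3) sign_cases by (auto simp: fun_eq_iff) (metis)
  then have "\<phi> = J (L1_class (\<lambda>x. 2 * f (x, 1)))"
    using integrable_S_section[OF f(2), of 1] f(1) by (simp add: J_class ref_real_def)
  then show "\<phi> \<in> range J" by blast
next
  fix \<phi> assume "\<phi> \<in> range J"
  then obtain \<psi> where "\<phi> = J \<psi>" by blast
  moreover obtain f where f: "integrable ref f" "\<psi> = L1_class f" by (rule L1_exhaust)
  ultimately show "\<phi> \<in> L0"
    using integrable_lift_S[of f] by (auto simp: L0_def J_class ref_real_def case_prod_beta' intro!: exI[of _ "\<lambda>z. f (fst z) / 2"])
qed

text \<open>Membership in \<open>L0\<close> asks for a representative that is symmetric everywhere,
  while \<open>B \<phi> = \<phi>\<close> gives symmetry only almost everywhere; averaging a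
  representative with its flip closes the gap.\<close>

lemma L0_iff_B: "\<phi> \<in> L0 \<longleftrightarrow> B \<phi> = \<phi>"
proof
  assume "\<phi> \<in> L0"
  then obtain f where f: "\<phi> = L1_class f" "integrable ref f" "\<And>x. f (x, 1) = f (x, - 1)"
    by (auto simp: L0_def)
  have "(\<lambda>(x, i). f (x, - i)) = f"
    using f(3) sign_cases by (auto simp: fun_eq_iff sign_minus_minus) (metis sign_minus_minus)
  then show "B \<phi> = \<phi>" using f by (simp add: B_class)
next
  assume B: "B \<phi> = \<phi>"
  obtain f where f: "integrable ref f" "\<phi> = L1_class f" by (rule L1_exhaust)
  have "\<phi> = (1 / 2) *\<^sub>R (B \<phi> + \<phi>)" by (simp add: B flip: scaleR_2)
  also have "\<dots> = L1_class (\<lambda>z. 1 / 2 * ((case z of (x, i) \<Rightarrow> f (x, - i)) + f z))"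
    using f(1) integrable_flip[OF f(1)] by (simp add: f(2) B_class L1_class_plus L1_class_scale)
  finally show "\<phi> \<in> L0"
    using f(1) integrable_flip[OF f(1)] unfolding L0_def
    by (intro CollectI exI[of _ "\<lambda>z. 1 / 2 * ((case z of (x, i) \<Rightarrow> f (x, - i)) + f z)"] conjI)
       (auto simp: sign_minus_minus)
qed

lemma P_in_L0: "P \<phi> \<in> L0"
  by (simp add: L0_iff_B P_def linear_simps[OF bounded_linear_B] add.commute)

lemma P_L0: "\<phi> \<in> L0 \<Longrightarrow> P \<phi> = \<phi>"
  by (simp add: L0_iff_B P_def flip: scaleR_2)

section \<open>Absolutely continuous functions\<close>

text \<open>Measuring both increments from \<open>x\<close> keeps the error proportional to
  \<open>v - u\<close>, since \<open>v - x\<close> and \<open>x - u\<close> are nonnegative and add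
  up to it.\<close>

lemma straddle_real:
  fixes f :: "real \<Rightarrow> real"
  assumes "(f has_real_derivative c) (at x)" "e > 0"
  obtains d where "d > 0"
    "\<And>u v. u \<le> x \<Longrightarrow> x \<le> v \<Longrightarrow> {u..v} \<subseteq> ball x d \<Longrightarrow> \<bar>(v - u) * c - (f v - f u)\<bar> \<le> e * (v - u)"
proof -
  from assms obtain d where d: "d > 0"
    "\<And>y. \<bar>y - x\<bar> < d \<Longrightarrow> \<bar>f y - f x - c * (y - x)\<bar> \<le> e * \<bar>y - x\<bar>"
    unfolding has_field_derivative_def has_derivative_at_alt by (auto simp: mult.commute)
  show thesis
  proof
    fix u v assume uv: "u \<le> x" "x \<le> v" "{u..v} \<subseteq> ball x d"
    then have "u \<in> ball x d" "v \<in> ball x d" by (auto intro: subsetD[OF uv(3)] simp del: mem_ball)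
    then have "\<bar>f v - f x - c * (v - x)\<bar> \<le> e * \<bar>v - x\<bar>" "\<bar>f u - f x - c * (u - x)\<bar> \<le> e * \<bar>u - x\<bar>"
      by (auto intro!: d(2) simp: dist_real_def)
    with uv have "\<bar>f v - f x - c * (v - x)\<bar> \<le> e * (v - x)" "\<bar>f u - f x - c * (u - x)\<bar> \<le> e * (x - u)"
      by auto
    then show "\<bar>(v - u) * c - (f v - f u)\<bar> \<le> e * (v - u)" by (simp add: algebra_simps abs_le_iff)
  qed (rule d)
qed

text \<open>
  The gauge integral of \<open>g\<close>: on tags outside the exceptional null set the straddle estimate applies, while
  the remaining intervals lie in an open set of small measure and contribute little by absolute continuity.
\<close>

lemma absolutely_continuous_fun_on_FTC:
  fixes f g :: "real \<Rightarrow> real"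
  assumes ac: "absolutely_continuous_fun_on I f" and I: "{a..b} \<subseteq> I" and "a \<le> b"
    and deriv: "AE x in lborel. (f has_real_derivative g x) (at x)"
  shows "(g has_integral (f b - f a)) {a..b}"
proof -
  obtain N where N: "{x. \<not> (f has_real_derivative g x) (at x)} \<subseteq> N" "N \<in> null_sets lborel"
    using deriv by (auto simp: eventually_ae_filter)
  have negl: "negligible N"
    using N(2) by (simp add: negligible_iff_null_sets null_sets_completionI)
  \<comment> \<open>On \<open>N\<close> the values of \<open>g\<close> are unrelated to
    \<open>f\<close>; setting them to 0 leaves the integral unchanged and makes the tags in
    \<open>N\<close> invisible in the Riemann sum.\<close>
  define g' where "g' x = (if x \<in> N then 0 else g x)" for x
  have "(g' has_integral (f b - f a)) (cbox a b)"
    unfolding has_integral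
  proof (intro allI impI)
    fix e :: real assume "e > 0"
    then obtain d where d: "d > 0" "\<And>(n::nat) u v. (\<forall>k<n. u k \<le> v k \<and> {u k..v k} \<subseteq> I) \<Longrightarrow>
        disjoint_family_on (\<lambda>k. {u k<..<v k}) {..<n} \<Longrightarrow> (\<Sum>k<n. v k - u k) < d \<Longrightarrow>
        (\<Sum>k<n. \<bar>f (v k) - f (u k)\<bar>) < e / 2"
      using ac[unfolded absolutely_continuous_fun_on_def, rule_format, of "e / 2"] by auto
    obtain W where W: "open W" "N \<subseteq> W" "emeasure lebesgue (W - N) < ennreal d"
      using sets_lebesgue_outer_open[OF negligible_imp_sets[OF negl] d(1)] by metis
    \<comment> \<open>Chosen so that \<open>e' * (b - a)\<close> is at most \<open>e / 2\<close>;
      the added 1 covers \<open>a = b\<close>.\<close>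
    define e' where "e' = e / (2 * (b - a + 1))"
    have e': "e' > 0" using \<open>e > 0\<close> \<open>a \<le> b\<close> by (simp add: e'_def)
    have "\<exists>r>0. (x \<in> N \<longrightarrow> ball x r \<subseteq> W) \<and> (x \<notin> N \<longrightarrow> (\<forall>u v. u \<le> x \<longrightarrow> x \<le> v \<longrightarrow> {u..v} \<subseteq> ball x r \<longrightarrow>
        \<bar>(v - u) * g x - (f v - f u)\<bar> \<le> e' * (v - u)))" for x
    proof (cases "x \<in> N")
      case True
      then obtain r where "r > 0" "ball x r \<subseteq> W" using W by (meson open_contains_ball subsetD)
      with True show ?thesis by auto
    next
      case False
      then have "(f has_real_derivative g x) (at x)" using N(1) by auto
      from straddle_real[OF this e'] obtain r where "r > 0" "\<And>u v. u \<le> x \<Longrightarrow> x \<le> v \<Longrightarrow> {u..v} \<subseteq> ball x r \<Longrightarrow>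
        \<bar>(v - u) * g x - (f v - f u)\<bar> \<le> e' * (v - u)" by metis
      with False show ?thesis by auto
    qed
    then obtain r where r: "\<And>x. r x > 0" "\<And>x. x \<in> N \<Longrightarrow> ball x (r x) \<subseteq> W"
      "\<And>x u v. x \<notin> N \<Longrightarrow> u \<le> x \<Longrightarrow> x \<le> v \<Longrightarrow> {u..v} \<subseteq> ball x (r x) \<Longrightarrow>
        \<bar>(v - u) * g x - (f v - f u)\<bar> \<le> e' * (v - u)"
      by metis
    have "norm ((\<Sum>(x, K)\<in>p. measure lborel K *\<^sub>R g' x) - (f b - f a)) < e"
      if p: "p tagged_division_of (cbox a b)" and fine: "(\<lambda>x. ball x (r x)) fine p" for p
    proof -
      note fin = tagged_division_of_finite[OF p]
      have K: "\<exists>u v. K = {u..v} \<and> u \<le> x \<and> x \<le> v \<and> {u..v} \<subseteq> {a..b} \<and> {u..v} \<subseteq> ball x (r x)" if xK: "(x, K) \<in> p" for x K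
      proof -
        obtain u v where "K = cbox u v" using tagged_division_ofD(4)[OF p xK] by blast
        with tagged_division_ofD(2,3)[OF p xK] fine xK show ?thesis
          by (intro exI[of _ u] exI[of _ v]) (auto simp: fine_def box_real)
      qed
      have len: "measure lborel K = Sup K - Inf K" if "(x, K) \<in> p" for x K
        using K[OF that] by force
      define F where "F = (\<lambda>(x :: real, K). f (Sup K) - f (Inf K))"
      have tel: "(\<Sum>z\<in>p. F z) = f b - f a"
        using additive_tagged_division_1[OF \<open>a \<le> b\<close>, of p f] p unfolding F_def by (simp add: box_real)
      have cont: "(\<Sum>(x, K)\<in>p. measure lborel K) = b - a"
        using additive_content_tagged_division[OF p] \<open>a \<le> b\<close> by (simp add: box_real)
      \<comment> \<open>The intervals tagged in \<open>N\<close> are enumerated by numbers to fit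
        the finite families in the definition of absolute continuity. The gauge keeps them inside
        \<open>W\<close>, so their total length is less than \<open>d\<close>.\<close>
      define pN where "pN = {z\<in>p. fst z \<in> N}"
      have "finite pN" using fin by (simp add: pN_def)
      then obtain h n where h: "bij_betw h {..<n::nat} pN"
        using ex_bij_betw_nat_finite atLeast0LessThan by metis
      have hp: "h k \<in> pN" if "k < n" for k using h that by (auto simp: bij_betw_def)
      define u v where "u k = Inf (snd (h k))" and "v k = Sup (snd (h k))" for k
      have uv: "u k \<le> v k \<and> {u k..v k} \<subseteq> I \<and> snd (h k) = {u k..v k} \<and> {u k..v k} \<subseteq> W" if "k < n" for k
      proof -
        obtain x K' where xk: "h k = (x, K')" by (cases "h k")
        then have "(x, K') \<in> p" "x \<in> N" using hp[OF that] by (auto simp: pN_def)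
        with K[of x K'] r(2)[of x] I show ?thesis unfolding u_def v_def xk by fastforce
      qed
      have disj: "disjoint_family_on (\<lambda>k. {u k<..<v k}) {..<n}"
        unfolding disjoint_family_on_def
      proof (intro ballI impI)
        fix j k assume jk: "j \<in> {..<n}" "k \<in> {..<n}" "j \<noteq> k"
        then have "h j \<noteq> h k" using h by (auto simp: bij_betw_def inj_on_def)
        then have "interior (snd (h j)) \<inter> interior (snd (h k)) = {}"
          using tagged_division_ofD(5)[OF p, of "fst (h j)" "snd (h j)" "fst (h k)" "snd (h k)"] hp jk
          by (auto simp: pN_def prod_eq_iff)
        then show "{u j<..<v j} \<inter> {u k<..<v k} = {}" using uv jk by (simp add: interior_atLeastAtMost_real)
      qed
      have "ennreal (\<Sum>k<n. v k - u k) = (\<Sum>k<n. ennreal (v k - u k))"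
        using uv by (intro sum_ennreal[symmetric]) auto
      also have "\<dots> = (\<Sum>k<n. emeasure lborel {u k<..<v k})"
        using uv by (intro sum.cong) auto
      also have "\<dots> = emeasure lborel (\<Union>k<n. {u k<..<v k})"
        by (intro sum_emeasure disj) auto
      also have "\<dots> \<le> emeasure lborel W"
        using uv W(1) by (intro emeasure_mono) (auto, meson atLeastAtMost_iff less_imp_le subsetD)
      also have "\<dots> = emeasure lebesgue (W - N)"
        using W(1) negl by (subst emeasure_Diff_null_set) (auto simp: negligible_iff_null_sets)
      also have "\<dots> < ennreal d" by (rule W)
      finally have "(\<Sum>k<n. v k - u k) < d" using uv by (subst (asm) ennreal_less_iff) (auto intro: sum_nonneg)
      then have ac: "(\<Sum>k<n. \<bar>f (v k) - f (u k)\<bar>) < e / 2" using uv disj by (intro d(2)) auto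
      have "(\<Sum>z\<in>pN. \<bar>F z\<bar>) = (\<Sum>k<n. \<bar>F (h k)\<bar>)"
        by (rule sum.reindex_bij_betw[OF h, symmetric])
      then have 1: "(\<Sum>z\<in>pN. \<bar>F z\<bar>) < e / 2" using ac by (simp add: F_def u_def v_def case_prod_beta')
      \<comment> \<open>A tag in \<open>N\<close> contributes its whole increment as error, because
        \<open>g'\<close> vanishes there; every other tag falls under the straddle estimate.\<close>
      have bound: "\<bar>(case z of (x, K) \<Rightarrow> measure lborel K *\<^sub>R g' x) - F z\<bar> \<le> (if fst z \<in> N then \<bar>F z\<bar> else 0) + e' * (case z of (x, K) \<Rightarrow> measure lborel K)"
        if "z \<in> p" for z
      proof -
        obtain x K' where z: "z = (x, K')" by (cases z)
        with that K[of x K'] obtain s t where st: "K' = {s..t}" "s \<le> x" "x \<le> t" "{s..t} \<subseteq> ball x (r x)" by blast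
        show ?thesis
          using st e' r(3)[OF _ st(2-4)] by (auto simp: z F_def g'_def abs_minus_commute[of "f s"])
      qed
      have "norm ((\<Sum>(x, K)\<in>p. measure lborel K *\<^sub>R g' x) - (f b - f a)) = \<bar>\<Sum>z\<in>p. (case z of (x, K) \<Rightarrow> measure lborel K *\<^sub>R g' x) - F z\<bar>"
        unfolding tel[symmetric] by (simp add: sum_subtractf)
      also have "\<dots> \<le> (\<Sum>z\<in>p. (if fst z \<in> N then \<bar>F z\<bar> else 0) + e' * (case z of (x, K) \<Rightarrow> measure lborel K))"
        by (rule order_trans[OF sum_abs sum_mono]) (rule bound)
      also have "\<dots> = (\<Sum>z\<in>pN. \<bar>F z\<bar>) + e' * (b - a)"
        unfolding cont[symmetric] pN_def using fin
        by (simp add: sum.distrib sum_distrib_left sum.inter_filter)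
      also have "e' * (b - a) \<le> e / 2"
        using \<open>e > 0\<close> \<open>a \<le> b\<close> by (simp add: e'_def divide_simps)
      finally show ?thesis using 1 by simp
    qed
    moreover have "gauge (\<lambda>x. ball x (r x))" using r(1) by (auto simp: gauge_def)
    ultimately show "\<exists>\<gamma>. gauge \<gamma> \<and> (\<forall>\<D>. \<D> tagged_division_of cbox a b \<and> \<gamma> fine \<D> \<longrightarrow>
        norm ((\<Sum>(x, k)\<in>\<D>. measure lborel k *\<^sub>R g' x) - (f b - f a)) < e)" by blast
  qed
  then show ?thesis
    by (subst has_integral_spike_eq[OF negl, of _ g']) (auto simp: g'_def box_real)
qed

lemma absolutely_continuous_fun_on_lebesgue_FTC:
  fixes f g :: "real \<Rightarrow> real"
  assumes "absolutely_continuous_fun_on I f" "{a..b} \<subseteq> I" "a \<le> b"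
    and "AE x in lborel. (f has_real_derivative g x) (at x)" "integrable lborel g"
  shows "(LBINT x:{a..b}. g x) = f b - f a"
  using absolutely_continuous_fun_on_FTC[OF assms(1-4)]
    set_borel_integral_eq_integral(2)[of "{a..b}" g] integrable_mult_indicator[OF _ assms(5), of "{a..b}"]
  by (simp add: set_integrable_def integral_unique)

text \<open>Truncation at height \<open>m\<close>: the part of the modulus of \<open>h\<close> below
  \<open>m\<close> contributes at most \<open>m\<close> times the total length, and the excess over
  \<open>m\<close> has a small integral on the whole line, wherever the intervals lie.\<close>

lemma absolutely_continuous_fun_onI_derivative:
  fixes F h :: "real \<Rightarrow> real"
  assumes h: "integrable lborel h"
    and F: "\<And>a b. a \<le> b \<Longrightarrow> {a..b} \<subseteq> I \<Longrightarrow> \<bar>F b - F a\<bar> \<le> (LBINT x:{a..b}. \<bar>h x\<bar>)"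
  shows "absolutely_continuous_fun_on I F"
  unfolding absolutely_continuous_fun_on_def
proof (intro allI impI)
  fix e :: real assume "e > 0"
  have [measurable]: "h \<in> borel_measurable lborel" using h by auto
  \<comment> \<open>The excess over height \<open>n\<close>. It vanishes at each point for large
    \<open>n\<close>, so its integral tends to 0 by dominated convergence.\<close>
  define w where "w n x = max 0 (\<bar>h x\<bar> - real n)" for n x
  have w_int: "integrable lborel (w n)" for n
    using h by (rule Bochner_Integration.integrable_bound) (auto simp: w_def[abs_def])
  have "(\<lambda>n. \<integral>x. w n x \<partial>lborel) \<longlonglongrightarrow> (\<integral>x. 0 \<partial>(lborel :: real measure))"
  proof (rule integral_dominated_convergence)
    show "integrable lborel (\<lambda>x. \<bar>h x\<bar>)" using h by simp
    have "(\<lambda>n. w n x) \<longlonglongrightarrow> 0" for x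
    proof (rule tendsto_eventually)
      obtain m where "\<bar>h x\<bar> \<le> real m" using real_arch_simple by blast
      then show "\<forall>\<^sub>F n in sequentially. w n x = 0"
        unfolding eventually_sequentially by (intro exI[of _ m]) (auto simp: w_def)
    qed
    then show "AE x in lborel. (\<lambda>n. w n x) \<longlonglongrightarrow> 0" by simp
  qed (auto simp: w_def)
  then have "\<forall>\<^sub>F n in sequentially. (\<integral>x. w n x \<partial>lborel) < e / 2"
    using \<open>e > 0\<close> by (intro order_tendstoD) auto
  then obtain m where m: "(\<integral>x. w m x \<partial>lborel) < e / 2" by (auto simp: eventually_sequentially)
  \<comment> \<open>This makes \<open>m * d\<close> at most \<open>e / 2\<close>, including the case
    \<open>m = 0\<close>.\<close>
  define d where "d = e / (2 * (real m + 1))"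
  show "\<exists>d>0. \<forall>(n::nat) a b. (\<forall>k<n. a k \<le> b k \<and> {a k..b k} \<subseteq> I) \<longrightarrow>
      disjoint_family_on (\<lambda>k. {a k<..<b k}) {..<n} \<longrightarrow> (\<Sum>k<n. b k - a k) < d \<longrightarrow>
      (\<Sum>k<n. \<bar>F (b k) - F (a k)\<bar>) < e"
  proof (intro exI[of _ d] conjI allI impI)
    show "d > 0" using \<open>e > 0\<close> by (simp add: d_def)
    fix n :: nat and a b :: "nat \<Rightarrow> real"
    assume ab: "\<forall>k<n. a k \<le> b k \<and> {a k..b k} \<subseteq> I" and disj: "disjoint_family_on (\<lambda>k. {a k<..<b k}) {..<n}"
      and len: "(\<Sum>k<n. b k - a k) < d"
    have ind: "integrable lborel (indicator {a k<..<b k} :: real \<Rightarrow> real)" for k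
      using emeasure_bounded_finite[of "{a k<..<b k}"] by (intro integrable_real_indicator) auto
    have int: "integrable lborel (\<lambda>x. indicator {a k<..<b k} x * w m x)" for k
      using integrable_mult_indicator[OF _ w_int, of "{a k<..<b k}" m] by simp
    have "\<bar>F (b k) - F (a k)\<bar> \<le> (\<integral>x. indicator {a k<..<b k} x * w m x \<partial>lborel) + m * (b k - a k)" if "k < n" for k
    proof -
      have "\<bar>F (b k) - F (a k)\<bar> \<le> (LBINT x:{a k..b k}. \<bar>h x\<bar>)" using F ab that by auto
      also have "\<dots> = (\<integral>x. indicator {a k<..<b k} x * \<bar>h x\<bar> \<partial>lborel)"
        unfolding set_lebesgue_integral_def
        by (rule integral_cong_AE)
           (use AE_lborel_singleton[of "a k"] AE_lborel_singleton[of "b k"] in \<open>auto simp: indicator_def\<close>)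
      also have "\<dots> \<le> (\<integral>x. indicator {a k<..<b k} x * w m x + real m * indicator {a k<..<b k} x \<partial>lborel)"
      proof (rule integral_mono)
        show "integrable lborel (\<lambda>x. indicator {a k<..<b k} x * \<bar>h x\<bar>)"
          using integrable_mult_indicator[of "{a k<..<b k}" lborel "\<lambda>x. \<bar>h x\<bar>"] h by simp
        show "integrable lborel (\<lambda>x. indicator {a k<..<b k} x * w m x + real m * indicator {a k<..<b k} x)"
          by (intro Bochner_Integration.integrable_add int integrable_mult_right ind)
      qed (auto simp: indicator_def w_def)
      also have "\<dots> = (\<integral>x. indicator {a k<..<b k} x * w m x \<partial>lborel) + m * (b k - a k)"
        using ab that
        by (subst Bochner_Integration.integral_add[OF int integrable_mult_right[OF ind]]) auto
      finally show ?thesis .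
    qed
    then have "(\<Sum>k<n. \<bar>F (b k) - F (a k)\<bar>) \<le> (\<Sum>k<n. (\<integral>x. indicator {a k<..<b k} x * w m x \<partial>lborel) + m * (b k - a k))"
      by (intro sum_mono) auto
    also have "\<dots> = (\<integral>x. (\<Sum>k<n. indicator {a k<..<b k} x * w m x) \<partial>lborel) + m * (\<Sum>k<n. b k - a k)"
      by (simp only: sum.distrib sum_distrib_left Bochner_Integration.integral_sum[OF int])
    also have "(\<integral>x. (\<Sum>k<n. indicator {a k<..<b k} x * w m x) \<partial>lborel) \<le> (\<integral>x. w m x \<partial>lborel)"
    proof (rule integral_mono)
      fix x
      have "(\<Sum>k<n. indicator {a k<..<b k} x :: real) = indicator (\<Union>k<n. {a k<..<b k}) x"
        by (rule indicator_UN_disjoint[symmetric]) (use disj in auto)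
      then show "(\<Sum>k<n. indicator {a k<..<b k} x * w m x) \<le> w m x"
        by (simp add: sum_distrib_right[symmetric] w_def indicator_def)
    qed (intro Bochner_Integration.integrable_sum int w_int)+
    also have "m * (\<Sum>k<n. b k - a k) \<le> m * d" using len by (intro mult_left_mono) auto
    also have "m * d \<le> e / 2" using \<open>e > 0\<close> by (simp add: d_def divide_simps)
    finally show "(\<Sum>k<n. \<bar>F (b k) - F (a k)\<bar>) < e" using m by linarith
  qed
qed

lemma absolutely_continuous_fun_onI_C1:
  fixes F h :: "real \<Rightarrow> real"
  assumes h: "integrable lborel h" "continuous_on I h"
    and F: "\<And>x. x \<in> I \<Longrightarrow> (F has_real_derivative h x) (at x)"
  shows "absolutely_continuous_fun_on I F"
proof (rule absolutely_continuous_fun_onI_derivative[OF h(1)])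
  fix a b assume ab: "a \<le> b" "{a..b} \<subseteq> I"
  have "(h has_integral (F b - F a)) {a..b}"
  proof (rule fundamental_theorem_of_calculus[OF ab(1)])
    fix x assume "x \<in> {a..b}"
    then have "(F has_real_derivative h x) (at x)" using F ab(2) by blast
    then show "(F has_vector_derivative h x) (at x within {a..b})"
      by (simp add: has_real_derivative_iff_has_vector_derivative has_vector_derivative_at_within)
  qed
  moreover have i: "set_integrable lborel {a..b} h"
    unfolding set_integrable_def by (rule integrable_mult_indicator[OF _ h(1)]) auto
  ultimately have "F b - F a = (LBINT x:{a..b}. h x)"
    using set_borel_integral_eq_integral(2)[OF i] by (simp add: integral_unique)
  then show "\<bar>F b - F a\<bar> \<le> (LBINT x:{a..b}. \<bar>h x\<bar>)"
    using set_integral_norm_bound[OF i] by simp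
qed

lemma absolutely_continuous_fun_on_add:
  assumes "absolutely_continuous_fun_on I f" "absolutely_continuous_fun_on I g"
  shows "absolutely_continuous_fun_on I (\<lambda>x. f x + g x)"
  unfolding absolutely_continuous_fun_on_def
proof (intro allI impI)
  fix e :: real assume "e > 0"
  then have "e / 2 > 0" by simp
  note f = assms(1)[unfolded absolutely_continuous_fun_on_def, rule_format, OF this]
    and g = assms(2)[unfolded absolutely_continuous_fun_on_def, rule_format, OF this]
  obtain d1 where d1: "d1 > 0" "\<And>(n::nat) a b. (\<forall>k<n. a k \<le> b k \<and> {a k..b k} \<subseteq> I) \<Longrightarrow>
      disjoint_family_on (\<lambda>k. {a k<..<b k}) {..<n} \<Longrightarrow> (\<Sum>k<n. b k - a k) < d1 \<Longrightarrow>
      (\<Sum>k<n. \<bar>f (b k) - f (a k)\<bar>) < e / 2" using f by blast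
  obtain d2 where d2: "d2 > 0" "\<And>(n::nat) a b. (\<forall>k<n. a k \<le> b k \<and> {a k..b k} \<subseteq> I) \<Longrightarrow>
      disjoint_family_on (\<lambda>k. {a k<..<b k}) {..<n} \<Longrightarrow> (\<Sum>k<n. b k - a k) < d2 \<Longrightarrow>
      (\<Sum>k<n. \<bar>g (b k) - g (a k)\<bar>) < e / 2" using g by blast
  show "\<exists>d>0. \<forall>(n::nat) a b. (\<forall>k<n. a k \<le> b k \<and> {a k..b k} \<subseteq> I) \<longrightarrow>
      disjoint_family_on (\<lambda>k. {a k<..<b k}) {..<n} \<longrightarrow> (\<Sum>k<n. b k - a k) < d \<longrightarrow>
      (\<Sum>k<n. \<bar>(f (b k) + g (b k)) - (f (a k) + g (a k))\<bar>) < e"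
  proof (intro exI[of _ "min d1 d2"] conjI allI impI)
    fix n :: nat and a b :: "nat \<Rightarrow> real"
    assume *: "\<forall>k<n. a k \<le> b k \<and> {a k..b k} \<subseteq> I" "disjoint_family_on (\<lambda>k. {a k<..<b k}) {..<n}"
      "(\<Sum>k<n. b k - a k) < min d1 d2"
    have "(\<Sum>k<n. \<bar>(f (b k) + g (b k)) - (f (a k) + g (a k))\<bar>)
        \<le> (\<Sum>k<n. \<bar>f (b k) - f (a k)\<bar> + \<bar>g (b k) - g (a k)\<bar>)"
      by (intro sum_mono) linarith
    also have "\<dots> < e" using d1(2)[OF *(1,2)] d2(2)[OF *(1,2)] *(3) by (simp add: sum.distrib)
    finally show "(\<Sum>k<n. \<bar>(f (b k) + g (b k)) - (f (a k) + g (a k))\<bar>) < e" .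
  qed (use d1 d2 in auto)
qed

text \<open>One comparison serves scalar multiples, changes of a function outside \<open>I\<close>,
  and composition with Lipschitz functions.\<close>

lemma absolutely_continuous_fun_on_dominated:
  assumes f: "absolutely_continuous_fun_on I f"
    and le: "\<And>x y. x \<in> I \<Longrightarrow> y \<in> I \<Longrightarrow> \<bar>g x - g y\<bar> \<le> c * \<bar>f x - f y\<bar>"
  shows "absolutely_continuous_fun_on I g"
  unfolding absolutely_continuous_fun_on_def
proof (intro allI impI)
  fix e :: real assume "e > 0"
  then have "e / (\<bar>c\<bar> + 1) > 0" by simp
  from f[unfolded absolutely_continuous_fun_on_def, rule_format, OF this]
  obtain d where d: "d > 0" "\<And>(n::nat) a b. (\<forall>k<n. a k \<le> b k \<and> {a k..b k} \<subseteq> I) \<Longrightarrow>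
      disjoint_family_on (\<lambda>k. {a k<..<b k}) {..<n} \<Longrightarrow> (\<Sum>k<n. b k - a k) < d \<Longrightarrow>
      (\<Sum>k<n. \<bar>f (b k) - f (a k)\<bar>) < e / (\<bar>c\<bar> + 1)" by blast
  show "\<exists>d>0. \<forall>(n::nat) a b. (\<forall>k<n. a k \<le> b k \<and> {a k..b k} \<subseteq> I) \<longrightarrow>
      disjoint_family_on (\<lambda>k. {a k<..<b k}) {..<n} \<longrightarrow> (\<Sum>k<n. b k - a k) < d \<longrightarrow>
      (\<Sum>k<n. \<bar>g (b k) - g (a k)\<bar>) < e"
  proof (intro exI[of _ d] conjI allI impI)
    fix n :: nat and a b :: "nat \<Rightarrow> real"
    assume *: "\<forall>k<n. a k \<le> b k \<and> {a k..b k} \<subseteq> I" "disjoint_family_on (\<lambda>k. {a k<..<b k}) {..<n}"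
      "(\<Sum>k<n. b k - a k) < d"
    have "\<bar>g (b k) - g (a k)\<bar> \<le> (\<bar>c\<bar> + 1) * \<bar>f (b k) - f (a k)\<bar>" if "k < n" for k
    proof -
      have "a k \<in> {a k..b k}" "b k \<in> {a k..b k}" "{a k..b k} \<subseteq> I" using *(1) that by auto
      then have "\<bar>g (b k) - g (a k)\<bar> \<le> c * \<bar>f (b k) - f (a k)\<bar>" by (intro le) blast+
      also have "\<dots> \<le> (\<bar>c\<bar> + 1) * \<bar>f (b k) - f (a k)\<bar>" by (intro mult_right_mono) auto
      finally show ?thesis .
    qed
    then have "(\<Sum>k<n. \<bar>g (b k) - g (a k)\<bar>) \<le> (\<bar>c\<bar> + 1) * (\<Sum>k<n. \<bar>f (b k) - f (a k)\<bar>)"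
      unfolding sum_distrib_left by (intro sum_mono) auto
    also have "\<dots> < e" using d(2)[OF *] by (simp add: field_simps)
    finally show "(\<Sum>k<n. \<bar>g (b k) - g (a k)\<bar>) < e" .
  qed (use d in auto)
qed

lemma absolutely_continuous_fun_on_cmult:
  "absolutely_continuous_fun_on I f \<Longrightarrow> absolutely_continuous_fun_on I (\<lambda>x. c * f x)"
  by (erule absolutely_continuous_fun_on_dominated[of _ _ _ "\<bar>c\<bar>"]) (simp flip: abs_mult right_diff_distrib)

lemma absolutely_continuous_fun_on_cong:
  "absolutely_continuous_fun_on I f \<Longrightarrow> (\<And>x. x \<in> I \<Longrightarrow> f x = g x) \<Longrightarrow> absolutely_continuous_fun_on I g"
  by (erule absolutely_continuous_fun_on_dominated[of _ _ _ 1]) simp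

section \<open>Dissipativity of \<open>A\<close>\<close>

lemma AE_lborel_uminus:
  fixes Q :: "real \<Rightarrow> bool"
  assumes "AE x in lborel. Q x"
  shows "AE x in lborel. Q (- x)"
proof -
  have "AE x in distr lborel borel (uminus :: real \<Rightarrow> real). Q x"
    unfolding lborel_distr_uminus by (rule assms)
  from AE_distrD[OF _ this] show ?thesis by simp
qed

lemma integrable_lborel_uminus:
  fixes h :: "real \<Rightarrow> real"
  assumes "integrable lborel h" shows "integrable lborel (\<lambda>x. h (- x))"
  using lborel_integrable_real_affine[OF assms, of "-1" 0] by simp

lemma integral_lborel_uminus:
  fixes h :: "real \<Rightarrow> real"
  shows "(\<integral>x. h (- x) \<partial>lborel) = (\<integral>x. h x \<partial>lborel)"
  using lborel_integral_real_affine[of "-1" h 0] by simp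

lemma integral_lborel_halves:
  fixes h :: "real \<Rightarrow> real"
  assumes h: "integrable lborel h"
  shows "(\<integral>x. h x \<partial>lborel) = (LBINT x:{0<..}. h x) + (LBINT x:{0<..}. h (- x))"
proof -
  have i: "integrable lborel (\<lambda>x. indicator {0<..} x * h x)" "integrable lborel (\<lambda>x. indicator {..<0} x * h x)"
    using integrable_mult_indicator[OF _ h, of "{0<..}"] integrable_mult_indicator[OF _ h, of "{..<0}"] by simp_all
  have "(\<integral>x. h x \<partial>lborel) = (\<integral>x. indicator {0<..} x * h x + indicator {..<0} x * h x \<partial>lborel)"
    using i h AE_lborel_singleton[of 0]
    by (intro integral_cong_AE) (auto simp: indicator_def neq_iff)
  also have "\<dots> = (\<integral>x. indicator {0<..} x * h x \<partial>lborel) + (\<integral>x. indicator {..<0} x * h x \<partial>lborel)"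
    using i by simp
  also have "(\<integral>x. indicator {..<0} x * h x \<partial>lborel) = (\<integral>x. indicator {..<0} (- x) * h (- x) \<partial>lborel)"
    by (rule integral_lborel_uminus[symmetric])
  also have "\<dots> = (\<integral>x. indicator {0<..} x * h (- x) \<partial>lborel)"
    by (intro Bochner_Integration.integral_cong) (auto simp: indicator_def)
  finally show ?thesis by (simp add: set_lebesgue_integral_def)
qed

lemma set_integrable_lborel:
  fixes h :: "real \<Rightarrow> real"
  assumes "integrable lborel h" "S \<in> sets borel" shows "set_integrable lborel S h"
  unfolding set_integrable_def using assms by (intro integrable_mult_indicator) auto

lemma absolutely_continuous_fun_on_uminus:
  assumes f: "absolutely_continuous_fun_on I f"
  shows "absolutely_continuous_fun_on (uminus ` I) (\<lambda>x. f (- x))"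
  unfolding absolutely_continuous_fun_on_def
proof (intro allI impI)
  fix e :: real assume "e > 0"
  then obtain d where d: "d > 0" "\<And>(n::nat) a b. (\<forall>k<n. a k \<le> b k \<and> {a k..b k} \<subseteq> I) \<Longrightarrow>
      disjoint_family_on (\<lambda>k. {a k<..<b k}) {..<n} \<Longrightarrow> (\<Sum>k<n. b k - a k) < d \<Longrightarrow>
      (\<Sum>k<n. \<bar>f (b k) - f (a k)\<bar>) < e"
    using f[unfolded absolutely_continuous_fun_on_def, rule_format, of e] by blast
  show "\<exists>d>0. \<forall>(n::nat) a b. (\<forall>k<n. a k \<le> b k \<and> {a k..b k} \<subseteq> uminus ` I) \<longrightarrow>
      disjoint_family_on (\<lambda>k. {a k<..<b k}) {..<n} \<longrightarrow> (\<Sum>k<n. b k - a k) < d \<longrightarrow>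
      (\<Sum>k<n. \<bar>f (- b k) - f (- a k)\<bar>) < e"
  proof (intro exI[of _ d] conjI allI impI)
    fix n :: nat and a b :: "nat \<Rightarrow> real"
    assume *: "\<forall>k<n. a k \<le> b k \<and> {a k..b k} \<subseteq> uminus ` I" "disjoint_family_on (\<lambda>k. {a k<..<b k}) {..<n}"
      "(\<Sum>k<n. b k - a k) < d"
    have "(\<Sum>k<n. \<bar>f (- a k) - f (- b k)\<bar>) < e"
    proof (rule d(2))
      show "\<forall>k<n. - b k \<le> - a k \<and> {- b k..- a k} \<subseteq> I"
      proof (intro allI impI conjI subsetI)
        fix k x assume "k < n" "x \<in> {- b k..- a k}"
        then have "- x \<in> {a k..b k}" "{a k..b k} \<subseteq> uminus ` I" using *(1) by auto
        then have "- x \<in> uminus ` I" by (rule subsetD[rotated])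
        then show "x \<in> I" by auto
      qed (use *(1) in auto)
      show "disjoint_family_on (\<lambda>k. {- b k<..<- a k}) {..<n}"
        unfolding disjoint_family_on_def
      proof (intro ballI impI equals0I)
        fix j k x assume "j \<in> {..<n}" "k \<in> {..<n}" "j \<noteq> k" "x \<in> {- b j<..<- a j} \<inter> {- b k<..<- a k}"
        then have "- x \<in> {a j<..<b j} \<inter> {a k<..<b k}" by auto
        then show False
          using *(2) \<open>j \<in> {..<n}\<close> \<open>k \<in> {..<n}\<close> \<open>j \<noteq> k\<close> unfolding disjoint_family_on_def by blast
      qed
    qed (use *(3) in simp)
    then show "(\<Sum>k<n. \<bar>f (- b k) - f (- a k)\<bar>) < e" by (simp add: abs_minus_commute)
  qed (rule d)
qed

lemma uminus_image_lessThan_0: "uminus ` {..<0::real} = {0<..}"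
  by (auto simp: image_iff intro: bexI[of _ "- _"])

lemma sqrt_sum_squares_nonexpansive:
  fixes x y d :: real
  shows "\<bar>sqrt (x\<^sup>2 + d\<^sup>2) - sqrt (y\<^sup>2 + d\<^sup>2)\<bar> \<le> \<bar>x - y\<bar>"
  using norm_triangle_ineq3[of "(x, d)" "(y, d)"] by (simp add: norm_Pair)

text \<open>Everything is proved for the right half-line; the left one is reached through the
  reflection \<open>x \<mapsto> - x\<close>, which changes the sign of the derivative.\<close>

locale halfline_function =
  fixes f g :: "real \<Rightarrow> real"
  assumes ac: "absolutely_continuous_fun_on {0<..} f"
    and deriv: "AE x in lborel. (f has_real_derivative g x) (at x)"
    and f_int: "integrable lborel f" and g_int: "integrable lborel g"
begin

lemma FTC: "0 < a \<Longrightarrow> a \<le> b \<Longrightarrow> (LBINT x:{a..b}. g x) = f b - f a"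
  by (rule absolutely_continuous_fun_on_lebesgue_FTC[OF ac _ _ deriv g_int]) auto

text \<open>\<open>Lim\<close> is a definite description, so the interface conditions carry
  information only once the limits exist. Existence follows from writing \<open>f a\<close> as
  \<open>f 1\<close> minus the integral of \<open>g\<close> over \<open>{a..1}\<close>.\<close>

lemma limit_at_right_0: "(f \<longlongrightarrow> Lim (at_right 0) f) (at_right 0)"
proof -
  have "((\<lambda>a. f 1 - (LBINT x:{a..1}. g x)) \<longlongrightarrow> f 1 - (LBINT x:{0<..1}. g x)) (at_right 0)"
    by (intro tendsto_intros tendsto_set_lebesgue_integral_at_right set_integrable_lborel g_int) auto
  moreover have "\<forall>\<^sub>F a in at_right 0. f 1 - (LBINT x:{a..1}. g x) = f a"
    unfolding eventually_at_right_field by (intro exI[of _ 1]) (auto simp: FTC)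
  ultimately have "(f \<longlongrightarrow> f 1 - (LBINT x:{0<..1}. g x)) (at_right 0)"
    by (rule Lim_transform_eventually)
  then show ?thesis by (simp add: tendsto_Lim)
qed

text \<open>The integrable derivative makes \<open>f\<close> converge, and a nonzero limit would
  contradict integrability of \<open>f\<close>.\<close>

lemma limit_at_top: "(f \<longlongrightarrow> 0) at_top"
proof -
  define l where "l = f 1 + (LBINT x:{1..}. g x)"
  have "((\<lambda>b. f 1 + (LBINT x:{1..b}. g x)) \<longlongrightarrow> l) at_top"
    unfolding l_def by (intro tendsto_intros tendsto_set_lebesgue_integral_at_top set_integrable_lborel g_int) auto
  moreover have "\<forall>\<^sub>F b in at_top. f 1 + (LBINT x:{1..b}. g x) = f b"
    using eventually_ge_at_top[of 1] by eventually_elim (simp add: FTC)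
  ultimately have lim: "(f \<longlongrightarrow> l) at_top"
    by (rule Lim_transform_eventually)
  have "l = 0"
  proof (rule ccontr)
    assume "l \<noteq> 0"
    then have "\<forall>\<^sub>F x in at_top. \<bar>l\<bar> / 2 < \<bar>f x\<bar>"
      using order_tendstoD(1)[OF tendsto_rabs[OF lim], of "\<bar>l\<bar> / 2"] by simp
    then obtain M where M: "\<And>x. x \<ge> M \<Longrightarrow> \<bar>l\<bar> / 2 < \<bar>f x\<bar>" by (auto simp: eventually_at_top_linorder)
    obtain n :: nat where n: "(\<integral>x. \<bar>f x\<bar> \<partial>lborel) < n * (\<bar>l\<bar> / 2)"
      using reals_Archimedean3[of "\<bar>l\<bar> / 2"] \<open>l \<noteq> 0\<close> by auto
    have "real n * (\<bar>l\<bar> / 2) = (\<integral>x. indicator {M..M + n} x * (\<bar>l\<bar> / 2) \<partial>lborel)"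
      by simp
    also have "\<dots> \<le> (\<integral>x. \<bar>f x\<bar> \<partial>lborel)"
    proof (rule integral_mono)
      show "integrable lborel (\<lambda>x. indicator {M..M + n} x * (\<bar>l\<bar> / 2))"
        by (intro integrable_mult_left integrable_real_indicator) auto
    qed (use f_int M in \<open>auto simp: indicator_def less_imp_le\<close>)
    finally show False using n by simp
  qed
  with lim show ?thesis by simp
qed

text \<open>Test \<open>f + c * g\<close> against the sign of \<open>f\<close>, which has modulus at
  most 1: the first term gives the modulus of \<open>f\<close>, and the second is \<open>c\<close>
  times the derivative of that modulus, hence the boundary terms. The sign of \<open>c\<close> is
  left open because the two copies of the line carry opposite velocities.\<close>

lemma dissipative_interval:
  assumes ab: "0 < a" "a \<le> b"
  shows "(LBINT x:{a..b}. \<bar>f x\<bar>) + c * (\<bar>f b\<bar> - \<bar>f a\<bar>) \<le> (LBINT x:{a..b}. \<bar>f x + c * g x\<bar>)"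
proof -
  note [measurable] = borel_measurable_integrable[OF f_int, simplified] borel_measurable_integrable[OF g_int, simplified]
  have *: "(LBINT x:{a..b}. \<bar>f x\<bar>) - d * (b - a) + c * (sqrt ((f b)\<^sup>2 + d\<^sup>2) - sqrt ((f a)\<^sup>2 + d\<^sup>2))
      \<le> (LBINT x:{a..b}. \<bar>f x + c * g x\<bar>)" if "d > 0" for d
  proof -
    \<comment> \<open>A smooth convex substitute for \<open>\<bar>y\<bar>\<close>, since \<open>\<bar>f\<bar>\<close> need not be differentiable at zeros of \<open>f\<close>.\<close>
    define E where "E y = sqrt (y\<^sup>2 + d\<^sup>2)" for y
    define E' where "E' y = y / E y" for y
    have pos: "y\<^sup>2 + d\<^sup>2 > 0" for y using \<open>d > 0\<close> by (simp add: add_nonneg_pos)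
    have E_pos: "E y > 0" for y using pos by (simp add: E_def)
    have E'_le: "\<bar>E' y\<bar> \<le> 1" for y
      using E_pos[of y] real_sqrt_le_mono[of "y\<^sup>2" "y\<^sup>2 + d\<^sup>2"] by (simp add: E'_def E_def divide_le_eq)
    \<comment> \<open>Smoothing costs at most \<open>d\<close> per unit length, hence
      \<open>d * (b - a)\<close> in total. This is finite only on a bounded interval, which is why
      the half-line comes afterwards.\<close>
    have E'_ge: "E' y * y \<ge> \<bar>y\<bar> - d" for y
    proof -
      have "E y ^ 2 = y\<^sup>2 + d\<^sup>2" using pos[of y] by (simp add: E_def)
      then have "E' y * y = E y - d * (d / E y)"
        using E_pos[of y] by (simp add: E'_def field_simps power2_eq_square)
      moreover have "d / E y \<le> 1"
        using E_pos[of y] real_sqrt_le_mono[of "d\<^sup>2" "y\<^sup>2 + d\<^sup>2"] \<open>d > 0\<close> by (simp add: E_def divide_le_eq)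
      then have "d * (d / E y) \<le> d * 1" using \<open>d > 0\<close> by (intro mult_left_mono) auto
      moreover have "E y \<ge> \<bar>y\<bar>" using real_sqrt_le_mono[of "y\<^sup>2" "y\<^sup>2 + d\<^sup>2"] by (simp add: E_def)
      ultimately show ?thesis by simp
    qed
    have [measurable]: "E' \<in> borel_measurable borel" unfolding E'_def E_def by measurable
    have bound: "\<bar>E' y * z\<bar> \<le> \<bar>z\<bar>" for y z
      using mult_right_mono[OF E'_le[of y], of "\<bar>z\<bar>"] by (simp add: abs_mult)
    have i1: "integrable lborel (\<lambda>x. E' (f x) * g x)" and i2: "integrable lborel (\<lambda>x. E' (f x) * f x)"
      by (rule Bochner_Integration.integrable_bound[OF g_int] Bochner_Integration.integrable_bound[OF f_int]; use bound in simp)+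
    have "(LBINT x:{a..b}. E' (f x) * g x) = E (f b) - E (f a)"
    proof (rule absolutely_continuous_fun_on_lebesgue_FTC[OF _ _ _ _ i1])
      show "absolutely_continuous_fun_on {0<..} (\<lambda>x. E (f x))"
        using sqrt_sum_squares_nonexpansive
        by (intro absolutely_continuous_fun_on_dominated[OF ac, of _ 1]) (simp add: E_def)
      have "(E has_real_derivative E' y) (at y)" for y
        unfolding E_def E'_def using pos[of y] by (auto intro!: derivative_eq_intros simp: divide_simps)
      then show "AE x in lborel. ((\<lambda>x. E (f x)) has_real_derivative E' (f x) * g x) (at x)"
        using deriv by (auto intro: DERIV_chain2 elim: eventually_mono)
    qed (use ab in auto)
    moreover have fi: "set_integrable lborel {a..b} (\<lambda>x. \<bar>f x\<bar>)"
      using f_int by (intro set_integrable_lborel) auto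
    moreover have di: "set_integrable lborel {a..b} (\<lambda>x. d)"
      unfolding set_integrable_def real_scaleR_def
      by (intro integrable_mult_left integrable_real_indicator) (auto simp: emeasure_lborel_Icc_eq)
    moreover have "(LBINT x:{a..b}. E' (f x) * f x) \<ge> (LBINT x:{a..b}. \<bar>f x\<bar> - d)"
      by (intro set_integral_mono set_integral_diff fi di set_integrable_lborel i2 E'_ge) auto
    moreover have "(LBINT x:{a..b}. \<bar>f x\<bar> - d) = (LBINT x:{a..b}. \<bar>f x\<bar>) - d * (b - a)"
      using ab by (subst set_integral_diff(2)[OF fi di]) (simp add: set_lebesgue_integral_def)
    moreover have "(LBINT x:{a..b}. E' (f x) * f x) + c * (LBINT x:{a..b}. E' (f x) * g x)
        = (LBINT x:{a..b}. E' (f x) * (f x + c * g x))"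
      using i1 i2 unfolding set_integral_mult_right[symmetric]
      by (subst set_integral_add(2)[symmetric]) (auto intro!: set_integrable_lborel simp: algebra_simps)
    moreover have "(LBINT x:{a..b}. E' (f x) * (f x + c * g x)) \<le> (LBINT x:{a..b}. \<bar>f x + c * g x\<bar>)"
    proof (rule set_integral_mono)
      have "integrable lborel (\<lambda>x. E' (f x) * f x + c * (E' (f x) * g x))" using i1 i2 by simp
      then show "set_integrable lborel {a..b} (\<lambda>x. E' (f x) * (f x + c * g x))"
        by (intro set_integrable_lborel) (simp_all add: algebra_simps)
      show "set_integrable lborel {a..b} (\<lambda>x. \<bar>f x + c * g x\<bar>)"
        using f_int g_int by (intro set_integrable_lborel) auto
      show "E' (f x) * (f x + c * g x) \<le> \<bar>f x + c * g x\<bar>" for x using bound abs_le_D1 by blast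
    qed
    ultimately show ?thesis unfolding E_def by simp
  qed
  have "((\<lambda>d. (LBINT x:{a..b}. \<bar>f x\<bar>) - d * (b - a) + c * (sqrt ((f b)\<^sup>2 + d\<^sup>2) - sqrt ((f a)\<^sup>2 + d\<^sup>2)))
      \<longlongrightarrow> (LBINT x:{a..b}. \<bar>f x\<bar>) - 0 * (b - a) + c * (sqrt ((f b)\<^sup>2 + 0\<^sup>2) - sqrt ((f a)\<^sup>2 + 0\<^sup>2))) (at_right 0)"
    by (intro tendsto_intros)
  from tendsto_upperbound[OF this eventually_mono[OF eventually_at_right_less *]] show ?thesis
    by simp
qed

text \<open>Pass to the limit first in \<open>b\<close>, where the boundary value disappears at
  infinity, and then in \<open>a\<close>, where the one-sided limit at 0 remains.\<close>

lemma dissipative: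
  "(LBINT x:{0<..}. \<bar>f x\<bar>) - c * \<bar>Lim (at_right 0) f\<bar> \<le> (LBINT x:{0<..}. \<bar>f x + c * g x\<bar>)"
proof -
  have i: "integrable lborel (\<lambda>x. \<bar>f x\<bar>)" "integrable lborel (\<lambda>x. \<bar>f x + c * g x\<bar>)"
    using f_int g_int by auto
  have 1: "(LBINT x:{a..}. \<bar>f x\<bar>) + c * (\<bar>0\<bar> - \<bar>f a\<bar>) \<le> (LBINT x:{a..}. \<bar>f x + c * g x\<bar>)" if "a > 0" for a
  proof (rule tendsto_le[of at_top])
    show "((\<lambda>b. (LBINT x:{a..b}. \<bar>f x\<bar>) + c * (\<bar>f b\<bar> - \<bar>f a\<bar>)) \<longlongrightarrow> (LBINT x:{a..}. \<bar>f x\<bar>) + c * (\<bar>0\<bar> - \<bar>f a\<bar>)) at_top"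
      by (intro tendsto_intros tendsto_set_lebesgue_integral_at_top set_integrable_lborel i limit_at_top) auto
    show "((\<lambda>b. LBINT x:{a..b}. \<bar>f x + c * g x\<bar>) \<longlongrightarrow> (LBINT x:{a..}. \<bar>f x + c * g x\<bar>)) at_top"
      by (intro tendsto_set_lebesgue_integral_at_top set_integrable_lborel i) auto
    show "\<forall>\<^sub>F b in at_top. (LBINT x:{a..b}. \<bar>f x\<bar>) + c * (\<bar>f b\<bar> - \<bar>f a\<bar>) \<le> (LBINT x:{a..b}. \<bar>f x + c * g x\<bar>)"
      using eventually_ge_at_top[of a] by eventually_elim (rule dissipative_interval[OF that])
  qed simp
  have lim: "((\<lambda>a. LBINT x:{a..}. h x) \<longlongrightarrow> (LBINT x:{0<..}. h x)) (at_right 0)" if h: "integrable lborel h" for h :: "real \<Rightarrow> real"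
  proof -
    \<comment> \<open>Cutting at 1 confines the dependence on \<open>a\<close> to a bounded
      interval, so that only the limit at the lower endpoint of \<open>{a..1}\<close> has to be
      taken.\<close>
    have split: "(LBINT x:{a..}. h x) = (LBINT x:{a..1}. h x) + (LBINT x:{1<..}. h x)" if "a \<le> 1" for a
    proof -
      have "(LBINT x:{a..1} \<union> {1<..}. h x) = (LBINT x:{a..1}. h x) + (LBINT x:{1<..}. h x)"
        by (intro set_integral_Un set_integrable_lborel h) auto
      moreover have "{a..1} \<union> {1<..} = {a..}" using that by auto
      ultimately show ?thesis by simp
    qed
    have "(LBINT x:{0<..1} \<union> {1<..}. h x) = (LBINT x:{0<..1}. h x) + (LBINT x:{1<..}. h x)"
      by (intro set_integral_Un set_integrable_lborel h) auto
    moreover have "{0<..1} \<union> {1<..} = {0::real<..}" by auto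
    ultimately have split0: "(LBINT x:{0<..}. h x) = (LBINT x:{0<..1}. h x) + (LBINT x:{1<..}. h x)" by simp
    have "((\<lambda>a. (LBINT x:{a..1}. h x) + (LBINT x:{1<..}. h x)) \<longlongrightarrow> (LBINT x:{0<..1}. h x) + (LBINT x:{1<..}. h x)) (at_right 0)"
      by (intro tendsto_intros tendsto_set_lebesgue_integral_at_right set_integrable_lborel h) auto
    then show ?thesis
      unfolding split0
    proof (rule Lim_transform_eventually)
      show "\<forall>\<^sub>F a in at_right 0. (LBINT x:{a..1}. h x) + (LBINT x:{1<..}. h x) = (LBINT x:{a..}. h x)"
        unfolding eventually_at_right_field by (intro exI[of _ 1]) (auto simp: split)
    qed
  qed
  have "(LBINT x:{0<..}. \<bar>f x\<bar>) + c * (\<bar>0\<bar> - \<bar>Lim (at_right 0) f\<bar>) \<le> (LBINT x:{0<..}. \<bar>f x + c * g x\<bar>)"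
  proof (rule tendsto_le[of "at_right 0"])
    show "((\<lambda>a. (LBINT x:{a..}. \<bar>f x\<bar>) + c * (\<bar>0\<bar> - \<bar>f a\<bar>)) \<longlongrightarrow> (LBINT x:{0<..}. \<bar>f x\<bar>) + c * (\<bar>0\<bar> - \<bar>Lim (at_right 0) f\<bar>)) (at_right 0)"
      by (intro tendsto_intros lim i limit_at_right_0)
    show "\<forall>\<^sub>F a in at_right 0. (LBINT x:{a..}. \<bar>f x\<bar>) + c * (\<bar>0\<bar> - \<bar>f a\<bar>) \<le> (LBINT x:{a..}. \<bar>f x + c * g x\<bar>)"
      using eventually_at_right_less[of 0] by eventually_elim (rule 1)
  qed (auto intro: lim i)
  then show ?thesis by simp
qed

end

lemma Lim_at_left_0: "Lim (at_left (0::real)) f = Lim (at_right 0) (\<lambda>x. f (- x))"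
  by (simp add: t2_space_class.Lim_def filterlim_at_left_to_right)

lemma halfline_function_reflect:
  assumes "absolutely_continuous_fun_on {..<0} f"
    and "AE x in lborel. (f has_real_derivative g x) (at x)"
    and "integrable lborel f" "integrable lborel g"
  shows "halfline_function (\<lambda>x. f (- x)) (\<lambda>x. - g (- x))"
proof
  show "absolutely_continuous_fun_on {0<..} (\<lambda>x. f (- x))"
    using absolutely_continuous_fun_on_uminus[OF assms(1)] by (simp add: uminus_image_lessThan_0)
  show "AE x in lborel. ((\<lambda>x. f (- x)) has_real_derivative - g (- x)) (at x)"
    using AE_lborel_uminus[OF assms(2)]
    by (auto elim!: eventually_mono simp: DERIV_mirror)
qed (use assms integrable_lborel_uminus in auto)

lemma A_E:
  assumes "(\<phi>, \<psi>) \<in> A p p' q q'"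
  obtains f g where "\<phi> = L1_class f" "\<psi> = L1_class (\<lambda>(x, i). - real_of_sign i * g (x, i))"
    "integrable ref f" "integrable ref g"
    "\<And>i. halfline_function (\<lambda>x. f (x, i)) (\<lambda>x. g (x, i))"
    "\<And>i. halfline_function (\<lambda>x. f (- x, i)) (\<lambda>x. - g (- x, i))"
    "\<And>i. absolutely_continuous_fun_on {..<0} (\<lambda>x. f (x, i))"
    "Lim (at_right 0) (\<lambda>x. f (x, 1)) = p * Lim (at_left 0) (\<lambda>x. f (x, 1)) + q' * Lim (at_right 0) (\<lambda>x. f (x, - 1))"
    "Lim (at_left 0) (\<lambda>x. f (x, - 1)) = p' * Lim (at_left 0) (\<lambda>x. f (x, 1)) + q * Lim (at_right 0) (\<lambda>x. f (x, - 1))"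
proof -
  from assms obtain f g where fg: "\<phi> = L1_class f" "\<psi> = L1_class (\<lambda>(x, i). - real_of_sign i * g (x, i))"
    "integrable ref f" "integrable ref g"
    and ac: "\<And>i. absolutely_continuous_fun_on {0<..} (\<lambda>x. f (x, i))" "\<And>i. absolutely_continuous_fun_on {..<0} (\<lambda>x. f (x, i))"
      "\<And>i. AE x in lborel. ((\<lambda>y. f (y, i)) has_real_derivative g (x, i)) (at x)"
    and bc: "Lim (at_right 0) (\<lambda>x. f (x, 1)) = p * Lim (at_left 0) (\<lambda>x. f (x, 1)) + q' * Lim (at_right 0) (\<lambda>x. f (x, - 1))"
    "Lim (at_left 0) (\<lambda>x. f (x, - 1)) = p' * Lim (at_left 0) (\<lambda>x. f (x, 1)) + q * Lim (at_right 0) (\<lambda>x. f (x, - 1))"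
    unfolding A_def by blast
  note i = integrable_S_section[OF fg(3)] integrable_S_section[OF fg(4)]
  show thesis
    by (rule that[OF fg _ _ ac(2) bc])
       (auto intro: halfline_function_reflect halfline_function.intro ac i)
qed

lemma integrable_real_of_sign:
  "integrable ref g \<Longrightarrow> integrable ref (\<lambda>(x, i). - real_of_sign i * g (x :: real, i))"
  by (simp add: integrable_S_iff)

lemma real_of_sign_simps [simp]: "real_of_sign 1 = 1" "real_of_sign (- i) = - real_of_sign i"
  by (simp_all add: real_of_sign_def int_of_sign_simps)

text \<open>A balance of fluxes at 0. Motion is to the right for sign 1 and to the left for sign -1,
  so the values at 0- for sign 1 and at 0+ for sign -1 arrive at the interface and the other two
  leave it. The bounds \<open>p + p' \<le> 1\<close> and \<open>q + q' \<le> 1\<close> say that no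
  more leaves than arrives.\<close>

lemma A_dissipative:
  assumes p: "p \<ge> 0" "p' \<ge> 0" "q \<ge> 0" "q' \<ge> 0" "p + p' \<le> 1" "q + q' \<le> 1"
    and \<phi>: "(\<phi>, \<psi>) \<in> A p p' q q'" and "h \<ge> 0"
  shows "norm \<phi> \<le> norm (\<phi> - h *\<^sub>R \<psi>)"
proof -
  obtain f g where fg: "\<phi> = L1_class f" "\<psi> = L1_class (\<lambda>(x, i). - real_of_sign i * g (x, i))"
    "integrable ref f" "integrable ref g"
    and hr: "\<And>i. halfline_function (\<lambda>x. f (x, i)) (\<lambda>x. g (x, i))"
    and hl: "\<And>i. halfline_function (\<lambda>x. f (- x, i)) (\<lambda>x. - g (- x, i))"
    and bc: "Lim (at_right 0) (\<lambda>x. f (x, 1)) = p * Lim (at_left 0) (\<lambda>x. f (x, 1)) + q' * Lim (at_right 0) (\<lambda>x. f (x, - 1))"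
    "Lim (at_left 0) (\<lambda>x. f (x, - 1)) = p' * Lim (at_left 0) (\<lambda>x. f (x, 1)) + q * Lim (at_right 0) (\<lambda>x. f (x, - 1))"
    using \<phi> by (rule A_E) (blast intro: that)
  note i = integrable_S_section[OF fg(3)] integrable_S_section[OF fg(4)]
  let ?r = "\<lambda>i. \<bar>Lim (at_right 0) (\<lambda>x. f (x, i))\<bar>" and ?l = "\<lambda>i. \<bar>Lim (at_left 0) (\<lambda>x. f (x, i))\<bar>"
  have line: "(\<integral>x. \<bar>f (x, i)\<bar> \<partial>lborel) - c * ?r i + c * ?l i \<le> (\<integral>x. \<bar>f (x, i) + c * g (x, i)\<bar> \<partial>lborel)" for i c
  proof -
    have "(\<integral>x. \<bar>f (x, i)\<bar> \<partial>lborel) = (LBINT x:{0<..}. \<bar>f (x, i)\<bar>) + (LBINT x:{0<..}. \<bar>f (- x, i)\<bar>)"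
      "(\<integral>x. \<bar>f (x, i) + c * g (x, i)\<bar> \<partial>lborel) = (LBINT x:{0<..}. \<bar>f (x, i) + c * g (x, i)\<bar>) + (LBINT x:{0<..}. \<bar>f (- x, i) + c * g (- x, i)\<bar>)"
      using i by (intro integral_lborel_halves; simp)+
    with halfline_function.dissipative[OF hr[of i], of c] halfline_function.dissipative[OF hl[of i], of "- c"]
    show ?thesis by (simp add: Lim_at_left_0)
  qed
  have "?r 1 \<le> p * ?l 1 + q' * ?r (- 1)" "?l (- 1) \<le> p' * ?l 1 + q * ?r (- 1)"
    unfolding bc using p by (auto intro!: order_trans[OF abs_triangle_ineq] simp: abs_mult)
  then have "?r 1 + ?l (- 1) \<le> (p + p') * ?l 1 + (q + q') * ?r (- 1)" by (simp add: algebra_simps)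
  also have "\<dots> \<le> 1 * ?l 1 + 1 * ?r (- 1)" using p by (intro add_mono mult_right_mono) auto
  finally have bd: "h * (?r 1 + ?l (- 1)) \<le> h * (?l 1 + ?r (- 1))" using \<open>h \<ge> 0\<close> by (intro mult_left_mono) auto
  \<comment> \<open>The minus sign in \<open>A\<close> meets the one in front of \<open>h\<close>,
    so the half-line estimates apply with \<open>c = h\<close> for sign 1 and \<open>c = - h\<close>
    for sign -1.\<close>
  have eq: "\<phi> - h *\<^sub>R \<psi> = L1_class (\<lambda>(x, i). f (x, i) + h * real_of_sign i * g (x, i))"
    using fg(3) integrable_real_of_sign[OF fg(4)]
    by (simp add: fg(1,2) L1_class_minus L1_class_scale case_prod_beta' mult.assoc)
  have int: "integrable ref (\<lambda>(x, i). f (x, i) + h * real_of_sign i * g (x, i))"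
    using i by (simp add: integrable_S_iff)
  have "norm (\<phi> - h *\<^sub>R \<psi>) = (\<integral>x. \<bar>f (x, 1) + h * g (x, 1)\<bar> \<partial>lborel) + (\<integral>x. \<bar>f (x, - 1) + - h * g (x, - 1)\<bar> \<partial>lborel)"
    unfolding eq norm_S_class[OF int] by simp
  moreover have "norm \<phi> = (\<integral>x. \<bar>f (x, 1)\<bar> \<partial>lborel) + (\<integral>x. \<bar>f (x, - 1)\<bar> \<partial>lborel)"
    unfolding fg(1) by (rule norm_S_class[OF fg(3)])
  ultimately show ?thesis
    using bd line[of 1 h] line[of "- 1" "- h"] by (simp add: distrib_left)
qed

text \<open>The loss term of \<open>B - I\<close> enlarges the coefficient of \<open>\<phi>\<close>
  to \<open>a\<close>, and dissipativity of \<open>A\<close> with the rescaled step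
  \<open>h / \<epsilon> / a\<close> preserves the resulting lower bound. Since \<open>B\<close> is
  an isometry, the gain term takes back exactly the surplus \<open>h / \<epsilon>\<^sup>2\<close>
  times the norm.\<close>

lemma G_dissipative:
  assumes p: "p \<ge> 0" "p' \<ge> 0" "q \<ge> 0" "q' \<ge> 0" "p + p' \<le> 1" "q + q' \<le> 1"
    and \<phi>: "(\<phi>, \<psi>) \<in> G p p' q q' \<epsilon>" and "h > 0" "\<epsilon> > 0"
  shows "norm \<phi> \<le> norm (\<phi> - h *\<^sub>R \<psi>)"
proof -
  obtain \<psi>' where \<psi>': "(\<phi>, \<psi>') \<in> A p p' q q'" "\<psi> = (1 / \<epsilon>) *\<^sub>R \<psi>' + (1 / \<epsilon>\<^sup>2) *\<^sub>R (B \<phi> - \<phi>)"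
    using \<phi> by (auto simp: G_def)
  define a where "a = 1 + h / \<epsilon>\<^sup>2"
  have a: "a > 0" using assms by (simp add: a_def add_pos_nonneg)
  have "a *\<^sub>R (\<phi> - (h / \<epsilon> / a) *\<^sub>R \<psi>') = a *\<^sub>R \<phi> - (h / \<epsilon>) *\<^sub>R \<psi>'"
    using a by (simp add: scaleR_diff_right less_imp_neq[symmetric])
  moreover have "a *\<^sub>R \<phi> = \<phi> + (h / \<epsilon>\<^sup>2) *\<^sub>R \<phi>" by (simp add: a_def scaleR_add_left)
  ultimately have "\<phi> - h *\<^sub>R \<psi> = a *\<^sub>R (\<phi> - (h / \<epsilon> / a) *\<^sub>R \<psi>') - (h / \<epsilon>\<^sup>2) *\<^sub>R B \<phi>"
    unfolding \<psi>'(2) by (simp only:) (simp add: algebra_simps)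
  then have "norm (\<phi> - h *\<^sub>R \<psi>) \<ge> norm (a *\<^sub>R (\<phi> - (h / \<epsilon> / a) *\<^sub>R \<psi>')) - norm ((h / \<epsilon>\<^sup>2) *\<^sub>R B \<phi>)"
    by (metis norm_triangle_ineq2)
  moreover have "norm (a *\<^sub>R (\<phi> - (h / \<epsilon> / a) *\<^sub>R \<psi>')) \<ge> a * norm \<phi>"
    using A_dissipative[OF p \<psi>'(1), of "h / \<epsilon> / a"] a assms by simp
  moreover have "norm ((h / \<epsilon>\<^sup>2) *\<^sub>R B \<phi>) = h / \<epsilon>\<^sup>2 * norm \<phi>" using assms by simp
  moreover have "a * norm \<phi> = norm \<phi> + h / \<epsilon>\<^sup>2 * norm \<phi>" by (simp add: a_def distrib_right)
  ultimately show ?thesis by linarith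
qed

section \<open>Functions on a half-line vanishing at the origin\<close>

text \<open>The profile used to adjust boundary values. It has value 1 and slope 0 at the origin, so
  adding it moves the even boundary value of a corrector without touching the odd one; it is
  integrable together with its first two derivatives, whose moduli are bounded by multiples of
  it.\<close>

definition bump :: "real \<Rightarrow> real" where "bump x = 1 / (1 + x\<^sup>2)"
definition bump' :: "real \<Rightarrow> real" where "bump' x = - 2 * x / (1 + x\<^sup>2)\<^sup>2"
definition bump'' :: "real \<Rightarrow> real" where "bump'' x = (6 * x\<^sup>2 - 2) / (1 + x\<^sup>2) ^ 3"

lemma one_plus_square_pos: "1 + x\<^sup>2 > 0" for x :: real
  by (simp add: add_pos_nonneg)

lemma bump_deriv: "(bump has_real_derivative bump' x) (at x)"
  and bump'_deriv: "(bump' has_real_derivative bump'' x) (at x)"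
  and continuous_on_bump: "continuous_on S bump" "continuous_on S bump'" "continuous_on S bump''"
proof -
  have nz: "1 + x\<^sup>2 \<noteq> 0" for x :: real using one_plus_square_pos[of x] by simp
  show "(bump has_real_derivative bump' x) (at x)"
    unfolding bump_def[abs_def] bump'_def
    by (auto intro!: derivative_eq_intros simp: nz power2_eq_square[of "1 + x\<^sup>2"])
  show "(bump' has_real_derivative bump'' x) (at x)"
    unfolding bump''_def bump'_def[abs_def]
    by (rule derivative_eq_intros refl | simp add: nz)+
       (simp add: nz divide_simps, simp add: algebra_simps power2_eq_square power3_eq_cube eval_nat_numeral)
  show "continuous_on S bump" "continuous_on S bump'" "continuous_on S bump''"
    unfolding bump_def[abs_def] bump'_def[abs_def] bump''_def[abs_def]
    by (intro continuous_intros; simp add: nz)+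
qed

lemma bump_bounds: "bump x \<ge> 0" "\<bar>bump' x\<bar> \<le> bump x" "\<bar>bump'' x\<bar> \<le> 6 * bump x"
proof -
  have p: "1 + x\<^sup>2 > 0" by (rule one_plus_square_pos)
  show "bump x \<ge> 0" using p by (simp add: bump_def)
  have "\<bar>2 * x\<bar> \<le> 1 + x\<^sup>2"
    using zero_le_power2[of "\<bar>x\<bar> - 1"] by (simp add: power2_diff)
  then have "\<bar>2 * x\<bar> / (1 + x\<^sup>2)\<^sup>2 \<le> (1 + x\<^sup>2) / (1 + x\<^sup>2)\<^sup>2" by (intro divide_right_mono) auto
  then show "\<bar>bump' x\<bar> \<le> bump x" using p by (simp add: bump_def bump'_def power2_eq_square abs_mult)
  have "\<bar>6 * x\<^sup>2 - 2\<bar> \<le> 6 * (1 + x\<^sup>2)" by (auto simp: abs_le_iff)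
  also have "\<dots> \<le> 6 * (1 + x\<^sup>2) ^ 2"
    using self_le_power[of "1 + x\<^sup>2" 2] by simp
  finally have "\<bar>6 * x\<^sup>2 - 2\<bar> / (1 + x\<^sup>2) ^ 3 \<le> 6 * (1 + x\<^sup>2) ^ 2 / (1 + x\<^sup>2) ^ 3"
    using p by (intro divide_right_mono) auto
  moreover have "6 * s ^ 2 / s ^ 3 = 6 / s" if "s > 0" for s :: real
    using that by (simp add: field_simps eval_nat_numeral)
  ultimately show "\<bar>bump'' x\<bar> \<le> 6 * bump x"
    using p by (simp add: bump_def bump''_def abs_mult)
qed

lemma integrable_bump: "integrable lborel bump" "integrable lborel bump'" "integrable lborel bump''"
proof -
  have m [measurable]: "bump \<in> borel_measurable borel" "bump' \<in> borel_measurable borel" "bump'' \<in> borel_measurable borel"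
    using continuous_on_bump by (auto intro: borel_measurable_continuous_onI)
  have "(\<integral>\<^sup>+x. ennreal (bump x) * indicator {0..} x \<partial>lborel) = ennreal (pi / 2 - arctan 0)"
    by (rule nn_integral_FTC_atLeast)
       (use bump_bounds tendsto_arctan_at_top in \<open>auto intro!: derivative_eq_intros simp: bump_def inverse_eq_divide\<close>)
  moreover have "(\<integral>\<^sup>+x. ennreal (bump x * indicator {0..} x) \<partial>lborel) = (\<integral>\<^sup>+x. ennreal (bump x) * indicator {0..} x \<partial>lborel)"
    by (intro nn_integral_cong) (auto simp: indicator_def)
  ultimately have i: "integrable lborel (\<lambda>x. bump x * indicator {0..} x)"
    by (intro integrableI_nonneg) (auto simp: bump_bounds)
  then show "integrable lborel bump"
    by (rule Bochner_Integration.integrable_bound[OF Bochner_Integration.integrable_add[OF _ integrable_lborel_uminus]])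
       (use i in \<open>auto simp: indicator_def bump_def\<close>)
  then show "integrable lborel bump'" "integrable lborel bump''"
    using bump_bounds by (auto intro: Bochner_Integration.integrable_bound[of lborel "\<lambda>x. 6 * bump x"] Bochner_Integration.integrable_bound[of lborel bump])
qed

lemma bump_0: "bump 0 = 1" "bump' 0 = 0"
  by (simp_all add: bump_def bump'_def)

section \<open>Indefinite integrals and moving windows\<close>

lemma continuous_on_indefinite_integral:
  fixes h :: "real \<Rightarrow> real"
  assumes h: "\<And>a. set_integrable lborel {0..a} h"
  shows "continuous_on {0..} (\<lambda>x. LBINT y:{0..x}. h y)"
proof -
  have eq: "(LBINT y:{0..x}. h y) = integral {0..x} h" for x
    by (rule set_borel_integral_eq_integral(2)[OF h])
  have c: "continuous_on {0..a} (\<lambda>x. integral {0..x} h)" for a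
    by (rule indefinite_integral_continuous_1[OF set_borel_integral_eq_integral(1)[OF h]])
  have "continuous (at x within {0..}) (\<lambda>x. integral {0..x} h)" if "x \<ge> 0" for x
  proof -
    have "continuous (at x within {0..x + 1}) (\<lambda>x. integral {0..x} h)"
      using c[of "x + 1"] that by (auto simp: continuous_on_eq_continuous_within)
    moreover have "at x within {0..x + 1} = at x within {0..}"
      by (rule at_within_nhd[of _ "{..<x + 1}"]) auto
    ultimately show ?thesis by simp
  qed
  then show ?thesis unfolding eq by (auto simp: continuous_on_eq_continuous_within)
qed

lemma has_real_derivative_indefinite_integral:
  fixes h :: "real \<Rightarrow> real"
  assumes h: "\<And>a. set_integrable lborel {0..a} h" and c: "continuous_on {0<..} h" and "x > 0"
  shows "((\<lambda>x. LBINT y:{0..x}. h y) has_real_derivative h x) (at x)"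
proof -
  have eq: "(LBINT y:{0..x}. h y) = integral {0..x} h" for x
    by (rule set_borel_integral_eq_integral(2)[OF h])
  have "isCont h x" using c \<open>x > 0\<close> by (simp add: continuous_on_eq_continuous_at)
  then have "((\<lambda>x. integral {0..x} h) has_vector_derivative h x) (at x within ({0..x + 1} - {}))"
    using \<open>x > 0\<close>
    by (intro integral_has_vector_derivative_continuous_at set_borel_integral_eq_integral(1)[OF h])
       (auto intro: continuous_at_imp_continuous_at_within)
  moreover have "at x within ({0..x + 1} - {}) = at x"
    using \<open>x > 0\<close> by (intro at_within_interior) auto
  ultimately show ?thesis unfolding eq by (simp add: has_real_derivative_iff_has_vector_derivative)
qed

text \<open>By Tonelli, a point \<open>y\<close> belongs to the window starting at \<open>x\<close>
  exactly when \<open>x\<close> lies in \<open>{y - 1..y}\<close>, a set of length 1; thus the unit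
  moving average preserves the total mass.\<close>

lemma window_integral:
  fixes h :: "real \<Rightarrow> real"
  assumes h: "integrable lborel h"
  shows "integrable lborel (\<lambda>x. LBINT y:{x..x + 1}. \<bar>h y\<bar>)"
    and "(\<integral>x. (LBINT y:{x..x + 1}. \<bar>h y\<bar>) \<partial>lborel) = (\<integral>x. \<bar>h x\<bar> \<partial>lborel)"
proof -
  have [measurable]: "h \<in> borel_measurable borel" using h by auto
  define k where "k x = (LBINT y:{x..x + 1}. \<bar>h y\<bar>)" for x
  have k0: "k x \<ge> 0" for x unfolding k_def set_lebesgue_integral_def by (intro Bochner_Integration.integral_nonneg) (auto simp: indicator_def)
  have k: "ennreal (k x) = (\<integral>\<^sup>+y. ennreal \<bar>h y\<bar> * indicator {x..x + 1} y \<partial>lborel)" for x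
  proof -
    have "(\<integral>\<^sup>+y. ennreal (indicator {x..x + 1} y *\<^sub>R \<bar>h y\<bar>) \<partial>lborel) = ennreal (k x)"
      unfolding k_def set_lebesgue_integral_def using h
      by (intro nn_integral_eq_integral integrable_mult_indicator) (auto simp: indicator_def)
    then show ?thesis
      by (subst (asm) nn_integral_cong[where v = "\<lambda>y. ennreal \<bar>h y\<bar> * indicator {x..x + 1} y"]) (auto simp: indicator_def)
  qed
  have [measurable]: "k \<in> borel_measurable borel"
    unfolding k_def[abs_def] set_lebesgue_integral_def indicator_def atLeastAtMost_iff by measurable
  have "(\<integral>\<^sup>+x. ennreal (k x) \<partial>lborel) = (\<integral>\<^sup>+x. \<integral>\<^sup>+y. ennreal \<bar>h y\<bar> * indicator {x..x + 1} y \<partial>lborel \<partial>lborel)"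
    by (simp add: k)
  also have "\<dots> = (\<integral>\<^sup>+y. \<integral>\<^sup>+x. ennreal \<bar>h y\<bar> * indicator {x..x + 1} y \<partial>lborel \<partial>lborel)"
    unfolding indicator_def atLeastAtMost_iff by (rule lborel_pair.Fubini'[symmetric]) measurable
  also have "\<dots> = (\<integral>\<^sup>+y. \<integral>\<^sup>+x. ennreal \<bar>h y\<bar> * indicator {y - 1..y} x \<partial>lborel \<partial>lborel)"
    by (intro nn_integral_cong) (auto simp: indicator_def)
  also have "\<dots> = (\<integral>\<^sup>+y. ennreal \<bar>h y\<bar> \<partial>lborel)"
    by (simp add: nn_integral_cmult_indicator)
  also have "\<dots> = ennreal (\<integral>y. \<bar>h y\<bar> \<partial>lborel)"
    using h by (intro nn_integral_eq_integral) auto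
  finally have *: "(\<integral>\<^sup>+x. ennreal (k x) \<partial>lborel) = ennreal (\<integral>y. \<bar>h y\<bar> \<partial>lborel)" .
  then have "has_bochner_integral lborel k (\<integral>y. \<bar>h y\<bar> \<partial>lborel)"
    by (intro has_bochner_integral_nn_integral) (auto simp: k0)
  then show "integrable lborel (\<lambda>x. LBINT y:{x..x + 1}. \<bar>h y\<bar>)"
    "(\<integral>x. (LBINT y:{x..x + 1}. \<bar>h y\<bar>) \<partial>lborel) = (\<integral>x. \<bar>h x\<bar> \<partial>lborel)"
    unfolding k_def[abs_def] by (auto simp: has_bochner_integral_iff)
qed

lemma set_integral_singleton:
  fixes h :: "real \<Rightarrow> real"
  shows "(LBINT y:{a..a}. h y) = 0"
  unfolding set_lebesgue_integral_def
proof (rule integral_eq_zero_AE)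
  show "AE x in lborel. indicat_real {a..a} x *\<^sub>R h x = 0"
    using AE_lborel_singleton[of a] by eventually_elim (auto simp: indicator_def)
qed

lemma set_integral_mono_subset:
  fixes h :: "real \<Rightarrow> real"
  assumes "set_integrable lborel S' h" "S \<in> sets borel" "S \<subseteq> S'" "\<And>x. h x \<ge> 0"
  shows "(LBINT x:S. h x) \<le> (LBINT x:S'. h x)"
  unfolding set_lebesgue_integral_def
proof (rule integral_mono)
  show "integrable lborel (\<lambda>x. indicat_real S x *\<^sub>R h x)"
    using set_integrable_subset[OF assms(1) _ assms(3)] assms(2) by (simp add: set_integrable_def)
qed (use assms in \<open>auto simp: set_integrable_def indicator_def\<close>)

text \<open>The derivative of the function in \<open>killed_halfline\<close>, given by its formula
  so that it can be estimated before any differentiability is available.\<close>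

definition slope :: "real \<Rightarrow> (real \<Rightarrow> real) \<Rightarrow> real \<Rightarrow> real" where
  "slope d \<psi> x = d + (LBINT y:{0..x}. \<psi> y)"

text \<open>One half of the domain of \<open>\<Delta>\<^sub>0\<close>. The formula is Taylor's, with
  integral remainder, for a function with value 0 and slope \<open>d\<close> at the origin and
  second derivative \<open>\<psi>\<close>.\<close>

locale killed_halfline =
  fixes f \<psi> :: "real \<Rightarrow> real" and d :: real
  assumes f_int: "integrable lborel f" and \<psi>_int: "integrable lborel \<psi>"
    and f_eq: "\<And>x. x > 0 \<Longrightarrow> f x = d * x + (LBINT y:{0..x}. (x - y) * \<psi> y)"
begin

lemma linear_weight_integrable: "set_integrable lborel {a..b} (\<lambda>y. (c - y) * \<psi> y)"
proof -
  have [measurable]: "\<psi> \<in> borel_measurable borel" using \<psi>_int by auto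
  have "integrable lborel (\<lambda>y. (max \<bar>c - a\<bar> \<bar>c - b\<bar>) * \<psi> y)" using \<psi>_int by simp
  then show ?thesis
    unfolding set_integrable_def
    by (rule Bochner_Integration.integrable_bound)
       (auto simp: indicator_def abs_mult intro!: mult_right_mono)
qed

lemma f_eq': "x > 0 \<Longrightarrow> f x = d * x + x * (LBINT y:{0..x}. \<psi> y) - (LBINT y:{0..x}. y * \<psi> y)"
proof -
  assume "x > 0"
  have i: "set_integrable lborel {0..x} (\<lambda>y. x * \<psi> y)" "set_integrable lborel {0..x} (\<lambda>y. y * \<psi> y)"
    using set_integrable_lborel[of "\<lambda>y. x * \<psi> y" "{0..x}"] \<psi>_int linear_weight_integrable[of 0 x 0]
    by (simp_all add: set_integrable_def)
  have "(LBINT y:{0..x}. (x - y) * \<psi> y) = (LBINT y:{0..x}. x * \<psi> y - y * \<psi> y)" by (simp add: left_diff_distrib)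
  also have "\<dots> = x * (LBINT y:{0..x}. \<psi> y) - (LBINT y:{0..x}. y * \<psi> y)"
    by (subst set_integral_diff(2)[OF i]) simp
  finally show ?thesis using f_eq[OF \<open>x > 0\<close>] by simp
qed

lemma weighted_integrable: "set_integrable lborel {0..a} (\<lambda>y. y * \<psi> y)"
  using linear_weight_integrable[of 0 a 0] by (simp add: set_integrable_def)

lemma continuous_on_f: "continuous_on {0<..} f"
proof (rule continuous_on_eq)
  show "continuous_on {0<..} (\<lambda>x. d * x + x * (LBINT y:{0..x}. \<psi> y) - (LBINT y:{0..x}. y * \<psi> y))"
    by (intro continuous_intros continuous_on_subset[OF continuous_on_indefinite_integral] weighted_integrable
        set_integrable_lborel \<psi>_int) auto
qed (simp add: f_eq')

lemma continuous_on_slope: "continuous_on {0..} (slope d \<psi>)"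
  unfolding slope_def
  by (intro continuous_intros continuous_on_indefinite_integral set_integrable_lborel \<psi>_int) auto

lemma slope_limit: "(slope d \<psi> \<longlongrightarrow> d) (at_right 0)"
proof -
  have "(slope d \<psi> \<longlongrightarrow> slope d \<psi> 0) (at_right 0)"
    using continuous_on_slope unfolding continuous_on_def
    by (auto intro: tendsto_within_subset)
  moreover have "slope d \<psi> 0 = d"
    by (simp add: slope_def set_integral_singleton del: atLeastAtMost_singleton)
  ultimately show ?thesis by simp
qed

lemma f_limit: "(f \<longlongrightarrow> 0) (at_right 0)"
proof -
  have c: "continuous_on {0..} (\<lambda>x. d * x + x * (LBINT y:{0..x}. \<psi> y) - (LBINT y:{0..x}. y * \<psi> y))"
    by (intro continuous_intros continuous_on_indefinite_integral weighted_integrable set_integrable_lborel \<psi>_int) auto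
  have "((\<lambda>x. d * x + x * (LBINT y:{0..x}. \<psi> y) - (LBINT y:{0..x}. y * \<psi> y)) \<longlongrightarrow>
      d * 0 + 0 * (LBINT y:{0..0}. \<psi> y) - (LBINT y:{0..0}. y * \<psi> y)) (at_right 0)"
    using c[unfolded continuous_on_def, rule_format, of 0] by (auto intro: tendsto_within_subset)
  moreover have "(LBINT y:{0..0}. y * \<psi> y) = 0"
    by (rule set_integral_singleton)
  ultimately have "((\<lambda>x. d * x + x * (LBINT y:{0..x}. \<psi> y) - (LBINT y:{0..x}. y * \<psi> y)) \<longlongrightarrow> 0) (at_right 0)"
    by simp
  then show ?thesis by (rule tendsto_at_right_0_cong) (simp add: f_eq')
qed

text \<open>
  Taylor's formula \<open>f (x + 1) - f x = f' x + \<integral> (x + 1 - y) f'' y dy\<close> over \<open>[x, x + 1]\<close>; it bounds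
  \<open>f'\<close> in \<open>L\<^sup>1\<close> by \<open>f\<close> and \<open>f''\<close>.
\<close>

lemma f_increment:
  assumes "x > 0"
  shows "f (x + 1) - f x = slope d \<psi> x + (LBINT y:{x..x + 1}. (x + 1 - y) * \<psi> y)"
proof -
  have split: "(LBINT y:{0..x + 1}. h y) = (LBINT y:{0..x}. h y) + (LBINT y:{x..x + 1}. h y)"
    if "\<And>a b. set_integrable lborel {a..b} h" for h :: "real \<Rightarrow> real"
  proof -
    have "integral {0..x} h + integral {x..x + 1} h = integral {0..x + 1} h"
      using assms set_borel_integral_eq_integral(1)[OF that]
      by (intro Henstock_Kurzweil_Integration.integral_combine) auto
    then show ?thesis by (simp add: set_borel_integral_eq_integral(2)[OF that])
  qed
  have 1: "f (x + 1) = d * (x + 1) + ((LBINT y:{0..x}. (x + 1 - y) * \<psi> y) + (LBINT y:{x..x + 1}. (x + 1 - y) * \<psi> y))"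
    using f_eq[of "x + 1"] assms split[OF linear_weight_integrable, of "x + 1"] by simp
  have "(LBINT y:{0..x}. (x + 1 - y) * \<psi> y) = (LBINT y:{0..x}. (x - y) * \<psi> y + \<psi> y)"
    by (simp add: algebra_simps)
  also have "\<dots> = (LBINT y:{0..x}. (x - y) * \<psi> y) + (LBINT y:{0..x}. \<psi> y)"
    by (intro set_integral_add(2) linear_weight_integrable set_integrable_lborel \<psi>_int) auto
  finally show ?thesis
    using 1 f_eq[OF assms] by (simp add: slope_def algebra_simps)
qed

lemma slope_bound:
  assumes "x > 0"
  shows "\<bar>slope d \<psi> x\<bar> \<le> \<bar>f (x + 1)\<bar> + \<bar>f x\<bar> + (LBINT y:{x..x + 1}. \<bar>indicator {0<..} y * \<psi> y\<bar>)"
proof -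
  have "\<bar>LBINT y:{x..x + 1}. (x + 1 - y) * \<psi> y\<bar> \<le> (LBINT y:{x..x + 1}. \<bar>(x + 1 - y) * \<psi> y\<bar>)"
    using set_integral_norm_bound[OF linear_weight_integrable[of x "x + 1" "x + 1"]] by simp
  \<comment> \<open>The weight lies between 0 and 1 on the window. The indicator discards the
    negative half of \<open>\<psi>\<close>, so that integrating over all \<open>x\<close> later
    involves one side only.\<close>
  also have "\<dots> \<le> (LBINT y:{x..x + 1}. \<bar>indicator {0<..} y * \<psi> y\<bar>)"
  proof (rule set_integral_mono)
    show "set_integrable lborel {x..x + 1} (\<lambda>y. \<bar>(x + 1 - y) * \<psi> y\<bar>)"
      by (rule set_integrable_abs[OF linear_weight_integrable])
    show "set_integrable lborel {x..x + 1} (\<lambda>y. \<bar>indicator {0<..} y * \<psi> y\<bar>)"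
      using integrable_mult_indicator[OF _ \<psi>_int, of "{0<..}"]
      by (intro set_integrable_lborel) auto
    fix y assume "y \<in> {x..x + 1}"
    then show "\<bar>(x + 1 - y) * \<psi> y\<bar> \<le> \<bar>indicator {0<..} y * \<psi> y\<bar>"
      using assms mult_right_mono[of "x + 1 - y" 1 "\<bar>\<psi> y\<bar>"] by (simp add: abs_mult)
  qed
  finally show ?thesis using f_increment[OF assms] by linarith
qed

text \<open>Integrate the pointwise bound in \<open>x\<close>: the two values of \<open>f\<close>,
  one of them translated, account for the factor 2, and the window integral returns the mass of
  \<open>\<psi>\<close> once.\<close>

lemma slope_integrable: "set_integrable lborel {0<..} (slope d \<psi>)"
  and slope_integral: "(LBINT x:{0<..}. \<bar>slope d \<psi> x\<bar>) \<le> 2 * (LBINT x:{0<..}. \<bar>f x\<bar>) + (LBINT x:{0<..}. \<bar>\<psi> x\<bar>)"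
proof -
  define h where "h y = indicator {0<..} y * \<psi> y" for y
  have h: "integrable lborel h" unfolding h_def using integrable_mult_indicator[OF _ \<psi>_int, of "{0<..}"] by simp
  have i: "integrable lborel (\<lambda>x. indicator {0<..} x * \<bar>f x\<bar>)"
    using integrable_mult_indicator[of "{0<..}" lborel "\<lambda>x. \<bar>f x\<bar>"] f_int by simp
  have sh: "integrable lborel (\<lambda>x. indicator {0<..} (x + 1) * \<bar>f (x + 1)\<bar>)"
    using lborel_integrable_real_affine[OF i, of 1 1] by (simp add: add.commute)
  have [measurable]: "\<psi> \<in> borel_measurable borel" using \<psi>_int by auto
  have [measurable]: "slope d \<psi> \<in> borel_measurable borel"
    unfolding slope_def[abs_def] set_lebesgue_integral_def indicator_def atLeastAtMost_iff by measurable
  let ?B = "\<lambda>x. indicator {0<..} (x + 1) * \<bar>f (x + 1)\<bar> + indicator {0<..} x * \<bar>f x\<bar> + (LBINT y:{x..x + 1}. \<bar>h y\<bar>)"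
  have B: "integrable lborel ?B" using sh i window_integral(1)[OF h] by simp
  have nn: "0 \<le> (LBINT y:{x..x + 1}. \<bar>h y\<bar>)" for x
    unfolding set_lebesgue_integral_def by (intro Bochner_Integration.integral_nonneg) (auto simp: indicator_def)
  have le: "\<bar>indicator {0<..} x * slope d \<psi> x\<bar> \<le> ?B x" for x
    using slope_bound[of x] nn[of x] by (auto simp: indicator_def h_def)
  then show si: "set_integrable lborel {0<..} (slope d \<psi>)"
    unfolding set_integrable_def
    by (intro Bochner_Integration.integrable_bound[OF B] AE_I2) (auto intro: order_trans[OF _ abs_ge_self])
  have "(LBINT x:{0<..}. \<bar>slope d \<psi> x\<bar>) = (\<integral>x. \<bar>indicator {0<..} x * slope d \<psi> x\<bar> \<partial>lborel)"
    unfolding set_lebesgue_integral_def by (intro Bochner_Integration.integral_cong) (auto simp: indicator_def)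
  also have "\<dots> \<le> (\<integral>x. ?B x \<partial>lborel)"
    using si[unfolded set_integrable_def] by (intro integral_mono B le) auto
  also have "\<dots> = (\<integral>x. indicator {0<..} (x + 1) * \<bar>f (x + 1)\<bar> \<partial>lborel) + (\<integral>x. indicator {0<..} x * \<bar>f x\<bar> \<partial>lborel) + (\<integral>x. \<bar>h x\<bar> \<partial>lborel)"
    using sh i window_integral[OF h] by simp
  also have "(\<integral>x. indicator {0<..} (x + 1) * \<bar>f (x + 1)\<bar> \<partial>lborel) = (\<integral>x. indicator {0<..} x * \<bar>f x\<bar> \<partial>lborel)"
    using lborel_integral_real_affine[of 1 "\<lambda>x. indicator {0<..} x * \<bar>f x\<bar>" 1] by (simp add: add.commute)
  also have "(\<integral>x. \<bar>h x\<bar> \<partial>lborel) = (LBINT x:{0<..}. \<bar>\<psi> x\<bar>)"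
    unfolding set_lebesgue_integral_def h_def by (intro Bochner_Integration.integral_cong) (auto simp: indicator_def)
  finally show "(LBINT x:{0<..}. \<bar>slope d \<psi> x\<bar>) \<le> 2 * (LBINT x:{0<..}. \<bar>f x\<bar>) + (LBINT x:{0<..}. \<bar>\<psi> x\<bar>)"
    by (simp add: set_lebesgue_integral_def)
qed

text \<open>The slope at any point differs from \<open>d\<close> by at most the mass of
  \<open>\<psi>\<close>; averaging over the unit interval next to the origin turns the integral
  bound on the slope into a bound on the number \<open>d\<close>.\<close>

lemma d_bound: "\<bar>d\<bar> \<le> 2 * (LBINT x:{0<..}. \<bar>f x\<bar>) + 2 * (LBINT x:{0<..}. \<bar>\<psi> x\<bar>)"
proof -
  have a: "set_integrable lborel {0<..} (\<lambda>x. \<bar>\<psi> x\<bar>)" using \<psi>_int by (intro set_integrable_lborel) auto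
  have le: "\<bar>d\<bar> \<le> \<bar>slope d \<psi> x\<bar> + (LBINT x:{0<..}. \<bar>\<psi> x\<bar>)" if "x > 0" for x
  proof -
    have "\<bar>LBINT y:{0..x}. \<psi> y\<bar> \<le> (LBINT y:{0..x}. \<bar>\<psi> y\<bar>)"
      using set_integral_norm_bound[OF set_integrable_lborel[OF \<psi>_int, of "{0..x}"]] by simp
    also have "\<dots> = (LBINT y:{0<..x}. \<bar>\<psi> y\<bar>)"
      unfolding set_lebesgue_integral_def using \<psi>_int
      by (intro integral_cong_AE) (use AE_lborel_singleton[of 0] in \<open>auto simp: indicator_def\<close>)
    also have "\<dots> \<le> (LBINT x:{0<..}. \<bar>\<psi> x\<bar>)"
      by (intro set_integral_mono_subset a) auto
    finally show ?thesis by (simp add: slope_def)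
  qed
  have si: "set_integrable lborel {0<..} (\<lambda>x. \<bar>slope d \<psi> x\<bar>)" by (rule set_integrable_abs[OF slope_integrable])
  have si1: "set_integrable lborel {0<..1} (\<lambda>x. \<bar>slope d \<psi> x\<bar>)" by (rule set_integrable_subset[OF si]) auto
  have const: "set_integrable lborel {0<..1} (\<lambda>x :: real. c)" for c :: real
    unfolding set_integrable_def real_scaleR_def
    by (intro integrable_mult_left integrable_real_indicator) (auto simp: emeasure_lborel_Ioc)
  have "\<bar>d\<bar> = (LBINT x:{0<..1::real}. \<bar>d\<bar>)" by (simp add: set_lebesgue_integral_def)
  also have "\<dots> \<le> (LBINT x:{0<..1}. \<bar>slope d \<psi> x\<bar> + (LBINT x:{0<..}. \<bar>\<psi> x\<bar>))"
    by (intro set_integral_mono set_integral_add si1 const le) auto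
  also have "\<dots> = (LBINT x:{0<..1}. \<bar>slope d \<psi> x\<bar>) + (LBINT x:{0<..}. \<bar>\<psi> x\<bar>)"
    by (subst set_integral_add(2)[OF si1 const]) (simp add: set_lebesgue_integral_def)
  also have "(LBINT x:{0<..1}. \<bar>slope d \<psi> x\<bar>) \<le> (LBINT x:{0<..}. \<bar>slope d \<psi> x\<bar>)"
    by (intro set_integral_mono_subset si) auto
  finally show ?thesis using slope_integral by simp
qed

lemma slope_derivative:
  assumes "continuous_on {0<..} \<psi>" "x > 0"
  shows "(slope d \<psi> has_real_derivative \<psi> x) (at x)"
  unfolding slope_def[abs_def]
  by (auto intro!: derivative_eq_intros has_real_derivative_indefinite_integral set_integrable_lborel \<psi>_int assms)

lemma f_derivative:
  assumes c: "continuous_on {0<..} \<psi>" and "x > 0"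
  shows "(f has_real_derivative slope d \<psi> x) (at x)"
proof (rule has_field_derivative_transform_within_open[of _ _ _ "{0<..}"])
  have "((\<lambda>x. LBINT y:{0..x}. \<psi> y) has_real_derivative \<psi> x) (at x)"
    by (intro has_real_derivative_indefinite_integral set_integrable_lborel \<psi>_int assms) auto
  moreover have "((\<lambda>x. LBINT y:{0..x}. y * \<psi> y) has_real_derivative x * \<psi> x) (at x)"
    by (intro has_real_derivative_indefinite_integral weighted_integrable assms continuous_intros)
  ultimately show "((\<lambda>x. d * x + x * (LBINT y:{0..x}. \<psi> y) - (LBINT y:{0..x}. y * \<psi> y)) has_real_derivative slope d \<psi> x) (at x)"
    by (auto intro!: derivative_eq_intros simp: slope_def)
qed (use assms in \<open>auto simp: f_eq'\<close>)

end

section \<open>First-order correctors\<close>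

text \<open>The left branch \<open>l\<close> is a function of the distance to the origin, so both
  branches live on the same half-line; differentiation changes the sign of the left one. The value 0
  at the origin matches \<open>killed_line\<close>.\<close>

definition paste :: "(real \<Rightarrow> real) \<Rightarrow> (real \<Rightarrow> real) \<Rightarrow> real \<Rightarrow> real" where
  "paste r l x = (if x > 0 then r x else if x < 0 then l (- x) else 0)"

lemma paste_integrable:
  assumes "set_integrable lborel {0<..} r" "set_integrable lborel {0<..} l"
  shows "integrable lborel (paste r l)"
proof -
  have "integrable lborel (\<lambda>x. indicator {0<..} x *\<^sub>R r x + indicator {0<..} (- x) *\<^sub>R l (- x))"
    using assms integrable_lborel_uminus[of "\<lambda>x. indicator {0<..} x *\<^sub>R l x"]
    by (intro Bochner_Integration.integrable_add) (auto simp: set_integrable_def)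
  moreover have "(\<lambda>x. indicator {0<..} x *\<^sub>R r x + indicator {0<..} (- x) *\<^sub>R l (- x)) = paste r l"
    by (auto simp: paste_def fun_eq_iff indicator_def)
  ultimately show ?thesis by simp
qed

lemma paste_integral_abs:
  assumes "set_integrable lborel {0<..} r" "set_integrable lborel {0<..} l"
  shows "(\<integral>x. \<bar>paste r l x\<bar> \<partial>lborel) = (LBINT x:{0<..}. \<bar>r x\<bar>) + (LBINT x:{0<..}. \<bar>l x\<bar>)"
proof -
  have "(LBINT x:{0<..}. \<bar>paste r l x\<bar>) = (LBINT x:{0<..}. \<bar>r x\<bar>)"
    "(LBINT x:{0<..}. \<bar>paste r l (- x)\<bar>) = (LBINT x:{0<..}. \<bar>l x\<bar>)"
    by (auto intro!: set_lebesgue_integral_cong simp: paste_def)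
  then show ?thesis using integral_lborel_halves[of "\<lambda>x. \<bar>paste r l x\<bar>"] paste_integrable[OF assms] by simp
qed

lemma uminus_image_greaterThan_0: "uminus ` {0::real<..} = {..<0}"
  by (auto simp: image_iff intro: bexI[of _ "- _"])

lemma paste_absolutely_continuous:
  shows "absolutely_continuous_fun_on {0<..} r \<Longrightarrow> absolutely_continuous_fun_on {0<..} (paste r l)"
    and "absolutely_continuous_fun_on {0<..} l \<Longrightarrow> absolutely_continuous_fun_on {..<0} (paste r l)"
  using absolutely_continuous_fun_on_uminus[of "{0<..}" l]
  by (auto simp: paste_def uminus_image_greaterThan_0 elim!: absolutely_continuous_fun_on_cong)

lemma paste_derivative:
  assumes r: "\<And>x. x > 0 \<Longrightarrow> (r has_real_derivative r' x) (at x)"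
    and l: "\<And>x. x > 0 \<Longrightarrow> (l has_real_derivative l' x) (at x)"
  shows "AE x in lborel. (paste r l has_real_derivative paste r' (\<lambda>x. - l' x) x) (at x)"
  using AE_lborel_singleton[of 0]
proof eventually_elim
  case (elim x)
  then consider "x > 0" | "x < 0" by linarith
  then show ?case
  proof cases
    case 1
    have "(paste r l has_real_derivative r' x) (at x)"
      by (rule has_field_derivative_transform_within_open[OF r[OF 1], of "{0<..}"]) (use 1 in \<open>auto simp: paste_def\<close>)
    then show ?thesis using 1 by (simp add: paste_def)
  next
    case 2
    have "((\<lambda>x. l (- x)) has_real_derivative - l' (- x)) (at x)"
      using l[of "- x"] 2 by (simp add: DERIV_mirror)
    then have "(paste r l has_real_derivative - l' (- x)) (at x)"
      by (rule has_field_derivative_transform_within_open[of _ _ _ "{..<0}"]) (use 2 in \<open>auto simp: paste_def\<close>)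
    then show ?thesis using 2 by (simp add: paste_def)
  qed
qed

lemma paste_Lim:
  shows "(r \<longlongrightarrow> a) (at_right 0) \<Longrightarrow> Lim (at_right 0) (paste r l) = a"
    and "(l \<longlongrightarrow> b) (at_right 0) \<Longrightarrow> Lim (at_left 0) (paste r l) = b"
proof -
  assume "(r \<longlongrightarrow> a) (at_right 0)"
  then have "(paste r l \<longlongrightarrow> a) (at_right 0)" by (rule tendsto_at_right_0_cong) (simp add: paste_def)
  then show "Lim (at_right 0) (paste r l) = a" by (simp add: tendsto_Lim)
next
  assume "(l \<longlongrightarrow> b) (at_right 0)"
  then have "((\<lambda>x. paste r l (- x)) \<longlongrightarrow> b) (at_right 0)" by (rule tendsto_at_right_0_cong) (simp add: paste_def)
  then show "Lim (at_left 0) (paste r l) = b" by (simp add: Lim_at_left_0 tendsto_Lim)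
qed

text \<open>One branch of k/2 - c k'/4 with k = f + e \<open>bump\<close>. The parameter
  \<open>c\<close> is \<epsilon> times the sign of the motion relative to the direction away from
  the origin, so the same formula serves both half-lines.\<close>

definition corrected :: "real \<Rightarrow> real \<Rightarrow> real \<Rightarrow> (real \<Rightarrow> real) \<Rightarrow> (real \<Rightarrow> real) \<Rightarrow> real \<Rightarrow> real" where
  "corrected c e d f \<psi> x = (f x + e * bump x) / 2 - c * (slope d \<psi> x + e * bump' x) / 4"

definition corrected' :: "real \<Rightarrow> real \<Rightarrow> real \<Rightarrow> (real \<Rightarrow> real) \<Rightarrow> real \<Rightarrow> real" where
  "corrected' c e d \<psi> x = (slope d \<psi> x + e * bump' x) / 2 - c * (\<psi> x + e * bump'' x) / 4"

lemma set_integrable_bump [simp]: "S \<in> sets borel \<Longrightarrow> set_integrable lborel S bump"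
    "S \<in> sets borel \<Longrightarrow> set_integrable lborel S bump'" "S \<in> sets borel \<Longrightarrow> set_integrable lborel S bump''"
  by (simp_all add: set_integrable_lborel integrable_bump)

context killed_halfline
begin

lemma set_integrable_parts: "set_integrable lborel {0<..} f" "set_integrable lborel {0<..} \<psi>"
  by (simp_all add: set_integrable_lborel f_int \<psi>_int)

lemma corrected_integrable:
  "set_integrable lborel {0<..} (corrected c e d f \<psi>)"
  "set_integrable lborel {0<..} (corrected' c e d \<psi>)"
  unfolding corrected_def[abs_def] corrected'_def[abs_def]
  by (auto intro!: set_integral_diff set_integral_add set_integrable_divide set_integrable_mult_right
      set_integrable_parts slope_integrable)

lemma corrected_derivative:
  assumes "continuous_on {0<..} \<psi>" "x > 0"
  shows "(corrected c e d f \<psi> has_real_derivative corrected' c e d \<psi> x) (at x)"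
  unfolding corrected_def[abs_def] corrected'_def
  by (auto intro!: derivative_eq_intros f_derivative slope_derivative bump_deriv bump'_deriv assms simp: field_simps)

lemma corrected_absolutely_continuous:
  assumes "continuous_on {0<..} \<psi>"
  shows "absolutely_continuous_fun_on {0<..} (corrected c e d f \<psi>)"
proof (rule absolutely_continuous_fun_onI_C1[where h = "\<lambda>x. indicator {0<..} x * corrected' c e d \<psi> x"])
  show "integrable lborel (\<lambda>x. indicator {0<..} x * corrected' c e d \<psi> x)"
    using corrected_integrable(2) by (simp add: set_integrable_def)
  have "continuous_on {0<..} (corrected' c e d \<psi>)"
    unfolding corrected'_def[abs_def]
    by (intro continuous_intros assms continuous_on_bump continuous_on_subset[OF continuous_on_slope]) auto
  then show "continuous_on {0<..} (\<lambda>x. indicator {0<..} x * corrected' c e d \<psi> x)"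
    by (rule continuous_on_eq) auto
qed (use corrected_derivative[OF assms] in auto)

lemma corrected_limit: "(corrected c e d f \<psi> \<longlongrightarrow> e / 2 - c * d / 4) (at_right 0)"
proof -
  have "(bump \<longlongrightarrow> 1) (at_right 0)" "(bump' \<longlongrightarrow> 0) (at_right 0)"
    using continuous_on_bump(1,2)[of UNIV] bump_0
    by (auto simp: continuous_on_def intro: tendsto_within_subset dest!: spec[of _ 0])
  then have "((\<lambda>x. (f x + e * bump x) / 2 - c * (slope d \<psi> x + e * bump' x) / 4) \<longlongrightarrow>
      (0 + e * 1) / 2 - c * (d + e * 0) / 4) (at_right 0)"
    by (intro tendsto_intros f_limit slope_limit) auto
  then show ?thesis by (simp add: corrected_def[abs_def])
qed

lemma corrected_error:
  assumes "\<bar>c\<bar> = \<epsilon>" "0 < \<epsilon>" "\<epsilon> \<le> 1"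
  shows "(LBINT x:{0<..}. \<bar>corrected c (\<epsilon> * e) d f \<psi> x - f x / 2\<bar>)
    \<le> \<epsilon> * (\<bar>e\<bar> * (\<integral>x. bump x \<partial>lborel) + (LBINT x:{0<..}. \<bar>f x\<bar>) + (LBINT x:{0<..}. \<bar>\<psi> x\<bar>))"
proof -
  let ?R = "\<lambda>x. \<epsilon> * \<bar>e\<bar> * bump x + \<epsilon> / 4 * \<bar>slope d \<psi> x\<bar>"
  have s: "set_integrable lborel {0<..} (\<lambda>x. \<epsilon> / 4 * \<bar>slope d \<psi> x\<bar>)" "set_integrable lborel {0<..} (\<lambda>x. \<epsilon> * \<bar>e\<bar> * bump x)"
    by (auto intro!: set_integrable_mult_right set_integrable_abs slope_integrable)
  have le: "\<bar>corrected c (\<epsilon> * e) d f \<psi> x - f x / 2\<bar> \<le> ?R x" for x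
  proof -
    have "\<bar>c * (slope d \<psi> x + \<epsilon> * e * bump' x)\<bar> \<le> \<epsilon> * (\<bar>slope d \<psi> x\<bar> + \<epsilon> * \<bar>e\<bar> * bump x)"
    proof -
      have "\<bar>slope d \<psi> x + \<epsilon> * e * bump' x\<bar> \<le> \<bar>slope d \<psi> x\<bar> + \<epsilon> * \<bar>e\<bar> * \<bar>bump' x\<bar>"
        using abs_triangle_ineq[of "slope d \<psi> x" "\<epsilon> * e * bump' x"] assms by (simp add: abs_mult)
      also have "\<dots> \<le> \<bar>slope d \<psi> x\<bar> + \<epsilon> * \<bar>e\<bar> * bump x"
        using assms by (intro add_left_mono mult_left_mono bump_bounds) auto
      finally show ?thesis using assms by (simp add: abs_mult mult_left_mono)
    qed
    \<comment> \<open>Here \<open>\<epsilon> \<le> 1\<close> absorbs the second-order contribution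
      of the bump derivative into the first-order one.\<close>
    moreover have "\<epsilon> * (\<epsilon> * \<bar>e\<bar> * bump x) \<le> 1 * (\<epsilon> * \<bar>e\<bar> * bump x)"
      using assms bump_bounds(1)[of x] by (intro mult_right_mono) auto
    ultimately have "\<bar>c * (slope d \<psi> x + \<epsilon> * e * bump' x)\<bar> \<le> \<epsilon> * \<bar>slope d \<psi> x\<bar> + \<epsilon> * \<bar>e\<bar> * bump x"
      by (simp add: distrib_left)
    moreover have "\<bar>\<epsilon> * e * bump x\<bar> = \<epsilon> * \<bar>e\<bar> * bump x" using assms bump_bounds(1)[of x] by (simp add: abs_mult)
    moreover have "corrected c (\<epsilon> * e) d f \<psi> x - f x / 2 = \<epsilon> * e * bump x / 2 - c * (slope d \<psi> x + \<epsilon> * e * bump' x) / 4"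
      by (simp add: corrected_def add_divide_distrib)
    moreover have "0 \<le> \<epsilon> * \<bar>e\<bar> * bump x" using assms bump_bounds(1)[of x] by simp
    ultimately show ?thesis by linarith
  qed
  have "(LBINT x:{0<..}. \<bar>corrected c (\<epsilon> * e) d f \<psi> x - f x / 2\<bar>) \<le> (LBINT x:{0<..}. ?R x)"
    by (intro set_integral_mono le set_integral_add s set_integrable_abs set_integral_diff corrected_integrable
        set_integrable_divide set_integrable_parts)
  also have "\<dots> = \<epsilon> * \<bar>e\<bar> * (LBINT x:{0<..}. bump x) + \<epsilon> / 4 * (LBINT x:{0<..}. \<bar>slope d \<psi> x\<bar>)"
    by (subst set_integral_add(2)[OF s(2,1)]) simp
  also have "\<dots> \<le> \<epsilon> * \<bar>e\<bar> * (\<integral>x. bump x \<partial>lborel) + \<epsilon> / 4 * (4 * ((LBINT x:{0<..}. \<bar>f x\<bar>) + (LBINT x:{0<..}. \<bar>\<psi> x\<bar>)))"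
  proof (intro add_mono mult_left_mono)
    show "(LBINT x:{0<..}. bump x) \<le> (\<integral>x. bump x \<partial>lborel)"
      using set_integral_mono_subset[of UNIV bump "{0<..}"] bump_bounds(1) by (simp add: set_lebesgue_integral_def)
    have "0 \<le> (LBINT x:{0<..}. \<bar>f x\<bar>)" "0 \<le> (LBINT x:{0<..}. \<bar>\<psi> x\<bar>)"
      unfolding set_lebesgue_integral_def by (intro Bochner_Integration.integral_nonneg; simp)+
    then show "(LBINT x:{0<..}. \<bar>slope d \<psi> x\<bar>) \<le> 4 * ((LBINT x:{0<..}. \<bar>f x\<bar>) + (LBINT x:{0<..}. \<bar>\<psi> x\<bar>))"
      using slope_integral by simp
  qed (use assms in auto)
  finally show ?thesis by (simp add: algebra_simps)
qed

text \<open>The class of \<open>\<psi>\<close> enters twice: through the integral formula for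
  \<open>f\<close>, and as an element of the domain of \<open>\<Delta>\<^sub>0\<close> with its own
  continuous representative. Only integrals of \<open>\<psi>\<close> occur in the formula and in the
  slope, so one representative may replace the other.\<close>

lemma cong_AE:
  assumes AE: "AE x in lborel. \<psi> x = \<psi>' x" and "integrable lborel \<psi>'"
  shows "killed_halfline f \<psi>' d" "slope d \<psi> = slope d \<psi>'"
proof -
  have [measurable]: "\<psi> \<in> borel_measurable borel" "\<psi>' \<in> borel_measurable borel"
    using \<psi>_int assms by auto
  have "(LBINT y:{0..x}. (x - y) * \<psi> y) = (LBINT y:{0..x}. (x - y) * \<psi>' y)" for x
    unfolding set_lebesgue_integral_def by (intro integral_cong_AE) (use AE in auto)
  then show "killed_halfline f \<psi>' d"
    using f_eq f_int assms by unfold_locales auto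
  have "(LBINT y:{0..x}. \<psi> y) = (LBINT y:{0..x}. \<psi>' y)" for x
    unfolding set_lebesgue_integral_def by (intro integral_cong_AE) (use AE in auto)
  then show "slope d \<psi> = slope d \<psi>'" by (simp add: slope_def fun_eq_iff)
qed

end

lemma set_integrable_uminus: "set_integrable M S' h \<Longrightarrow> set_integrable M S' (\<lambda>x. - h x :: real)"
  by (simp add: set_integrable_def)

lemma killed_halfline_linear:
  assumes "killed_halfline f \<psi> d" "killed_halfline g \<theta> b"
  shows "killed_halfline (\<lambda>x. f x + a * g x) (\<lambda>x. \<psi> x + a * \<theta> x) (d + a * b)"
    and "slope (d + a * b) (\<lambda>x. \<psi> x + a * \<theta> x) x = slope d \<psi> x + a * slope b \<theta> x"
proof -
  interpret f: killed_halfline f \<psi> d by fact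
  interpret g: killed_halfline g \<theta> b by fact
  show "killed_halfline (\<lambda>x. f x + a * g x) (\<lambda>x. \<psi> x + a * \<theta> x) (d + a * b)"
  proof
    fix x :: real assume "x > 0"
    have "(LBINT y:{0..x}. (x - y) * (\<psi> y + a * \<theta> y)) = (LBINT y:{0..x}. (x - y) * \<psi> y + a * ((x - y) * \<theta> y))"
      by (simp add: algebra_simps)
    also have "\<dots> = (LBINT y:{0..x}. (x - y) * \<psi> y) + (LBINT y:{0..x}. a * ((x - y) * \<theta> y))"
      by (intro set_integral_add(2) set_integrable_mult_right f.linear_weight_integrable g.linear_weight_integrable)
    also have "(LBINT y:{0..x}. a * ((x - y) * \<theta> y)) = a * (LBINT y:{0..x}. (x - y) * \<theta> y)"
      by (rule set_integral_mult_right)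
    finally show "f x + a * g x = (d + a * b) * x + (LBINT y:{0..x}. (x - y) * (\<psi> y + a * \<theta> y))"
      unfolding f.f_eq[OF \<open>x > 0\<close>] g.f_eq[OF \<open>x > 0\<close>] by algebra
  qed (use f.f_int g.f_int f.\<psi>_int g.\<psi>_int in auto)
  have "(LBINT y:{0..x}. \<psi> y + a * \<theta> y) = (LBINT y:{0..x}. \<psi> y) + (LBINT y:{0..x}. a * \<theta> y)"
    by (intro set_integral_add(2) set_integrable_mult_right set_integrable_lborel f.\<psi>_int g.\<psi>_int) auto
  then show "slope (d + a * b) (\<lambda>x. \<psi> x + a * \<theta> x) x = slope d \<psi> x + a * slope b \<theta> x"
    by (simp add: slope_def algebra_simps)
qed

text \<open>The condition at the origin matches the convention of \<open>paste\<close>, so the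
  identities between correctors and their limits hold at every point.\<close>

definition killed_line :: "(real \<Rightarrow> real) \<Rightarrow> (real \<Rightarrow> real) \<Rightarrow> real \<Rightarrow> real \<Rightarrow> bool" where
  "killed_line f \<psi> d d' \<longleftrightarrow> killed_halfline f \<psi> d \<and> killed_halfline (\<lambda>x. f (- x)) (\<lambda>x. \<psi> (- x)) d' \<and> f 0 = 0"

lemma \<Delta>\<^sub>0_E:
  assumes "(\<phi>, \<theta>) \<in> \<Delta>\<^sub>0"
  obtains f \<psi> d d' where "\<phi> = L1_class f" "\<theta> = L1_class \<psi>" "killed_line f \<psi> d d'"
proof -
  obtain f \<psi> C D where fg: "\<phi> = L1_class f" "\<theta> = L1_class \<psi>" and i: "integrable lborel f" "integrable lborel \<psi>"
    and eq: "\<And>x. f x = (C * x - (LBINT y:{x..0}. (x - y) * \<psi> y)) * of_bool (x < 0) +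
           (D * x + (LBINT y:{0..x}. (x - y) * \<psi> y)) * of_bool (x > 0)"
    using assms unfolding \<Delta>\<^sub>0_def ref_real_def by blast
  have "killed_halfline f \<psi> D" by standard (use i eq in auto)
  \<comment> \<open>Reflection turns the left slope \<open>C\<close> into \<open>- C\<close>, the
    slope measured away from the origin.\<close>
  moreover have "killed_halfline (\<lambda>x. f (- x)) (\<lambda>x. \<psi> (- x)) (- C)"
  proof
    fix x :: real assume "x > 0"
    have "(LBINT y:{- x..0}. (- x - y) * \<psi> y) = (\<integral>y. indicator {- x..0} (- y) *\<^sub>R ((- x - - y) * \<psi> (- y)) \<partial>lborel)"
      unfolding set_lebesgue_integral_def by (rule integral_lborel_uminus[symmetric])
    also have "\<dots> = (\<integral>y. - (indicator {0..x} y *\<^sub>R ((x - y) * \<psi> (- y))) \<partial>lborel)"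
      by (intro Bochner_Integration.integral_cong) (auto simp: indicator_def algebra_simps)
    also have "\<dots> = - (LBINT y:{0..x}. (x - y) * \<psi> (- y))"
      unfolding set_lebesgue_integral_def by (rule Bochner_Integration.integral_minus)
    finally show "f (- x) = - C * x + (LBINT y:{0..x}. (x - y) * \<psi> (- y))"
      using eq[of "- x"] \<open>x > 0\<close> by simp
  qed (use i integrable_lborel_uminus in auto)
  moreover have "f 0 = 0" using eq[of 0] by simp
  ultimately show thesis using that fg unfolding killed_line_def by blast
qed

text \<open>The ansatz k/2 - \<epsilon> i k'/4 on both half-lines, with \<open>er\<close> and
  \<open>el\<close> the even boundary values in units of \<epsilon>. On the left the derivative in
  the reflected variable has the opposite sign, hence \<open>- \<epsilon>\<close>.\<close>

definition corrector :: "real \<Rightarrow> real \<Rightarrow> real \<Rightarrow> (real \<Rightarrow> real) \<Rightarrow> (real \<Rightarrow> real) \<Rightarrow> real \<Rightarrow> real \<Rightarrow> S \<Rightarrow> real" where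
  "corrector \<epsilon> er el f \<psi> d d' = (\<lambda>(x, i). paste
     (corrected (\<epsilon> * real_of_sign i) (\<epsilon> * er) d f \<psi>)
     (corrected (- \<epsilon> * real_of_sign i) (\<epsilon> * el) d' (\<lambda>x. f (- x)) (\<lambda>x. \<psi> (- x))) x)"

lemma abs_real_of_sign: "\<bar>real_of_sign i\<bar> = 1"
  using sign_cases[of i] by auto

lemma paste_linear: "paste r l x + a * paste r' l' x = paste (\<lambda>x. r x + a * r' x) (\<lambda>x. l x + a * l' x) x"
  by (simp add: paste_def)

lemma killed_line_linear:
  assumes "killed_line f \<psi> d d'" "killed_line g \<theta> b b'"
  shows "killed_line (\<lambda>x. f x + a * g x) (\<lambda>x. \<psi> x + a * \<theta> x) (d + a * b) (d' + a * b')"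
    and "corrector \<epsilon> (er + a * er') (el + a * el') (\<lambda>x. f x + a * g x) (\<lambda>x. \<psi> x + a * \<theta> x) (d + a * b) (d' + a * b') z
      = corrector \<epsilon> er el f \<psi> d d' z + a * corrector \<epsilon> er' el' g \<theta> b b' z"
proof -
  note k = assms[unfolded killed_line_def]
  show "killed_line (\<lambda>x. f x + a * g x) (\<lambda>x. \<psi> x + a * \<theta> x) (d + a * b) (d' + a * b')"
    using k killed_halfline_linear(1) unfolding killed_line_def by auto
  have r: "slope (d + a * b) (\<lambda>x. \<psi> x + a * \<theta> x) x = slope d \<psi> x + a * slope b \<theta> x"
    and l: "slope (d' + a * b') (\<lambda>x. \<psi> (- x) + a * \<theta> (- x)) x = slope d' (\<lambda>x. \<psi> (- x)) x + a * slope b' (\<lambda>x. \<theta> (- x)) x" for x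
    using k killed_halfline_linear(2) by blast+
  show "corrector \<epsilon> (er + a * er') (el + a * el') (\<lambda>x. f x + a * g x) (\<lambda>x. \<psi> x + a * \<theta> x) (d + a * b) (d' + a * b') z
      = corrector \<epsilon> er el f \<psi> d d' z + a * corrector \<epsilon> er' el' g \<theta> b b' z"
    unfolding corrector_def case_prod_beta' paste_linear corrected_def r l
    by (simp add: paste_def field_simps)
qed

lemma killed_line_norms:
  assumes "killed_line f \<psi> d d'"
  shows "integrable lborel f" "integrable lborel \<psi>"
    and "norm (L1_class f) = (LBINT x:{0<..}. \<bar>f x\<bar>) + (LBINT x:{0<..}. \<bar>f (- x)\<bar>)"
    and "norm (L1_class \<psi>) = (LBINT x:{0<..}. \<bar>\<psi> x\<bar>) + (LBINT x:{0<..}. \<bar>\<psi> (- x)\<bar>)"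
    and "\<bar>d\<bar> + \<bar>d'\<bar> \<le> 2 * (norm (L1_class f) + norm (L1_class \<psi>))"
proof -
  interpret r: killed_halfline f \<psi> d using assms by (simp add: killed_line_def)
  interpret l: killed_halfline "\<lambda>x. f (- x)" "\<lambda>x. \<psi> (- x)" d' using assms by (simp add: killed_line_def)
  show "integrable lborel f" "integrable lborel \<psi>" by (rule r.f_int r.\<psi>_int)+
  show n: "norm (L1_class f) = (LBINT x:{0<..}. \<bar>f x\<bar>) + (LBINT x:{0<..}. \<bar>f (- x)\<bar>)"
    "norm (L1_class \<psi>) = (LBINT x:{0<..}. \<bar>\<psi> x\<bar>) + (LBINT x:{0<..}. \<bar>\<psi> (- x)\<bar>)"
    using integral_lborel_halves[of "\<lambda>x. \<bar>f x\<bar>"] integral_lborel_halves[of "\<lambda>x. \<bar>\<psi> x\<bar>"] r.f_int r.\<psi>_int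
    by (simp_all add: norm_L1_class ref_real_def)
  show "\<bar>d\<bar> + \<bar>d'\<bar> \<le> 2 * (norm (L1_class f) + norm (L1_class \<psi>))"
    unfolding n using r.d_bound l.d_bound by simp
qed

lemma corrector_integrable:
  assumes "killed_line f \<psi> d d'"
  shows "integrable ref (corrector \<epsilon> er el f \<psi> d d')"
  unfolding integrable_S_iff corrector_def
  using assms by (auto simp: killed_line_def intro!: paste_integrable killed_halfline.corrected_integrable)

lemma corrector_error:
  assumes k: "killed_line f \<psi> d d'" and \<epsilon>: "0 < \<epsilon>" "\<epsilon> \<le> 1"
  shows "norm (L1_class (corrector \<epsilon> er el f \<psi> d d') - J (L1_class f))
    \<le> \<epsilon> * (2 * (\<bar>er\<bar> + \<bar>el\<bar>) * (\<integral>x. bump x \<partial>lborel) + 2 * (norm (L1_class f) + norm (L1_class \<psi>)))"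
proof -
  interpret r: killed_halfline f \<psi> d using k by (simp add: killed_line_def)
  interpret l: killed_halfline "\<lambda>x. f (- x)" "\<lambda>x. \<psi> (- x)" d' using k by (simp add: killed_line_def)
  define er1 where "er1 i x = corrected (\<epsilon> * real_of_sign i) (\<epsilon> * er) d f \<psi> x - f x / 2" for i x
  define el1 where "el1 i x = corrected (- \<epsilon> * real_of_sign i) (\<epsilon> * el) d' (\<lambda>x. f (- x)) (\<lambda>x. \<psi> (- x)) x - f (- x) / 2" for i x
  have i: "set_integrable lborel {0<..} (er1 i)" "set_integrable lborel {0<..} (el1 i)" for i
    unfolding er1_def[abs_def] el1_def[abs_def]
    by (intro set_integral_diff set_integrable_divide r.corrected_integrable l.corrected_integrable
      r.set_integrable_parts l.set_integrable_parts)+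
  have eq: "L1_class (corrector \<epsilon> er el f \<psi> d d') - J (L1_class f) = L1_class (\<lambda>(x, i). paste (er1 i) (el1 i) x)"
  proof -
    have "L1_class (corrector \<epsilon> er el f \<psi> d d') - J (L1_class f)
        = L1_class (\<lambda>z. corrector \<epsilon> er el f \<psi> d d' z - (case z of (x, i) \<Rightarrow> f x / 2))"
      using corrector_integrable[OF k] integrable_lift_S[OF r.f_int] r.f_int
      by (simp add: J_class ref_real_def L1_class_minus)
    also have "\<dots> = L1_class (\<lambda>(x, i). paste (er1 i) (el1 i) x)"
    proof (rule arg_cong[of _ _ L1_class], rule ext)
      fix z :: S obtain x i where z: "z = (x, i)" by (cases z)
      consider "x > 0" | "x < 0" | "x = 0" by linarith
      then show "corrector \<epsilon> er el f \<psi> d d' z - (case z of (x, i) \<Rightarrow> f x / 2) = (case z of (x, i) \<Rightarrow> paste (er1 i) (el1 i) x)"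
        using k by cases (simp_all add: z corrector_def paste_def er1_def el1_def killed_line_def)
    qed
    finally show ?thesis .
  qed
  have int: "integrable ref (\<lambda>(x, i). paste (er1 i) (el1 i) x)"
    unfolding integrable_S_iff using i by (auto intro!: paste_integrable)
  have b: "(LBINT x:{0<..}. \<bar>er1 i x\<bar>) \<le> \<epsilon> * (\<bar>er\<bar> * (\<integral>x. bump x \<partial>lborel) + (LBINT x:{0<..}. \<bar>f x\<bar>) + (LBINT x:{0<..}. \<bar>\<psi> x\<bar>))"
    "(LBINT x:{0<..}. \<bar>el1 i x\<bar>) \<le> \<epsilon> * (\<bar>el\<bar> * (\<integral>x. bump x \<partial>lborel) + (LBINT x:{0<..}. \<bar>f (- x)\<bar>) + (LBINT x:{0<..}. \<bar>\<psi> (- x)\<bar>))" for i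
    unfolding er1_def el1_def using \<epsilon>
    by (intro r.corrected_error l.corrected_error; simp add: abs_mult abs_real_of_sign)+
  have "norm (L1_class (corrector \<epsilon> er el f \<psi> d d') - J (L1_class f))
      = ((LBINT x:{0<..}. \<bar>er1 1 x\<bar>) + (LBINT x:{0<..}. \<bar>el1 1 x\<bar>)) + ((LBINT x:{0<..}. \<bar>er1 (- 1) x\<bar>) + (LBINT x:{0<..}. \<bar>el1 (- 1) x\<bar>))"
    unfolding eq norm_S_class[OF int] by (simp add: paste_integral_abs i)
  also have "\<dots> \<le> \<epsilon> * (2 * (\<bar>er\<bar> + \<bar>el\<bar>) * (\<integral>x. bump x \<partial>lborel) + 2 * (norm (L1_class f) + norm (L1_class \<psi>)))"
    unfolding killed_line_norms(3,4)[OF k] using b[of 1] b[of "- 1"] by (simp add: algebra_simps)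
  finally show ?thesis .
qed

text \<open>
  The second derivative \<open>\<psi>\<close> is itself required to lie in the domain of \<open>\<Delta>\<^sub>0\<close>: it is then continuous off
  the origin, so that the corrector is differentiable there without an appeal to Lebesgue's differentiation theorem.
\<close>

lemma corrector_in_G:
  assumes k: "killed_line f \<psi> d d'" and k': "killed_line \<psi> \<theta> b b'" and \<epsilon>: "0 < \<epsilon>"
    and bc: "er - d / 2 = p * (el + d' / 2) + q' * (er + d / 2)" "el - d' / 2 = p' * (el + d' / 2) + q * (er + d / 2)"
  obtains v where "(L1_class (corrector \<epsilon> er el f \<psi> d d'), v) \<in> G p p' q q' \<epsilon>"
    "norm (v - (1 / 2) *\<^sub>R J (L1_class \<psi>)) \<le> \<epsilon> * (3 * (\<bar>er\<bar> + \<bar>el\<bar>) * (\<integral>x. bump x \<partial>lborel))"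
proof -
  interpret r: killed_halfline f \<psi> d using k by (simp add: killed_line_def)
  interpret l: killed_halfline "\<lambda>x. f (- x)" "\<lambda>x. \<psi> (- x)" d' using k by (simp add: killed_line_def)
  have cont: "continuous_on {0<..} \<psi>" "continuous_on {0<..} (\<lambda>x. \<psi> (- x))"
    using k' killed_halfline.continuous_on_f unfolding killed_line_def by blast+
  define u where "u = corrector \<epsilon> er el f \<psi> d d'"
  define g where "g = (\<lambda>(x, i). paste (corrected' (\<epsilon> * real_of_sign i) (\<epsilon> * er) d \<psi>)
     (\<lambda>x. - corrected' (- \<epsilon> * real_of_sign i) (\<epsilon> * el) d' (\<lambda>x. \<psi> (- x)) x) x)"
  define w where "w = (\<lambda>(x, i :: sign). paste (\<lambda>x. (\<psi> x + \<epsilon> * er * bump'' x) / 4) (\<lambda>x. (\<psi> (- x) + \<epsilon> * el * bump'' x) / 4) x)"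
  have u: "integrable ref u" unfolding u_def by (rule corrector_integrable[OF k])
  have g: "integrable ref g"
    unfolding integrable_S_iff g_def
    by (auto intro!: paste_integrable r.corrected_integrable set_integrable_uminus l.corrected_integrable)
  have "((L1_class u), L1_class (\<lambda>(x, i). - real_of_sign i * g (x, i))) \<in> A p p' q q'"
    unfolding A_def
  proof (rule CollectI, rule exI[of _ u], rule exI[of _ g], intro conjI allI refl u g)
    fix i
    show "absolutely_continuous_fun_on {0<..} (\<lambda>x. u (x, i))" "absolutely_continuous_fun_on {..<0} (\<lambda>x. u (x, i))"
      unfolding u_def corrector_def
      by (auto intro!: paste_absolutely_continuous r.corrected_absolutely_continuous l.corrected_absolutely_continuous cont)
    show "AE x in lborel. ((\<lambda>y. u (y, i)) has_real_derivative g (x, i)) (at x)"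
      unfolding u_def corrector_def g_def prod.case
      by (intro paste_derivative r.corrected_derivative l.corrected_derivative cont)
  next
    have R: "Lim (at_right 0) (\<lambda>x. u (x, i)) = \<epsilon> * er / 2 - \<epsilon> * real_of_sign i * d / 4"
      and L: "Lim (at_left 0) (\<lambda>x. u (x, i)) = \<epsilon> * el / 2 - - \<epsilon> * real_of_sign i * d' / 4" for i
      unfolding u_def corrector_def prod.case
      by (intro paste_Lim r.corrected_limit l.corrected_limit)+
    \<comment> \<open>Since \<open>f\<close> vanishes at the origin, all boundary values are
      proportional to \<epsilon>; the interface condition is the hypothesis \<open>bc(1)\<close>
      multiplied by \<open>\<epsilon> / 2\<close>.\<close>
    have "\<epsilon> * er / 2 - \<epsilon> * 1 * d / 4 = \<epsilon> / 2 * (er - d / 2)" by (simp add: algebra_simps)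
    also have "\<dots> = \<epsilon> / 2 * (p * (el + d' / 2) + q' * (er + d / 2))" by (simp only: bc(1))
    also have "\<dots> = p * (\<epsilon> * el / 2 - - \<epsilon> * 1 * d' / 4) + q' * (\<epsilon> * er / 2 - \<epsilon> * - 1 * d / 4)"
      by (simp add: algebra_simps)
    finally show "Lim (at_right 0) (\<lambda>x. u (x, 1)) = p * Lim (at_left 0) (\<lambda>x. u (x, 1)) + q' * Lim (at_right 0) (\<lambda>x. u (x, - 1))"
      unfolding R L real_of_sign_simps .
    have "\<epsilon> * el / 2 - - \<epsilon> * - 1 * d' / 4 = \<epsilon> / 2 * (el - d' / 2)" by (simp add: algebra_simps)
    also have "\<dots> = \<epsilon> / 2 * (p' * (el + d' / 2) + q * (er + d / 2))" by (simp only: bc(2))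
    also have "\<dots> = p' * (\<epsilon> * el / 2 - - \<epsilon> * 1 * d' / 4) + q * (\<epsilon> * er / 2 - \<epsilon> * - 1 * d / 4)"
      by (simp add: algebra_simps)
    finally show "Lim (at_left 0) (\<lambda>x. u (x, - 1)) = p' * Lim (at_left 0) (\<lambda>x. u (x, 1)) + q * Lim (at_right 0) (\<lambda>x. u (x, - 1))"
      unfolding R L real_of_sign_simps .
  qed
  moreover define v where "v = (1 / \<epsilon>) *\<^sub>R L1_class (\<lambda>(x, i). - real_of_sign i * g (x, i)) + (1 / \<epsilon>\<^sup>2) *\<^sub>R (B (L1_class u) - L1_class u)"
  ultimately have inG: "(L1_class u, v) \<in> G p p' q q' \<epsilon>" unfolding G_def by blast
  have v: "v = L1_class w"
  proof -
    have "v = L1_class (\<lambda>z. 1 / \<epsilon> * (case z of (x, i) \<Rightarrow> - real_of_sign i * g (x, i)) + 1 / \<epsilon>\<^sup>2 * ((case z of (x, i) \<Rightarrow> u (x, - i)) - u z))"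
      unfolding v_def using u integrable_flip[OF u] integrable_real_of_sign[OF g]
      by (simp add: B_class L1_class_minus L1_class_scale L1_class_plus)
    also have "\<dots> = L1_class w"
    proof (rule arg_cong[of _ _ L1_class], rule ext)
      fix z :: S obtain x i where z: "z = (x, i)" by (cases z)
      have s: "real_of_sign i * real_of_sign i = 1" using sign_cases[of i] by auto
      \<comment> \<open>With \<open>K\<close>, \<open>K1\<close>, \<open>K2\<close> standing for k,
        k', k'': the transport of the even part and the relaxation of the odd part cancel, and what
        is left is exact, with no remainder in \<epsilon>.\<close>
      have *: "1 / \<epsilon> * (- s * (K1 / 2 - \<epsilon> * s * K2 / 4)) + 1 / \<epsilon>\<^sup>2 * ((K / 2 - \<epsilon> * - s * K1 / 4) - (K / 2 - \<epsilon> * s * K1 / 4)) = K2 / 4"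
        if "s * s = 1" for s K K1 K2 :: real
      proof -
        have "1 / \<epsilon> * (- s * (K1 / 2 - \<epsilon> * s * K2 / 4)) + 1 / \<epsilon>\<^sup>2 * ((K / 2 - \<epsilon> * - s * K1 / 4) - (K / 2 - \<epsilon> * s * K1 / 4)) = (s * s) * K2 / 4"
          using \<epsilon> by (simp add: field_simps power2_eq_square)
        then show ?thesis using that by simp
      qed
      show "1 / \<epsilon> * (case z of (x, i) \<Rightarrow> - real_of_sign i * g (x, i)) + 1 / \<epsilon>\<^sup>2 * ((case z of (x, i) \<Rightarrow> u (x, - i)) - u z) = w z" (is "?lhs = _")
      proof -
        consider "x > 0" | "x < 0" | "x = 0" by linarith
        then show ?thesis
        proof cases
          case 1
          let ?K = "f x + \<epsilon> * er * bump x" and ?K1 = "slope d \<psi> x + \<epsilon> * er * bump' x"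
            and ?K2 = "\<psi> x + \<epsilon> * er * bump'' x" and ?s = "real_of_sign i"
          have "?lhs = 1 / \<epsilon> * (- ?s * (?K1 / 2 - \<epsilon> * ?s * ?K2 / 4)) + 1 / \<epsilon>\<^sup>2 * ((?K / 2 - \<epsilon> * - ?s * ?K1 / 4) - (?K / 2 - \<epsilon> * ?s * ?K1 / 4))"
            using 1 by (simp add: z u_def g_def corrector_def corrected_def corrected'_def paste_def)
          also have "\<dots> = ?K2 / 4" by (rule *[OF s])
          finally show ?thesis using 1 by (simp add: z w_def paste_def)
        next
          case 2
          \<comment> \<open>In the reflected variable the velocity is reversed, so the identity is
            used with \<open>?s\<close> equal to minus the sign.\<close>
          let ?K = "f x + \<epsilon> * el * bump (- x)" and ?K1 = "slope d' (\<lambda>x. \<psi> (- x)) (- x) + \<epsilon> * el * bump' (- x)"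
            and ?K2 = "\<psi> x + \<epsilon> * el * bump'' (- x)" and ?s = "- real_of_sign i"
          have "?lhs = 1 / \<epsilon> * (- ?s * (?K1 / 2 - \<epsilon> * ?s * ?K2 / 4)) + 1 / \<epsilon>\<^sup>2 * ((?K / 2 - \<epsilon> * - ?s * ?K1 / 4) - (?K / 2 - \<epsilon> * ?s * ?K1 / 4))"
            using 2 by (simp add: z u_def g_def corrector_def corrected_def corrected'_def paste_def algebra_simps)
          also have "\<dots> = ?K2 / 4" by (rule *) (use s in simp)
          finally show ?thesis using 2 by (simp add: z w_def paste_def)
        qed (simp add: z w_def u_def g_def corrector_def paste_def)
      qed
    qed
    finally show ?thesis .
  qed
  \<comment> \<open>The whole residual: after k''/4 is compared with \<psi>/4, only the second
    derivative of the bumps remains.\<close>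
  define y where "y = (\<lambda>(x, i :: sign). paste (\<lambda>x. \<epsilon> * er / 4 * bump'' x) (\<lambda>x. \<epsilon> * el / 4 * bump'' x) x)"
  have si: "set_integrable lborel {0<..} (\<lambda>x. c * bump'' x)" for c by (intro set_integrable_mult_right) simp
  have y: "integrable ref y"
    unfolding integrable_S_iff y_def by (auto intro!: paste_integrable si)
  have \<psi>0: "\<psi> 0 = 0" using k' by (simp add: killed_line_def)
  have w: "integrable ref w"
    unfolding integrable_S_iff w_def
    by (auto intro!: paste_integrable set_integrable_divide set_integral_add r.set_integrable_parts l.set_integrable_parts si)
  have J2: "(1 / 2) *\<^sub>R J (L1_class \<psi>) = L1_class (\<lambda>z. 1 / 2 * (case z of (x, i) \<Rightarrow> \<psi> x / 2))"
    using integrable_lift_S[of \<psi>] r.\<psi>_int by (simp add: J_class ref_real_def L1_class_scale)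
  have "v - (1 / 2) *\<^sub>R J (L1_class \<psi>) = L1_class (\<lambda>z. w z - 1 / 2 * (case z of (x, i) \<Rightarrow> \<psi> x / 2))"
    unfolding v J2 using integrable_mult_right[OF integrable_lift_S[OF r.\<psi>_int], of "1 / 2"] w by (intro L1_class_minus) auto
  also have "(\<lambda>z. w z - 1 / 2 * (case z of (x, i) \<Rightarrow> \<psi> x / 2)) = y"
  proof (rule ext)
    fix z :: S obtain x i where z: "z = (x, i)" by (cases z)
    consider "x > 0" | "x < 0" | "x = 0" by linarith
    then show "w z - 1 / 2 * (case z of (x, i) \<Rightarrow> \<psi> x / 2) = y z"
      by cases (simp_all add: z w_def y_def paste_def add_divide_distrib \<psi>0)
  qed
  finally have eq: "v - (1 / 2) *\<^sub>R J (L1_class \<psi>) = L1_class y" .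
  \<comment> \<open>The factor 3/2 is 6/4, with 6 from the bound on \<open>bump''\<close>; summing
    over the two signs makes it the 3 of the conclusion.\<close>
  have b: "(LBINT x:{0<..}. \<bar>\<epsilon> * e / 4 * bump'' x\<bar>) \<le> \<epsilon> * (3 / 2 * \<bar>e\<bar> * (\<integral>x. bump x \<partial>lborel))" for e
  proof -
    have "(LBINT x:{0<..}. \<bar>\<epsilon> * e / 4 * bump'' x\<bar>) \<le> (LBINT x:{0<..}. \<epsilon> * \<bar>e\<bar> / 4 * 6 * bump x)"
    proof (intro set_integral_mono set_integrable_abs si set_integrable_mult_right)
      show "\<bar>\<epsilon> * e / 4 * bump'' x\<bar> \<le> \<epsilon> * \<bar>e\<bar> / 4 * 6 * bump x" for x
        using mult_left_mono[OF bump_bounds(3)[of x], of "\<epsilon> * \<bar>e\<bar> / 4"] \<epsilon> by (simp add: abs_mult)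
    qed simp
    also have "\<dots> = \<epsilon> * \<bar>e\<bar> / 4 * 6 * (LBINT x:{0<..}. bump x)" by (rule set_integral_mult_right)
    also have "\<dots> \<le> \<epsilon> * \<bar>e\<bar> / 4 * 6 * (\<integral>x. bump x \<partial>lborel)"
      using set_integral_mono_subset[of UNIV bump "{0<..}"] bump_bounds(1) \<epsilon>
      by (intro mult_left_mono) (auto simp: set_lebesgue_integral_def)
    finally show ?thesis by simp
  qed
  have "(\<integral>x. \<bar>y (x, i)\<bar> \<partial>lborel) = (LBINT x:{0<..}. \<bar>\<epsilon> * er / 4 * bump'' x\<bar>) + (LBINT x:{0<..}. \<bar>\<epsilon> * el / 4 * bump'' x\<bar>)" for i
    unfolding y_def prod.case by (rule paste_integral_abs[OF si si])
  then have "norm (L1_class y) = 2 * ((LBINT x:{0<..}. \<bar>\<epsilon> * er / 4 * bump'' x\<bar>) + (LBINT x:{0<..}. \<bar>\<epsilon> * el / 4 * bump'' x\<bar>))"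
    unfolding norm_S_class[OF y] by simp
  also have "\<dots> \<le> \<epsilon> * (3 * (\<bar>er\<bar> + \<bar>el\<bar>) * (\<integral>x. bump x \<partial>lborel))"
    using b[of er] b[of el] by (simp add: algebra_simps)
  finally show thesis using that[OF inG[unfolded u_def]] by (simp add: eq)
qed

section \<open>The interface conditions\<close>

text \<open>Taking the odd part of a domain element generally destroys the interface conditions.
  Subtracting bumps that match its one-sided limits makes all boundary values 0, so the conditions
  hold trivially, and bumps compressed by a factor \<open>k\<close> carry mass of order 1/k
  only.\<close>

lemma odd_A_dense:
  assumes \<phi>: "(\<phi>, \<xi>) \<in> A p p' q q'" and "e > 0"
  obtains \<phi>' \<xi>' where "(\<phi>', \<xi>') \<in> A p p' q q'" "B \<phi>' = - \<phi>'" "norm (\<phi>' - (1 / 2) *\<^sub>R (\<phi> - B \<phi>)) < e"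
proof -
  obtain f g where fg: "\<phi> = L1_class f" "integrable ref f" "integrable ref g"
    and hr: "\<And>i. halfline_function (\<lambda>x. f (x, i)) (\<lambda>x. g (x, i))"
    and hl: "\<And>i. halfline_function (\<lambda>x. f (- x, i)) (\<lambda>x. - g (- x, i))"
    and ac: "\<And>i. absolutely_continuous_fun_on {..<0} (\<lambda>x. f (x, i))"
    using \<phi> by (rule A_E) (blast intro: that)
  note fi = integrable_S_section[OF fg(2)] and gi = integrable_S_section[OF fg(3)]
  define r where "r x = (f (x, 1) + (- 1) * f (x, - 1)) / 2" for x
  define r' where "r' x = (g (x, 1) + (- 1) * g (x, - 1)) / 2" for x
  define a where "a = (Lim (at_right 0) (\<lambda>x. f (x, 1)) + (- 1) * Lim (at_right 0) (\<lambda>x. f (x, - 1))) / 2"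
  define b where "b = (Lim (at_right 0) (\<lambda>x. f (- x, 1)) + (- 1) * Lim (at_right 0) (\<lambda>x. f (- x, - 1))) / 2"
  define K where "K = (\<integral>x. bump x \<partial>lborel)"
  \<comment> \<open>A compressed bump has mass \<open>K / k\<close>; the factor 2 counts the two
    signs.\<close>
  have "\<exists>k>0. (\<bar>a\<bar> + \<bar>b\<bar>) * K * 2 / k < e"
    using \<open>e > 0\<close> by (intro exI[of _ "(\<bar>(\<bar>a\<bar> + \<bar>b\<bar>) * K * 2\<bar> + 1) / e"]) (auto simp: divide_less_eq intro!: divide_pos_pos)
  then obtain k where k: "k > 0" "(\<bar>a\<bar> + \<bar>b\<bar>) * K * 2 / k < e" by blast
  define c where "c = paste (\<lambda>x. a * bump (k * x)) (\<lambda>x. b * bump (k * x))"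
  define c' where "c' = paste (\<lambda>x. a * (k * bump' (k * x))) (\<lambda>x. - (b * (k * bump' (k * x))))"
  define u where "u = (\<lambda>(x, i). real_of_sign i * (r x + (- 1) * c x))"
  define u' where "u' = (\<lambda>(x, i). real_of_sign i * (r' x + (- 1) * c' x))"
  have bi: "integrable lborel (\<lambda>x. bump (k * x))" "integrable lborel (\<lambda>x. bump' (k * x))"
    using lborel_integrable_real_affine[OF integrable_bump(1), of k 0] lborel_integrable_real_affine[OF integrable_bump(2), of k 0] k by simp_all
  have bd: "((\<lambda>x. m * bump (k * x)) has_real_derivative m * (k * bump' (k * x))) (at x)" for m x
    by (auto intro!: derivative_eq_intros DERIV_chain2[OF bump_deriv])
  have bac: "absolutely_continuous_fun_on {0<..} (\<lambda>x. m * bump (k * x))" for m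
  proof (rule absolutely_continuous_fun_onI_C1[where h = "\<lambda>x. m * (k * bump' (k * x))"])
    show "continuous_on {0<..} (\<lambda>x. m * (k * bump' (k * x)))"
      by (intro continuous_intros continuous_on_compose2[OF continuous_on_bump(2)[of UNIV]]) auto
  qed (use bd bi in auto)
  have si: "set_integrable lborel {0<..} (\<lambda>x. m * bump (k * x))" "set_integrable lborel {0<..} (\<lambda>x. m * (k * bump' (k * x)))" for m
    using bi by (auto intro!: set_integrable_lborel)
  have ci: "integrable lborel c" "integrable lborel c'"
    unfolding c_def c'_def by (intro paste_integrable set_integrable_uminus si)+
  have ri: "integrable lborel r" "integrable lborel r'"
    unfolding r_def[abs_def] r'_def[abs_def] using fi gi by auto
  have u: "integrable ref u" and u': "integrable ref u'"
    unfolding integrable_S_iff u_def u'_def using ci ri by auto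
  have half: "(1 / 2) * (y + (- 1) * z) = (y + (- 1) * z) / 2" for y z :: real by simp
  have "(L1_class u, L1_class (\<lambda>(x, i). - real_of_sign i * u' (x, i))) \<in> A p p' q q'"
    unfolding A_def
  proof (rule CollectI, rule exI[of _ u], rule exI[of _ u'], intro conjI allI refl u u')
    fix i
    have "absolutely_continuous_fun_on {0<..} r"
      unfolding r_def[abs_def] half[symmetric]
      by (intro absolutely_continuous_fun_on_cmult absolutely_continuous_fun_on_add halfline_function.ac[OF hr])
    then show "absolutely_continuous_fun_on {0<..} (\<lambda>x. u (x, i))"
      unfolding u_def prod.case c_def
      by (intro absolutely_continuous_fun_on_cmult absolutely_continuous_fun_on_add paste_absolutely_continuous bac)
    have "absolutely_continuous_fun_on {..<0} r"
      unfolding r_def[abs_def] half[symmetric]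
      by (intro absolutely_continuous_fun_on_cmult absolutely_continuous_fun_on_add ac)
    then show "absolutely_continuous_fun_on {..<0} (\<lambda>x. u (x, i))"
      unfolding u_def prod.case c_def
      by (intro absolutely_continuous_fun_on_cmult absolutely_continuous_fun_on_add paste_absolutely_continuous bac)
    have "AE x in lborel. (c has_real_derivative c' x) (at x)"
      unfolding c_def c'_def by (intro paste_derivative bd)
    with halfline_function.deriv[OF hr[of 1]] halfline_function.deriv[OF hr[of "- 1"]]
    show "AE x in lborel. ((\<lambda>y. u (y, i)) has_real_derivative u' (x, i)) (at x)"
    proof eventually_elim
      case (elim x)
      show ?case
        unfolding u_def u'_def prod.case r_def r'_def
        by (rule derivative_eq_intros elim refl | simp)+
    qed
  next
    have "isCont (\<lambda>x. m * bump (k * x)) 0" for m by (rule DERIV_isCont[OF bd])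
    then have cl: "((\<lambda>x. m * bump (k * x)) \<longlongrightarrow> m) (at_right 0)" for m
      using bump_0 by (auto simp: isCont_def filterlim_at_split)
    have "(r \<longlongrightarrow> a) (at_right 0)"
      unfolding r_def[abs_def] a_def
      by (intro tendsto_intros halfline_function.limit_at_right_0[OF hr]) auto
    moreover have "(c \<longlongrightarrow> a) (at_right 0)"
      using cl[of a] by (rule tendsto_at_right_0_cong) (simp add: c_def paste_def)
    ultimately have "((\<lambda>x. u (x, i)) \<longlongrightarrow> real_of_sign i * (a + (- 1) * a)) (at_right 0)" for i
      unfolding u_def prod.case by (intro tendsto_intros)
    then have R: "Lim (at_right 0) (\<lambda>x. u (x, i)) = 0" for i by (simp add: tendsto_Lim)
    have "((\<lambda>x. r (- x)) \<longlongrightarrow> b) (at_right 0)"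
      unfolding r_def[abs_def] b_def
      by (intro tendsto_intros halfline_function.limit_at_right_0[OF hl]) auto
    moreover have "((\<lambda>x. c (- x)) \<longlongrightarrow> b) (at_right 0)"
      using cl[of b] by (rule tendsto_at_right_0_cong) (simp add: c_def paste_def)
    ultimately have "((\<lambda>x. u (- x, i)) \<longlongrightarrow> real_of_sign i * (b + (- 1) * b)) (at_right 0)" for i
      unfolding u_def prod.case by (intro tendsto_intros)
    then have L: "Lim (at_left 0) (\<lambda>x. u (x, i)) = 0" for i by (simp add: Lim_at_left_0 tendsto_Lim)
    show "Lim (at_right 0) (\<lambda>x. u (x, 1)) = p * Lim (at_left 0) (\<lambda>x. u (x, 1)) + q' * Lim (at_right 0) (\<lambda>x. u (x, - 1))"
      "Lim (at_left 0) (\<lambda>x. u (x, - 1)) = p' * Lim (at_left 0) (\<lambda>x. u (x, 1)) + q * Lim (at_right 0) (\<lambda>x. u (x, - 1))"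
      unfolding R L by simp_all
  qed
  moreover have "B (L1_class u) = - L1_class u"
    using u by (simp add: B_class L1_class_uminus) (rule arg_cong[of _ _ L1_class], auto simp: u_def fun_eq_iff)
  moreover have "norm (L1_class u - (1 / 2) *\<^sub>R (\<phi> - B \<phi>)) < e"
  proof -
    define y where "y = (\<lambda>(x, i). - real_of_sign i * c x)"
    have y: "integrable ref y" unfolding integrable_S_iff y_def using ci by auto
    have "L1_class u - (1 / 2) *\<^sub>R (\<phi> - B \<phi>) = L1_class (\<lambda>z. u z - 1 / 2 * (f z - (case z of (x, i) \<Rightarrow> f (x, - i))))"
      using u fg(2) integrable_flip[OF fg(2)]
      by (simp add: fg(1) B_class L1_class_minus L1_class_scale)
    also have "(\<lambda>z. u z - 1 / 2 * (f z - (case z of (x, i) \<Rightarrow> f (x, - i)))) = y"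
    proof (rule ext)
      fix z :: S obtain x i where z: "z = (x, i)" by (cases z)
      show "u z - 1 / 2 * (f z - (case z of (x, i) \<Rightarrow> f (x, - i))) = y z"
        using sign_cases[of i] by (auto simp: z u_def y_def r_def sign_minus_minus field_simps)
    qed
    finally have eq: "L1_class u - (1 / 2) *\<^sub>R (\<phi> - B \<phi>) = L1_class y" .
    have "norm (L1_class u - (1 / 2) *\<^sub>R (\<phi> - B \<phi>)) = 2 * (\<integral>x. \<bar>c x\<bar> \<partial>lborel)"
      unfolding eq norm_S_class[OF y] by (simp add: y_def)
    also have "(\<integral>x. \<bar>c x\<bar> \<partial>lborel) = (LBINT x:{0<..}. \<bar>a * bump (k * x)\<bar>) + (LBINT x:{0<..}. \<bar>b * bump (k * x)\<bar>)"
      unfolding c_def by (rule paste_integral_abs[OF si(1) si(1)])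
    also have "\<dots> \<le> \<bar>a\<bar> * (K / k) + \<bar>b\<bar> * (K / k)"
    proof -
      have "(LBINT x:{0<..}. \<bar>m * bump (k * x)\<bar>) \<le> \<bar>m\<bar> * (K / k)" for m
      proof -
        have "(LBINT x:{0<..}. \<bar>m * bump (k * x)\<bar>) \<le> (LBINT x:UNIV. \<bar>m * bump (k * x)\<bar>)"
          using bi(1) by (intro set_integral_mono_subset set_integrable_lborel) auto
        also have "\<dots> = \<bar>m\<bar> * (\<integral>x. bump (k * x) \<partial>lborel)"
          by (simp add: set_lebesgue_integral_def abs_mult bump_bounds(1))
        also have "(\<integral>x. bump (k * x) \<partial>lborel) = K / k"
          using lborel_integral_real_affine[of k bump 0] k by (simp add: K_def)
        finally show ?thesis .
      qed
      then show ?thesis by (intro add_mono)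
    qed
    finally show ?thesis using k(2) by (simp add: algebra_simps add_divide_distrib)
  qed
  ultimately show thesis using that by blast
qed

text \<open>The last assumption is \<gamma> \<noteq> 0 in the form of the determinant that has to be
  inverted.\<close>

locale snapping =
  fixes p p' q q' :: real
  assumes nonneg: "p \<ge> 0" "p' \<ge> 0" "q \<ge> 0" "q' \<ge> 0" and le_1: "p + p' \<le> 1" "q + q' \<le> 1"
    and nonsingular: "(1 - q') * (1 - p') - p * q \<noteq> 0"
begin

text \<open>
  Boundary values of the even part of the first-order corrector: they solve the linear system
  that the interface conditions impose at order \<open>\<epsilon>\<close>, whose determinant is \<open>\<gamma>\<close>.
\<close>

definition \<gamma> where "\<gamma> = (1 - q') * (1 - p') - p * q"

definition even_right :: "real \<Rightarrow> real \<Rightarrow> real" where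
  "even_right d d' = ((1 - p') * (d / 2 + q' * d / 2 + p * d' / 2) + p * (d' / 2 + p' * d' / 2 + q * d / 2)) / \<gamma>"

definition even_left :: "real \<Rightarrow> real \<Rightarrow> real" where
  "even_left d d' = (q * (d / 2 + q' * d / 2 + p * d' / 2) + (1 - q') * (d' / 2 + p' * d' / 2 + q * d / 2)) / \<gamma>"

lemma even_part_solve:
  "even_right d d' - d / 2 = p * (even_left d d' + d' / 2) + q' * (even_right d d' + d / 2)"
  "even_left d d' - d' / 2 = p' * (even_left d d' + d' / 2) + q * (even_right d d' + d / 2)"
proof -
  have nz: "\<gamma> \<noteq> 0" using nonsingular by (simp add: \<gamma>_def)
  \<comment> \<open>The values come from Cramer's rule; multiplying by \<open>\<gamma>\<close>
    removes the denominators and leaves polynomial identities.\<close>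
  have "\<gamma> * ((1 - q') * even_right d d' - p * even_left d d') = \<gamma> * (d / 2 + q' * d / 2 + p * d' / 2)"
    "\<gamma> * ((1 - p') * even_left d d' - q * even_right d d') = \<gamma> * (d' / 2 + p' * d' / 2 + q * d / 2)"
    unfolding even_right_def even_left_def right_diff_distrib[of \<gamma>]
    by (simp_all add: nz) (simp_all add: \<gamma>_def field_simps)
  then have "(1 - q') * even_right d d' - p * even_left d d' = d / 2 + q' * d / 2 + p * d' / 2"
    "(1 - p') * even_left d d' - q * even_right d d' = d' / 2 + p' * d' / 2 + q * d / 2"
    using nz by simp_all
  then show "even_right d d' - d / 2 = p * (even_left d d' + d' / 2) + q' * (even_right d d' + d / 2)"
    "even_left d d' - d' / 2 = p' * (even_left d d' + d' / 2) + q * (even_right d d' + d / 2)"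
    by (simp_all add: algebra_simps)
qed

lemma even_part_linear:
  "even_right (d + a * b) (d' + a * b') = even_right d d' + a * even_right b b'"
  "even_left (d + a * b) (d' + a * b') = even_left d d' + a * even_left b b'"
  by (simp_all add: even_right_def even_left_def algebra_simps add_divide_distrib diff_divide_distrib)

text \<open>In Cramer's formulas the matrix entries have modulus at most 1 and each right-hand side
  is at most the sum of the moduli of the slopes, so every numerator is at most twice that
  sum.\<close>

lemma even_part_bound: "\<bar>even_right d d'\<bar> + \<bar>even_left d d'\<bar> \<le> 4 * (\<bar>d\<bar> + \<bar>d'\<bar>) / \<bar>\<gamma>\<bar>"
proof -
  have b: "\<bar>d / 2 + s * d / 2 + t * d' / 2\<bar> \<le> \<bar>d\<bar> + \<bar>d'\<bar>" if "0 \<le> s" "s \<le> 1" "0 \<le> t" "t \<le> 1" for s t d d' :: real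
  proof -
    have "\<bar>s * d\<bar> \<le> \<bar>d\<bar>" "\<bar>t * d'\<bar> \<le> \<bar>d'\<bar>"
      using that mult_right_mono[of s 1 "\<bar>d\<bar>"] mult_right_mono[of t 1 "\<bar>d'\<bar>"] by (auto simp: abs_mult)
    then show ?thesis by linarith
  qed
  have c: "\<bar>s * y + t * z\<bar> \<le> 2 * m" if "\<bar>s\<bar> \<le> 1" "\<bar>t\<bar> \<le> 1" "\<bar>y\<bar> \<le> m" "\<bar>z\<bar> \<le> m" for s t y z m :: real
  proof -
    have "\<bar>s * y\<bar> \<le> 1 * m" "\<bar>t * z\<bar> \<le> 1 * m" unfolding abs_mult using that by (intro mult_mono; simp)+
    then show ?thesis by linarith
  qed
  have y: "\<bar>d / 2 + q' * d / 2 + p * d' / 2\<bar> \<le> \<bar>d\<bar> + \<bar>d'\<bar>" "\<bar>d' / 2 + p' * d' / 2 + q * d / 2\<bar> \<le> \<bar>d\<bar> + \<bar>d'\<bar>"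
    using b[of q' p d d'] b[of p' q d' d] nonneg le_1 by auto
  have "\<bar>even_right d d'\<bar> \<le> 2 * (\<bar>d\<bar> + \<bar>d'\<bar>) / \<bar>\<gamma>\<bar>" "\<bar>even_left d d'\<bar> \<le> 2 * (\<bar>d\<bar> + \<bar>d'\<bar>) / \<bar>\<gamma>\<bar>"
    unfolding even_right_def even_left_def abs_divide using y nonneg le_1
    by (intro divide_right_mono c; simp)+
  then show ?thesis by (simp add: add_divide_distrib)
qed

text \<open>The 24 is 3 from the residual in \<open>corrector_in_G\<close>, times 4 from
  \<open>even_part_bound\<close>, times 2 from the bound on the slopes; the added 2 covers the
  remaining term of \<open>corrector_error\<close>.\<close>

definition corrector_bound :: real where "corrector_bound = 24 * (\<integral>x. bump x \<partial>lborel) / \<bar>\<gamma>\<bar> + 2"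

lemma corrector_bound_nonneg: "corrector_bound \<ge> 0"
  using bump_bounds(1) by (auto simp: corrector_bound_def intro!: add_nonneg_nonneg divide_nonneg_nonneg Bochner_Integration.integral_nonneg)

text \<open>A relation between classes rather than a function, because the formula needs
  representatives and slopes. Uniqueness is a consequence of \<open>is_corrector_diff\<close>
  applied to equal arguments.\<close>

definition is_corrector :: "real \<Rightarrow> real L1 \<Rightarrow> real L1 \<Rightarrow> S L1 \<Rightarrow> bool" where
  "is_corrector \<epsilon> \<phi> \<theta> u \<longleftrightarrow> (\<exists>f \<psi> d d'. killed_line f \<psi> d d' \<and> \<phi> = L1_class f \<and> \<theta> = L1_class \<psi> \<and>
     u = L1_class (corrector \<epsilon> (even_right d d') (even_left d d') f \<psi> d d'))"

lemma is_corrector_exists: "(\<phi>, \<theta>) \<in> \<Delta>\<^sub>0 \<Longrightarrow> \<exists>u. is_corrector \<epsilon> \<phi> \<theta> u"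
  by (erule \<Delta>\<^sub>0_E) (auto simp: is_corrector_def)

lemma even_part_norm_bound:
  assumes k: "killed_line f \<psi> d d'"
  shows "3 * (\<bar>even_right d d'\<bar> + \<bar>even_left d d'\<bar>) * (\<integral>x. bump x \<partial>lborel) \<le> (corrector_bound - 2) * (norm (L1_class f) + norm (L1_class \<psi>))"
proof -
  let ?K = "\<integral>x. bump x \<partial>lborel" and ?N = "norm (L1_class f) + norm (L1_class \<psi>)"
  have K: "?K \<ge> 0" using bump_bounds(1) by (intro Bochner_Integration.integral_nonneg) auto
  have "\<bar>even_right d d'\<bar> + \<bar>even_left d d'\<bar> \<le> 4 * (\<bar>d\<bar> + \<bar>d'\<bar>) / \<bar>\<gamma>\<bar>" by (rule even_part_bound)
  also have "\<dots> \<le> 4 * (2 * ?N) / \<bar>\<gamma>\<bar>"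
    using killed_line_norms(5)[OF k] by (intro divide_right_mono) auto
  finally have "3 * (\<bar>even_right d d'\<bar> + \<bar>even_left d d'\<bar>) * ?K \<le> 3 * (4 * (2 * ?N) / \<bar>\<gamma>\<bar>) * ?K"
    using K by (intro mult_right_mono mult_left_mono) auto
  then show ?thesis by (simp add: corrector_bound_def algebra_simps)
qed

lemma is_corrector_error:
  assumes "is_corrector \<epsilon> \<phi> \<theta> u" "0 < \<epsilon>" "\<epsilon> \<le> 1"
  shows "norm (u - J \<phi>) \<le> \<epsilon> * (corrector_bound * (norm \<phi> + norm \<theta>))"
proof -
  obtain f \<psi> d d' where k: "killed_line f \<psi> d d'" and c: "\<phi> = L1_class f" "\<theta> = L1_class \<psi>"
     "u = L1_class (corrector \<epsilon> (even_right d d') (even_left d d') f \<psi> d d')" using assms(1) by (auto simp: is_corrector_def)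
  let ?K = "\<integral>x. bump x \<partial>lborel"
  have K: "?K \<ge> 0" using bump_bounds(1) by (intro Bochner_Integration.integral_nonneg) auto
  have "2 * (\<bar>even_right d d'\<bar> + \<bar>even_left d d'\<bar>) * ?K \<le> 3 * (\<bar>even_right d d'\<bar> + \<bar>even_left d d'\<bar>) * ?K"
    using K by (intro mult_right_mono) auto
  then have "2 * (\<bar>even_right d d'\<bar> + \<bar>even_left d d'\<bar>) * ?K + 2 * (norm \<phi> + norm \<theta>) \<le> corrector_bound * (norm \<phi> + norm \<theta>)"
    using even_part_norm_bound[OF k] by (simp add: c algebra_simps)
  then have "\<epsilon> * (2 * (\<bar>even_right d d'\<bar> + \<bar>even_left d d'\<bar>) * ?K + 2 * (norm \<phi> + norm \<theta>)) \<le> \<epsilon> * (corrector_bound * (norm \<phi> + norm \<theta>))"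
    using assms by (intro mult_left_mono) auto
  with corrector_error[OF k assms(2,3), of "even_right d d'" "even_left d d'"] show ?thesis by (simp add: c)
qed

text \<open>Everything in the construction, including the solution of the interface system, is
  linear in the data; the form with a factor \<open>a\<close> yields sums, differences and multiples
  at once.\<close>

lemma is_corrector_linear:
  assumes "is_corrector \<epsilon> \<phi> \<theta> u" "is_corrector \<epsilon> \<phi>' \<theta>' u'"
  shows "is_corrector \<epsilon> (\<phi> + a *\<^sub>R \<phi>') (\<theta> + a *\<^sub>R \<theta>') (u + a *\<^sub>R u')"
proof -
  obtain f \<psi> d d' where k: "killed_line f \<psi> d d'" and c: "\<phi> = L1_class f" "\<theta> = L1_class \<psi>"
     "u = L1_class (corrector \<epsilon> (even_right d d') (even_left d d') f \<psi> d d')" using assms(1) by (auto simp: is_corrector_def)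
  obtain g \<eta> b b' where k': "killed_line g \<eta> b b'" and c': "\<phi>' = L1_class g" "\<theta>' = L1_class \<eta>"
     "u' = L1_class (corrector \<epsilon> (even_right b b') (even_left b b') g \<eta> b b')" using assms(2) by (auto simp: is_corrector_def)
  note n = killed_line_norms(1,2)[OF k] killed_line_norms(1,2)[OF k']
    corrector_integrable[OF k] corrector_integrable[OF k']
  show ?thesis
    unfolding is_corrector_def
  proof (intro exI conjI)
    show "killed_line (\<lambda>x. f x + a * g x) (\<lambda>x. \<psi> x + a * \<eta> x) (d + a * b) (d' + a * b')"
      by (rule killed_line_linear(1)[OF k k'])
    show "\<phi> + a *\<^sub>R \<phi>' = L1_class (\<lambda>x. f x + a * g x)" "\<theta> + a *\<^sub>R \<theta>' = L1_class (\<lambda>x. \<psi> x + a * \<eta> x)"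
      using n by (simp_all add: c c' L1_class_scale L1_class_plus ref_real_def)
    show "u + a *\<^sub>R u' = L1_class (corrector \<epsilon> (even_right (d + a * b) (d' + a * b')) (even_left (d + a * b) (d' + a * b'))
        (\<lambda>x. f x + a * g x) (\<lambda>x. \<psi> x + a * \<eta> x) (d + a * b) (d' + a * b'))"
      using n by (simp add: c c' L1_class_scale L1_class_plus even_part_linear killed_line_linear(2)[OF k k', abs_def])
  qed
qed

text \<open>The error estimate applied to the difference. The Lipschitz constant does not depend on
  \<epsilon>, and it transfers continuity and differentiability in time from an orbit to its
  correctors.\<close>

lemma is_corrector_diff:
  assumes "is_corrector \<epsilon> \<phi> \<theta> u" "is_corrector \<epsilon> \<phi>' \<theta>' u'" "0 < \<epsilon>" "\<epsilon> \<le> 1"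
  shows "norm (u - u') \<le> (1 + corrector_bound) * (norm (\<phi> - \<phi>') + norm (\<theta> - \<theta>'))"
proof -
  have c: "is_corrector \<epsilon> (\<phi> - \<phi>') (\<theta> - \<theta>') (u - u')" using is_corrector_linear[OF assms(1,2), of "- 1"] by simp
  have "norm (u - u') \<le> norm (J (\<phi> - \<phi>')) + norm (u - u' - J (\<phi> - \<phi>'))"
    by (rule norm_triangle_sub)
  also have "norm (u - u' - J (\<phi> - \<phi>')) \<le> 1 * (corrector_bound * (norm (\<phi> - \<phi>') + norm (\<theta> - \<theta>')))"
    using is_corrector_error[OF c assms(3,4)] assms(4) corrector_bound_nonneg
    by (elim order_trans) (intro mult_right_mono mult_nonneg_nonneg add_nonneg_nonneg; simp)
  finally show ?thesis
    by (simp add: distrib_right) (smt (verit) norm_ge_zero)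
qed

lemma is_corrector_in_G:
  assumes u: "is_corrector \<epsilon> \<phi> \<theta> u" and \<theta>: "(\<theta>, \<eta>) \<in> \<Delta>\<^sub>0" and \<epsilon>: "0 < \<epsilon>" "\<epsilon> \<le> 1"
  obtains v where "(u, v) \<in> G p p' q q' \<epsilon>" "norm (v - (1 / 2) *\<^sub>R J \<theta>) \<le> \<epsilon> * (corrector_bound * (norm \<phi> + norm \<theta>))"
proof -
  obtain f \<psi> d d' where k: "killed_line f \<psi> d d'" and c: "\<phi> = L1_class f" "\<theta> = L1_class \<psi>"
     "u = L1_class (corrector \<epsilon> (even_right d d') (even_left d d') f \<psi> d d')" using u by (auto simp: is_corrector_def)
  obtain \<psi>' \<xi> b b' where c': "\<theta> = L1_class \<psi>'" and k': "killed_line \<psi>' \<xi> b b'"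
    using \<theta> by (rule \<Delta>\<^sub>0_E) (blast intro: that)
  \<comment> \<open>Two representatives of \<open>\<theta>\<close> meet here; the one coming from
    the domain of \<open>\<Delta>\<^sub>0\<close> is continuous off the origin and replaces the
    other throughout the corrector.\<close>
  have AE: "AE x in lborel. \<psi> x = \<psi>' x"
    using killed_line_norms(2)[OF k] killed_line_norms(1)[OF k'] L1_class_eq_iff[of \<psi> \<psi>', unfolded ref_real_def] c(2) c'
    by simp
  note i = killed_line_norms(1)[OF k']
  have r: "killed_halfline f \<psi>' d" "slope d \<psi> = slope d \<psi>'"
    using killed_halfline.cong_AE[OF _ AE i] k unfolding killed_line_def by blast+
  have l: "killed_halfline (\<lambda>x. f (- x)) (\<lambda>x. \<psi>' (- x)) d'" "slope d' (\<lambda>x. \<psi> (- x)) = slope d' (\<lambda>x. \<psi>' (- x))"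
    using killed_halfline.cong_AE[OF _ AE_lborel_uminus[OF AE] integrable_lborel_uminus[OF i]] k unfolding killed_line_def by blast+
  have k2: "killed_line f \<psi>' d d'" using r l k by (simp add: killed_line_def)
  have "corrector \<epsilon> (even_right d d') (even_left d d') f \<psi> d d' = corrector \<epsilon> (even_right d d') (even_left d d') f \<psi>' d d'"
    by (simp add: corrector_def corrected_def[abs_def] r(2) l(2))
  then have u': "u = L1_class (corrector \<epsilon> (even_right d d') (even_left d d') f \<psi>' d d')" using c by simp
  obtain v where v: "(u, v) \<in> G p p' q q' \<epsilon>"
    "norm (v - (1 / 2) *\<^sub>R J (L1_class \<psi>')) \<le> \<epsilon> * (3 * (\<bar>even_right d d'\<bar> + \<bar>even_left d d'\<bar>) * (\<integral>x. bump x \<partial>lborel))"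
    using corrector_in_G[OF k2 k' \<epsilon>(1) even_part_solve] unfolding u' by blast
  have "(corrector_bound - 2) * (norm \<phi> + norm \<theta>) \<le> corrector_bound * (norm \<phi> + norm \<theta>)" by (intro mult_right_mono) auto
  with even_part_norm_bound[OF k] have "3 * (\<bar>even_right d d'\<bar> + \<bar>even_left d d'\<bar>) * (\<integral>x. bump x \<partial>lborel) \<le> corrector_bound * (norm \<phi> + norm \<theta>)"
    by (simp add: c)
  then have "\<epsilon> * (3 * (\<bar>even_right d d'\<bar> + \<bar>even_left d d'\<bar>) * (\<integral>x. bump x \<partial>lborel)) \<le> \<epsilon> * (corrector_bound * (norm \<phi> + norm \<theta>))"
    using \<epsilon> by (intro mult_left_mono) auto
  with v show thesis using that unfolding c'[symmetric] by force
qed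

end

section \<open>Convergence\<close>

lemma continuous_on_norm_diff_le:
  fixes w :: "real \<Rightarrow> 'a::real_normed_vector"
  assumes "\<And>s r. s \<in> X \<Longrightarrow> r \<in> X \<Longrightarrow> norm (w s - w r) \<le> c * (norm (a s - a r) + norm (b s - b r))"
    and "continuous_on X a" "continuous_on X b"
  shows "continuous_on X w"
  unfolding continuous_on_def
proof
  fix r assume r: "r \<in> X"
  have "((\<lambda>s. c * (norm (a s - a r) + norm (b s - b r))) \<longlongrightarrow> c * (norm (a r - a r) + norm (b r - b r))) (at r within X)"
    using assms(2,3) r by (intro tendsto_intros) (auto simp: continuous_on_def)
  then have lim: "((\<lambda>s. c * (norm (a s - a r) + norm (b s - b r))) \<longlongrightarrow> 0) (at r within X)" by simp
  have "((\<lambda>s. w s - w r) \<longlongrightarrow> 0) (at r within X)"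
    by (rule Lim_null_comparison[OF _ lim]) (use assms(1) r in \<open>auto simp: eventually_at_filter\<close>)
  then show "(w \<longlongrightarrow> w r) (at r within X)" by (rule LIM_zero_cancel)
qed

lemma compact_bounded_above:
  assumes "compact (K :: real set)" obtains \<tau> where "\<And>t. t \<in> K \<Longrightarrow> t \<le> \<tau>"
  using bounded_has_Sup(1)[OF compact_imp_bounded[OF assms]] by (metis empty_iff)

locale approximation = snapping +
  fixes T :: "real \<Rightarrow> real \<Rightarrow> S L1 \<Rightarrow> S L1" and U :: "real \<Rightarrow> S L1 \<Rightarrow> S L1"
  assumes T: "\<And>\<epsilon>. \<epsilon> > 0 \<Longrightarrow> generates_on UNIV (G p p' q q' \<epsilon>) (T \<epsilon>)"
    and U: "generates_on L0 (scale_op (1 / 2) \<Delta>\<^sub>0_tilde) U"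
begin

lemma T_semigroup: "\<epsilon> > 0 \<Longrightarrow> banach_c0_semigroup (T \<epsilon>)"
  using T by (simp add: generates_on_def banach_c0_semigroup_def c0_semigroup_def)

lemma T_generator: "\<epsilon> > 0 \<Longrightarrow> generator_on UNIV (T \<epsilon>) = G p p' q q' \<epsilon>"
  using T by (simp add: generates_on_def)

lemma T_contraction:
  assumes "\<epsilon> > 0" "t \<ge> 0" shows "norm (T \<epsilon> t \<phi>) \<le> norm \<phi>"
  by (rule banach_c0_semigroup.dissipative_imp_contractive[OF T_semigroup[OF assms(1)] _ assms(2)])
     (auto simp: T_generator assms intro: G_dissipative[OF nonneg le_1 _ _ assms(1)])

lemma T_diff: "\<epsilon> > 0 \<Longrightarrow> t \<ge> 0 \<Longrightarrow> T \<epsilon> t (\<phi> - \<psi>) = T \<epsilon> t \<phi> - T \<epsilon> t \<psi>"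
  by (rule c0_semigroup.diff[OF T_semigroup[unfolded banach_c0_semigroup_def]])

lemma U_semigroup: "c0_semigroup_on (range J) U"
  using U by (simp add: generates_on_def L0_eq_range_J)

text \<open>The limit semigroup transported to \<open>L\<^sup>1\<close> of the line, where it acts on the whole space.\<close>

definition V :: "real \<Rightarrow> real L1 \<Rightarrow> real L1" where "V t \<phi> = the_inv J (U t (J \<phi>))"

lemma J_V: "t \<ge> 0 \<Longrightarrow> J (V t \<phi>) = U t (J \<phi>)"
proof -
  assume "t \<ge> 0"
  then have "U t (J \<phi>) \<in> range J"
    by (intro c0_semigroup_onD(1)[OF U_semigroup]) auto
  then show ?thesis unfolding V_def by (intro f_the_inv_into_f) (auto simp: inj_def inj_J)
qed

lemma V_semigroup: "banach_c0_semigroup V"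
proof -
  interpret J: bounded_linear J by (rule bounded_linear_J)
  note u = c0_semigroup_onD[OF U_semigroup]
  have U_lin: "U t (J \<phi> + J \<psi>) = U t (J \<phi>) + U t (J \<psi>)" "U t (c *\<^sub>R J \<phi>) = c *\<^sub>R U t (J \<phi>)"
    if "t \<ge> 0" for t c \<phi> \<psi>
    using u(2,3)[OF that] by simp_all
  have U0: "U 0 (J \<phi>) = J \<phi>" and Uadd: "s \<ge> 0 \<Longrightarrow> t \<ge> 0 \<Longrightarrow> U (s + t) (J \<phi>) = U s (U t (J \<phi>))"
    and Ulim: "((\<lambda>t. U t (J \<phi>)) \<longlongrightarrow> J \<phi>) (at_right 0)" for s t \<phi>
    using u(5,6,7) by simp_all
  have "c0_semigroup_on UNIV V"
    unfolding c0_semigroup_on_def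
  proof (intro conjI allI impI ballI subspace_UNIV UNIV_I)
    fix t c \<phi> \<psi> assume t: "(t::real) \<ge> 0"
    have "J (V t (\<phi> + \<psi>)) = J (V t \<phi> + V t \<psi>)" by (simp add: J_V t J.add U_lin)
    then show "V t (\<phi> + \<psi>) = V t \<phi> + V t \<psi>" by (simp only: inj_J)
    have "J (V t (c *\<^sub>R \<phi>)) = J (c *\<^sub>R V t \<phi>)" by (simp add: J_V t J.scaleR U_lin)
    then show "V t (c *\<^sub>R \<phi>) = c *\<^sub>R V t \<phi>" by (simp only: inj_J)
  next
    fix t :: real assume t: "t \<ge> 0"
    then obtain K where "\<forall>\<phi>\<in>range J. norm (U t \<phi>) \<le> K * norm \<phi>" using u(4) by blast
    then have b: "norm (U t (J \<phi>)) \<le> K * norm (J \<phi>)" for \<phi> by blast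
    have "norm (V t \<phi>) \<le> K * norm \<phi>" for \<phi>
      using b[of \<phi>] J_V[OF t, of \<phi>] norm_J[of "V t \<phi>"] by simp
    then show "\<exists>K. \<forall>\<phi>\<in>UNIV. norm (V t \<phi>) \<le> K * norm \<phi>" by blast
  next
    fix \<phi>
    have "J (V 0 \<phi>) = J \<phi>" by (simp add: J_V U0)
    then show "V 0 \<phi> = \<phi>" by (simp only: inj_J)
  next
    fix s t \<phi> assume st: "(s::real) \<ge> 0" "(t::real) \<ge> 0"
    have "J (V (s + t) \<phi>) = U s (J (V t \<phi>))" using st by (simp add: J_V Uadd)
    also have "\<dots> = J (V s (V t \<phi>))" using st by (simp add: J_V)
    finally show "V (s + t) \<phi> = V s (V t \<phi>)" by (simp only: inj_J)
  next
    fix \<phi>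
    have "((\<lambda>t. norm (U t (J \<phi>) - J \<phi>)) \<longlongrightarrow> 0) (at_right 0)"
      using Ulim[of \<phi>] by (intro tendsto_norm_zero LIM_zero)
    then have "((\<lambda>t. norm (V t \<phi> - \<phi>)) \<longlongrightarrow> 0) (at_right 0)"
      by (rule tendsto_at_right_0_cong) (simp flip: J_V J.diff)
    then show "((\<lambda>t. V t \<phi>) \<longlongrightarrow> \<phi>) (at_right 0)"
      by (rule LIM_zero_cancel[OF tendsto_norm_zero_cancel])
  qed
  then show ?thesis by (simp add: banach_c0_semigroup_def c0_semigroup_def)
qed

sublocale V: banach_c0_semigroup V by (rule V_semigroup)

text \<open>The factor 2 undoes the one half in front of \<open>\<Delta>\<^sub>0\<close>.\<close>

lemma V_generator: "(\<phi>, \<psi>) \<in> generator_on UNIV V \<Longrightarrow> (\<phi>, 2 *\<^sub>R \<psi>) \<in> \<Delta>\<^sub>0"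
proof -
  interpret J: bounded_linear J by (rule bounded_linear_J)
  assume "(\<phi>, \<psi>) \<in> generator_on UNIV V"
  then have "((\<lambda>h. J ((1 / h) *\<^sub>R (V h \<phi> - \<phi>))) \<longlongrightarrow> J \<psi>) (at_right 0)"
    by (intro J.tendsto V.generatorD)
  then have "((\<lambda>h. (1 / h) *\<^sub>R (U h (J \<phi>) - J \<phi>)) \<longlongrightarrow> J \<psi>) (at_right 0)"
    by (rule tendsto_at_right_0_cong) (simp add: J.scaleR J.diff J_V)
  then have "(J \<phi>, J \<psi>) \<in> generator_on L0 U" by (simp add: generator_on_def L0_eq_range_J)
  also have "generator_on L0 U = scale_op (1 / 2) \<Delta>\<^sub>0_tilde" using U by (simp add: generates_on_def)
  finally obtain \<phi>' \<theta> where "J \<phi> = J \<phi>'" "J \<psi> = (1 / 2) *\<^sub>R J \<theta>" "(\<phi>', \<theta>) \<in> \<Delta>\<^sub>0"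
    by (auto simp: scale_op_def \<Delta>\<^sub>0_tilde_def)
  then have "J \<phi> = J \<phi>'" "J (2 *\<^sub>R \<psi>) = J \<theta>" "(\<phi>', \<theta>) \<in> \<Delta>\<^sub>0" by (simp_all add: J.scaleR)
  then show ?thesis by (simp only: inj_J)
qed

text \<open>The corrector of \<open>V s \<phi>\<close> is the approximate orbit. By linearity its
  time derivative is the corrector of \<open>V s \<psi>\<close>, while \<open>G\<close> maps it
  close to \<open>J (V s \<psi>)\<close>; both lie within O(\<epsilon>) of that element, uniformly
  on bounded time intervals.\<close>

lemma smooth_approximation:
  assumes gen: "(\<phi>, \<psi>) \<in> generator_on UNIV V" "(\<psi>, \<omega>) \<in> generator_on UNIV V"
  obtains K where "\<And>\<epsilon> t. 0 < \<epsilon> \<Longrightarrow> \<epsilon> \<le> 1 \<Longrightarrow> t \<in> {0..\<tau>} \<Longrightarrow> norm (T \<epsilon> t (J \<phi>) - J (V t \<phi>)) \<le> \<epsilon> * K"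
proof -
  obtain K1 K2 K3 where K: "\<And>s. s \<in> {0..\<tau>} \<Longrightarrow> norm (V s \<phi>) \<le> K1"
    "\<And>s. s \<in> {0..\<tau>} \<Longrightarrow> norm (V s \<psi>) \<le> K2" "\<And>s. s \<in> {0..\<tau>} \<Longrightarrow> norm (V s \<omega>) \<le> K3"
    using V.orbit_bounded by metis
  define N1 N2 where "N1 = corrector_bound * (K1 + 2 * K2)" and "N2 = corrector_bound * (K2 + 2 * K3)"
  have "norm (T \<epsilon> t (J \<phi>) - J (V t \<phi>)) \<le> \<epsilon> * (2 * N1 + (N1 + N2) * t)"
    if \<epsilon>: "0 < \<epsilon>" "\<epsilon> \<le> 1" and t: "t \<in> {0..\<tau>}" for \<epsilon> t
  proof -
    interpret T: banach_c0_semigroup "T \<epsilon>" by (rule T_semigroup[OF \<epsilon>(1)])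
    have D1: "(V s \<phi>, 2 *\<^sub>R V s \<psi>) \<in> \<Delta>\<^sub>0" and D2: "(V s \<psi>, 2 *\<^sub>R V s \<omega>) \<in> \<Delta>\<^sub>0"
      and D3: "(2 *\<^sub>R V s \<psi>, 4 *\<^sub>R V s \<omega>) \<in> \<Delta>\<^sub>0" if "s \<ge> 0" for s
      using V.generator_orbit(1)[OF gen(1) that] V.generator_orbit(1)[OF gen(2) that]
        V_generator[of "2 *\<^sub>R V s \<psi>" "2 *\<^sub>R V s \<omega>"]
        subspace_scale[OF V.generator_subspace V.generator_orbit(1)[OF gen(2) that], of 2]
      by (auto intro: V_generator)
    define w where "w s = (SOME u. is_corrector \<epsilon> (V s \<phi>) (2 *\<^sub>R V s \<psi>) u)" for s
    define w' where "w' s = (SOME u. is_corrector \<epsilon> (V s \<psi>) (2 *\<^sub>R V s \<omega>) u)" for s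
    have w: "is_corrector \<epsilon> (V s \<phi>) (2 *\<^sub>R V s \<psi>) (w s)" and w': "is_corrector \<epsilon> (V s \<psi>) (2 *\<^sub>R V s \<omega>) (w' s)" if "s \<ge> 0" for s
      unfolding w_def w'_def using is_corrector_exists[OF D1[OF that]] is_corrector_exists[OF D2[OF that]] by (auto intro: someI_ex)
    have "\<exists>v. (w s, v) \<in> G p p' q q' \<epsilon> \<and> norm (v - (1 / 2) *\<^sub>R J (2 *\<^sub>R V s \<psi>)) \<le> \<epsilon> * (corrector_bound * (norm (V s \<phi>) + norm (2 *\<^sub>R V s \<psi>)))" if "s \<ge> 0" for s
      using is_corrector_in_G[OF w[OF that] D3[OF that] \<epsilon>] by metis
    then obtain v where v: "\<And>s. s \<ge> 0 \<Longrightarrow> (w s, v s) \<in> G p p' q q' \<epsilon>"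
      "\<And>s. s \<ge> 0 \<Longrightarrow> norm (v s - (1 / 2) *\<^sub>R J (2 *\<^sub>R V s \<psi>)) \<le> \<epsilon> * (corrector_bound * (norm (V s \<phi>) + norm (2 *\<^sub>R V s \<psi>)))"
      by metis
    have b1: "\<epsilon> * (corrector_bound * (norm (V s \<phi>) + norm (2 *\<^sub>R V s \<psi>))) \<le> \<epsilon> * N1"
      and b2: "\<epsilon> * (corrector_bound * (norm (V s \<psi>) + norm (2 *\<^sub>R V s \<omega>))) \<le> \<epsilon> * N2" if "s \<in> {0..\<tau>}" for s
      unfolding N1_def N2_def using K(1)[OF that] K(2)[OF that] K(3)[OF that] \<epsilon> corrector_bound_nonneg
      by (intro mult_left_mono; simp)+
    have err: "norm (w s - J (V s \<phi>)) \<le> \<epsilon> * N1" if "s \<in> {0..\<tau>}" for s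
      using order_trans[OF is_corrector_error[OF w \<epsilon>] b1[OF that]] that by simp
    have "norm (w t - T \<epsilon> t (w 0)) \<le> \<epsilon> * (N1 + N2) * t - \<epsilon> * (N1 + N2) * 0"
    proof (rule T.approximate_orbit[where v = v and w' = w' and d = "\<lambda>_. \<epsilon> * (N1 + N2)"])
      show "norm (T \<epsilon> s \<eta>) \<le> norm \<eta>" if "s \<ge> 0" for s \<eta> by (rule T_contraction[OF \<epsilon>(1) that])
      show "continuous_on {0..} w"
        by (rule continuous_on_norm_diff_le[OF is_corrector_diff[OF w w \<epsilon>]])
           (auto intro!: continuous_intros V.continuous_on_orbit)
      show "(w s, v s) \<in> generator_on UNIV (T \<epsilon>)" if "s \<ge> 0" for s using v(1)[OF that] by (simp add: T_generator \<epsilon>)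
      show "continuous_on {0..} (\<lambda>t. \<epsilon> * (N1 + N2) * t)" by (intro continuous_intros)
      show "((\<lambda>t. \<epsilon> * (N1 + N2) * t) has_real_derivative \<epsilon> * (N1 + N2)) (at s)" for s
        by (auto intro!: derivative_eq_intros)
      show "((\<lambda>h. (1 / h) *\<^sub>R (w (s + h) - w s)) \<longlongrightarrow> w' s) (at_right 0)" if "s \<ge> 0" for s
      proof -
        let ?a = "\<lambda>h. (1 / h) *\<^sub>R (V (s + h) \<phi> - V s \<phi>)" and ?b = "\<lambda>h. 2 *\<^sub>R ((1 / h) *\<^sub>R (V (s + h) \<psi> - V s \<psi>))"
        have "((\<lambda>h. (1 + corrector_bound) * (norm (?a h - V s \<psi>) + norm (?b h - 2 *\<^sub>R V s \<omega>)))
            \<longlongrightarrow> (1 + corrector_bound) * (norm (V s \<psi> - V s \<psi>) + norm (2 *\<^sub>R V s \<omega> - 2 *\<^sub>R V s \<omega>))) (at_right 0)"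
          using that by (intro tendsto_intros V.generator_orbit(2) gen)
        then have lim: "((\<lambda>h. (1 + corrector_bound) * (norm (?a h - V s \<psi>) + norm (?b h - 2 *\<^sub>R V s \<omega>))) \<longlongrightarrow> 0) (at_right 0)" by simp
        have "norm ((1 / h) *\<^sub>R (w (s + h) - w s) - w' s) \<le> (1 + corrector_bound) * (norm (?a h - V s \<psi>) + norm (?b h - 2 *\<^sub>R V s \<omega>))"
          if "h > 0" for h
        proof -
          have c1: "is_corrector \<epsilon> (V (s + h) \<phi> - V s \<phi>) (2 *\<^sub>R V (s + h) \<psi> - 2 *\<^sub>R V s \<psi>) (w (s + h) - w s)"
            using is_corrector_linear[OF w[of "s + h"] w[of s], of "- 1"] that \<open>s \<ge> 0\<close> by simp
          \<comment> \<open>Scaling by \<open>1 / h\<close> is obtained as x + (1/h - 1) x from the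
            combined linearity lemma.\<close>
          have "is_corrector \<epsilon> (?a h) (?b h) ((1 / h) *\<^sub>R (w (s + h) - w s))"
            using is_corrector_linear[OF c1 c1, of "1 / h - 1"]
            by (simp add: algebra_simps)
          from is_corrector_diff[OF this w'[OF \<open>s \<ge> 0\<close>] \<epsilon>] show ?thesis .
        qed
        then have "((\<lambda>h. (1 / h) *\<^sub>R (w (s + h) - w s) - w' s) \<longlongrightarrow> 0) (at_right 0)"
          by (intro Lim_null_comparison[OF _ lim] eventually_mono[OF eventually_at_right_less])
        then show ?thesis by (rule LIM_zero_cancel)
      qed
      show "norm (w' s - v s) \<le> \<epsilon> * (N1 + N2)" if s: "0 \<le> s" "s < t" for s
      proof -
        have "s \<in> {0..\<tau>}" using s t by auto
        have "(1 / 2) *\<^sub>R J (2 *\<^sub>R V s \<psi>) = J (V s \<psi>)" by (simp add: linear_simps[OF bounded_linear_J])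
        then have "norm (v s - J (V s \<psi>)) \<le> \<epsilon> * N1" using v(2)[OF s(1)] b1[OF \<open>s \<in> {0..\<tau>}\<close>] by simp
        moreover have "norm (w' s - J (V s \<psi>)) \<le> \<epsilon> * N2"
          using is_corrector_error[OF w'[OF s(1)] \<epsilon>] b2[OF \<open>s \<in> {0..\<tau>}\<close>] by simp
        ultimately show ?thesis
          using norm_triangle_ineq4[of "w' s - J (V s \<psi>)" "v s - J (V s \<psi>)"] by (simp add: distrib_left)
      qed
    qed (use t in auto)
    then have 1: "norm (w t - T \<epsilon> t (w 0)) \<le> \<epsilon> * (N1 + N2) * t" by simp
    have "norm (T \<epsilon> t (w 0 - J \<phi>)) \<le> \<epsilon> * N1"
      using order_trans[OF T_contraction[OF \<epsilon>(1)] err[of 0]] t by simp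
    then have 2: "norm (T \<epsilon> t (w 0) - T \<epsilon> t (J \<phi>)) \<le> \<epsilon> * N1" using T_diff[OF \<epsilon>(1)] t by simp
    \<comment> \<open>Three errors: the corrector at time \<open>t\<close>, the accumulated
      residual, and the corrector at time 0 carried along by the contraction.\<close>
    have eq: "T \<epsilon> t (J \<phi>) - J (V t \<phi>) = (w t - J (V t \<phi>)) - (w t - T \<epsilon> t (w 0)) - (T \<epsilon> t (w 0) - T \<epsilon> t (J \<phi>))"
      by simp
    have "norm (T \<epsilon> t (J \<phi>) - J (V t \<phi>)) \<le> norm (w t - J (V t \<phi>)) + norm (w t - T \<epsilon> t (w 0)) + norm (T \<epsilon> t (w 0) - T \<epsilon> t (J \<phi>))"
      by (subst eq, intro order_trans[OF norm_triangle_ineq4] add_right_mono norm_triangle_ineq4)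
    then show ?thesis using 1 2 err[OF t] by (simp add: algebra_simps)
  qed
  moreover have "\<epsilon> * (2 * N1 + (N1 + N2) * t) \<le> \<epsilon> * (2 * N1 + \<bar>N1 + N2\<bar> * \<tau>)" if "0 < \<epsilon>" "t \<in> {0..\<tau>}" for \<epsilon> t
    using that mult_mono[of "N1 + N2" "\<bar>N1 + N2\<bar>" t \<tau>] by (intro mult_left_mono add_left_mono) auto
  ultimately show thesis using that by (meson order_trans)
qed

text \<open>A priori \<open>V t\<close> is only bounded for each \<open>t\<close>. On the domain of
  the squared generator it is a limit of contractions, and its own bound \<open>K\<close> suffices
  to extend the estimate by density.\<close>

lemma V_contraction:
  assumes "t \<ge> 0" shows "norm (V t \<phi>) \<le> norm \<phi>"
proof -
  interpret Vt: bounded_linear "V t" by (rule V.bounded_linear[OF assms])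
  obtain K where K: "K > 0" "\<And>\<phi>. norm (V t \<phi>) \<le> norm \<phi> * K" using Vt.pos_bounded by blast
  show ?thesis
  proof (rule field_le_epsilon)
    fix e :: real assume "e > 0"
    then have "e / (K + 1) > 0" using K by simp
    then obtain \<phi>' \<psi> \<omega> where g: "(\<phi>', \<psi>) \<in> generator_on UNIV V" "(\<psi>, \<omega>) \<in> generator_on UNIV V" "dist \<phi>' \<phi> < e / (K + 1)"
      by (rule V.generator_square_dense)
    obtain K' where K': "\<And>\<epsilon> s. 0 < \<epsilon> \<Longrightarrow> \<epsilon> \<le> 1 \<Longrightarrow> s \<in> {0..t} \<Longrightarrow> norm (T \<epsilon> s (J \<phi>') - J (V s \<phi>')) \<le> \<epsilon> * K'"
      using smooth_approximation[OF g(1,2)] by blast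
    have "norm (V t \<phi>') \<le> norm \<phi>' + 0 * K'"
    proof (rule tendsto_lowerbound)
      show "((\<lambda>\<epsilon>. norm \<phi>' + \<epsilon> * K') \<longlongrightarrow> norm \<phi>' + 0 * K') (at_right 0)" by (intro tendsto_intros)
      have "norm (V t \<phi>') \<le> norm \<phi>' + \<epsilon> * K'" if "0 < \<epsilon>" "\<epsilon> < 1" for \<epsilon>
        using K'[of \<epsilon> t] T_contraction[of \<epsilon> t "J \<phi>'"] that assms norm_triangle_ineq2[of "J (V t \<phi>')" "T \<epsilon> t (J \<phi>')"]
        by (simp add: norm_minus_commute)
      then show "\<forall>\<^sub>F \<epsilon> in at_right 0. norm (V t \<phi>') \<le> norm \<phi>' + \<epsilon> * K'"
        unfolding eventually_at_right_field by (intro exI[of _ 1]) auto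
    qed simp
    moreover have "norm (V t \<phi>) \<le> norm (V t \<phi>') + norm (\<phi> - \<phi>') * K"
      using norm_triangle_sub[of "V t \<phi>" "V t \<phi>'"] K(2)[of "\<phi> - \<phi>'"] by (simp add: Vt.diff)
    moreover have "norm \<phi>' \<le> norm \<phi> + norm (\<phi> - \<phi>')" using norm_triangle_sub[of \<phi>' \<phi>] by (simp add: norm_minus_commute)
    ultimately have "norm (V t \<phi>) \<le> norm \<phi> + norm (\<phi> - \<phi>') * (K + 1)" by (simp add: algebra_simps)
    also have "norm (\<phi> - \<phi>') * (K + 1) \<le> e" using g(3) K(1) by (simp add: dist_norm norm_minus_commute field_simps)
    finally show "norm (V t \<phi>) \<le> norm \<phi> + e" by simp
  qed
qed

text \<open>A three-part estimate: contractivity on both sides makes the cost of replacing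
  \<open>\<phi>\<close> by a smooth element independent of \<epsilon> and of the time.\<close>

lemma approximation_on_L0:
  assumes "e > 0"
  shows "\<forall>\<^sub>F \<epsilon> in at_right 0. \<forall>t\<in>{0..\<tau>}. norm (T \<epsilon> t (J \<phi>) - J (V t \<phi>)) < e"
proof -
  interpret J: bounded_linear J by (rule bounded_linear_J)
  have "e / 3 > 0" using assms by simp
  then obtain \<phi>' \<psi> \<omega> where g: "(\<phi>', \<psi>) \<in> generator_on UNIV V" "(\<psi>, \<omega>) \<in> generator_on UNIV V" "dist \<phi>' \<phi> < e / 3"
    by (rule V.generator_square_dense)
  obtain K where K: "\<And>\<epsilon> t. 0 < \<epsilon> \<Longrightarrow> \<epsilon> \<le> 1 \<Longrightarrow> t \<in> {0..\<tau>} \<Longrightarrow> norm (T \<epsilon> t (J \<phi>') - J (V t \<phi>')) \<le> \<epsilon> * K"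
    using smooth_approximation[OF g(1,2)] by blast
  have "((\<lambda>\<epsilon>. \<epsilon> * K) \<longlongrightarrow> 0 * K) (at_right 0)" by (intro tendsto_intros)
  then have "\<forall>\<^sub>F \<epsilon> in at_right 0. \<epsilon> * K < e / 3" using \<open>e / 3 > 0\<close> by (intro order_tendstoD) auto
  moreover have "\<forall>\<^sub>F \<epsilon> in at_right 0. 0 < \<epsilon> \<and> \<epsilon> \<le> (1::real)"
    unfolding eventually_at_right_field by (intro exI[of _ 1]) auto
  ultimately show ?thesis
  proof eventually_elim
    case (elim \<epsilon>)
    show ?case
    proof
      fix t assume t: "t \<in> {0..\<tau>}"
      have d: "norm (\<phi> - \<phi>') < e / 3" using g(3) by (simp add: dist_norm norm_minus_commute)
      have "norm (T \<epsilon> t (J (\<phi> - \<phi>'))) < e / 3" "norm (J (V t (\<phi> - \<phi>'))) < e / 3"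
        using T_contraction[of \<epsilon> t "J (\<phi> - \<phi>')"] V_contraction[of t "\<phi> - \<phi>'"] d elim t by auto
      moreover have "norm (T \<epsilon> t (J \<phi>') - J (V t \<phi>')) < e / 3" using K[of \<epsilon> t] elim t by auto
      moreover have "T \<epsilon> t (J \<phi>) - J (V t \<phi>) = T \<epsilon> t (J (\<phi> - \<phi>')) + (T \<epsilon> t (J \<phi>') - J (V t \<phi>')) - J (V t (\<phi> - \<phi>'))"
        using elim t by (simp add: J.diff V.diff T_diff)
      ultimately show "norm (T \<epsilon> t (J \<phi>) - J (V t \<phi>)) < e"
        using norm_triangle_ineq4[of "T \<epsilon> t (J (\<phi> - \<phi>')) + (T \<epsilon> t (J \<phi>') - J (V t \<phi>'))" "J (V t (\<phi> - \<phi>'))"]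
          norm_triangle_ineq[of "T \<epsilon> t (J (\<phi> - \<phi>'))" "T \<epsilon> t (J \<phi>') - J (V t \<phi>')"] by simp
    qed
  qed
qed

text \<open>For odd \<open>\<eta>\<close> the operator \<open>B - I\<close> acts as -2, so the
  damped vector solves the equation up to a residual of size 1/\<epsilon>. That residual is itself
  damped at the rate 2/\<epsilon>^2, so its total over time is only of order \<epsilon>.\<close>

lemma odd_decay:
  assumes \<eta>: "(\<eta>, \<xi>) \<in> A p p' q q'" "B \<eta> = - \<eta>" and \<epsilon>: "\<epsilon> > 0" and t: "t \<ge> 0"
  shows "norm (exp (- 2 * t / \<epsilon>\<^sup>2) *\<^sub>R \<eta> - T \<epsilon> t \<eta>) \<le> \<epsilon> / 2 * norm \<xi>"
proof -
  interpret T: banach_c0_semigroup "T \<epsilon>" by (rule T_semigroup[OF \<epsilon>])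
  define E where "E s = exp (- (2 / \<epsilon>\<^sup>2) * s)" for s
  \<comment> \<open>A primitive of the residual bound \<open>E s * norm \<xi> / \<epsilon>\<close>,
    bounded by \<open>\<epsilon> / 2 * norm \<xi>\<close> in modulus for
    \<open>s \<ge> 0\<close>.\<close>
  define D where "D s = - (\<epsilon> / 2 * norm \<xi>) * E s" for s
  have E': "(E has_real_derivative - (2 / \<epsilon>\<^sup>2) * E s) (at s)" for s
  proof -
    have "((\<lambda>s. exp (c * s)) has_real_derivative c * exp (c * s)) (at s)" for c :: real
      by (auto intro!: derivative_eq_intros)
    then show ?thesis unfolding E_def[abs_def] .
  qed
  let ?\<zeta> = "(1 / \<epsilon>) *\<^sub>R \<xi> + (1 / \<epsilon>\<^sup>2) *\<^sub>R (B \<eta> - \<eta>)"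
  have gen: "(\<eta>, ?\<zeta>) \<in> generator_on UNIV (T \<epsilon>)"
    unfolding T_generator[OF \<epsilon>] G_def using \<eta>(1) by blast
  have "norm (E t *\<^sub>R \<eta> - T \<epsilon> t (E 0 *\<^sub>R \<eta>)) \<le> D t - D 0"
  proof (rule T.approximate_orbit[where v = "\<lambda>s. E s *\<^sub>R ?\<zeta>" and w' = "\<lambda>s. (- (2 / \<epsilon>\<^sup>2) * E s) *\<^sub>R \<eta>" and d = "\<lambda>s. E s * norm \<xi> / \<epsilon>"])
    show "norm (T \<epsilon> s \<eta>) \<le> norm \<eta>" if "s \<ge> 0" for s \<eta> by (rule T_contraction[OF \<epsilon> that])
    have c: "continuous_on {0..} E" unfolding E_def by (intro continuous_intros) (use \<epsilon> in auto)
    then show "continuous_on {0..} (\<lambda>s. E s *\<^sub>R \<eta>)" "continuous_on {0..} D"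
      unfolding D_def by (intro continuous_intros c)+
    show "(E s *\<^sub>R \<eta>, E s *\<^sub>R ?\<zeta>) \<in> generator_on UNIV (T \<epsilon>)" for s
      using subspace_scale[OF T.generator_subspace gen, of "E s"] by simp
    show "((\<lambda>h. (1 / h) *\<^sub>R (E (s + h) *\<^sub>R \<eta> - E s *\<^sub>R \<eta>)) \<longlongrightarrow> (- (2 / \<epsilon>\<^sup>2) * E s) *\<^sub>R \<eta>) (at_right 0)" for s
    proof -
      have "((\<lambda>h. ((E (s + h) - E s) / h) *\<^sub>R \<eta>) \<longlongrightarrow> (- (2 / \<epsilon>\<^sup>2) * E s) *\<^sub>R \<eta>) (at_right 0)"
        using E'[of s] unfolding DERIV_def filterlim_at_split by (intro tendsto_intros) auto
      then show ?thesis by (simp add: scaleR_diff_left diff_divide_distrib scaleR_diff_right)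
    qed
    show "(D has_real_derivative E s * norm \<xi> / \<epsilon>) (at s)" for s
      unfolding D_def[abs_def] using \<epsilon>
      by (auto intro!: derivative_eq_intros E' simp: power2_eq_square)
    show "norm ((- (2 / \<epsilon>\<^sup>2) * E s) *\<^sub>R \<eta> - E s *\<^sub>R ?\<zeta>) \<le> E s * norm \<xi> / \<epsilon>" for s
    proof -
      have "(- (2 / \<epsilon>\<^sup>2) * E s) *\<^sub>R \<eta> - E s *\<^sub>R ?\<zeta> = - ((E s / \<epsilon>) *\<^sub>R \<xi>)"
      proof -
        have "B \<eta> - \<eta> = - (2 *\<^sub>R \<eta>)" by (simp add: \<eta>(2) scaleR_2)
        then show ?thesis by (simp add: scaleR_diff_right mult.commute)
      qed
      moreover have "E s \<ge> 0" by (simp add: E_def)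
      ultimately show ?thesis using \<epsilon> by simp
    qed
  qed (rule t)
  also have "D t - D 0 = \<epsilon> / 2 * norm \<xi> * (1 - E t)" by (simp add: D_def E_def algebra_simps)
  also have "\<dots> \<le> \<epsilon> / 2 * norm \<xi> * 1"
    using \<epsilon> by (intro mult_left_mono) (auto simp: E_def)
  finally show ?thesis by (simp add: E_def)
qed

text \<open>The odd part lives in an initial layer of width of order \<epsilon>^2, so times bounded
  below by \<open>t0\<close> leave it behind.\<close>

lemma odd_part_vanishes:
  assumes \<eta>: "B \<eta> = - \<eta>" and "e > 0" "t0 > 0"
  shows "\<forall>\<^sub>F \<epsilon> in at_right 0. \<forall>t\<ge>t0. norm (T \<epsilon> t \<eta>) < e"
proof -
  interpret T1: banach_c0_semigroup "T 1" by (rule T_semigroup) simp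
  interpret B: bounded_linear B by (rule bounded_linear_B)
  have e4: "e / 4 > 0" using assms by simp
  obtain \<phi> \<zeta> where "(\<phi>, \<zeta>) \<in> generator_on UNIV (T 1)" and close: "dist \<phi> \<eta> < e / 4"
    using e4 by (rule T1.generator_dense)
  \<comment> \<open>The domain of \<open>G\<close> is that of \<open>A\<close> for every \<epsilon>,
    so density of the generator domain for \<epsilon> = 1 gives density of the domain of
    \<open>A\<close>.\<close>
  then obtain \<xi>0 where "(\<phi>, \<xi>0) \<in> A p p' q q'" unfolding T_generator[OF zero_less_one] G_def by blast
  then obtain \<eta>' \<xi> where \<eta>': "(\<eta>', \<xi>) \<in> A p p' q q'" "B \<eta>' = - \<eta>'" "norm (\<eta>' - (1 / 2) *\<^sub>R (\<phi> - B \<phi>)) < e / 4"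
    using e4 by (rule odd_A_dense)
  have "(1 / 2) *\<^sub>R (\<phi> - B \<phi>) - \<eta> = (1 / 2) *\<^sub>R ((\<phi> - \<eta>) - B (\<phi> - \<eta>))"
    by (simp add: B.diff \<eta> algebra_simps flip: scaleR_2)
  then have "norm ((1 / 2) *\<^sub>R (\<phi> - B \<phi>) - \<eta>) \<le> (norm (\<phi> - \<eta>) + norm (B (\<phi> - \<eta>))) / 2"
    using norm_triangle_ineq4[of "\<phi> - \<eta>" "B (\<phi> - \<eta>)"] by simp
  then have d: "norm (\<eta> - \<eta>') < e / 2"
    using \<eta>'(3) close norm_triangle_ineq[of "\<eta>' - (1 / 2) *\<^sub>R (\<phi> - B \<phi>)" "(1 / 2) *\<^sub>R (\<phi> - B \<phi>) - \<eta>"]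
    by (simp add: dist_norm norm_minus_commute)
  \<comment> \<open>For \<open>t \<ge> t0\<close> the damping factor is largest at
    \<open>t0\<close>; it remains to see that this value tends to 0.\<close>
  have "filterlim (\<lambda>\<epsilon>::real. \<epsilon>\<^sup>2) (at_right 0) (at_right 0)"
    unfolding filterlim_at by (auto intro!: tendsto_eq_intros eventually_mono[OF eventually_at_right_less[of 0]])
  then have "filterlim (\<lambda>\<epsilon>. inverse (\<epsilon>\<^sup>2)) at_top (at_right (0::real))"
    by (rule filterlim_compose[OF filterlim_inverse_at_top_right])
  then have "filterlim (\<lambda>\<epsilon>. (2 * t0) * inverse (\<epsilon>\<^sup>2)) at_top (at_right (0::real))"
    using \<open>t0 > 0\<close> by (intro filterlim_tendsto_pos_mult_at_top[OF tendsto_const]) auto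
  then have "((\<lambda>\<epsilon>. exp (- ((2 * t0) * inverse (\<epsilon>\<^sup>2)))) \<longlongrightarrow> 0) (at_right (0::real))"
    by (intro filterlim_compose[OF exp_at_bot] filterlim_uminus_at_bot[THEN iffD2]) simp
  then have "((\<lambda>\<epsilon>. exp (- ((2 * t0) * inverse (\<epsilon>\<^sup>2))) * norm \<eta>' + \<epsilon> / 2 * norm \<xi>) \<longlongrightarrow> 0 * norm \<eta>' + 0 / 2 * norm \<xi>) (at_right 0)"
    by (intro tendsto_intros) auto
  then have "\<forall>\<^sub>F \<epsilon> in at_right 0. exp (- ((2 * t0) * inverse (\<epsilon>\<^sup>2))) * norm \<eta>' + \<epsilon> / 2 * norm \<xi> < e / 2"
    using assms by (intro order_tendstoD) auto
  then show ?thesis using eventually_at_right_less[of "0::real"]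
  proof eventually_elim
    case (elim \<epsilon>)
    show ?case
    proof (intro allI impI)
      fix t assume t: "t0 \<le> t"
      then have t0: "t \<ge> 0" using \<open>t0 > 0\<close> by simp
      have "norm (T \<epsilon> t \<eta>') \<le> norm (exp (- 2 * t / \<epsilon>\<^sup>2) *\<^sub>R \<eta>') + norm (exp (- 2 * t / \<epsilon>\<^sup>2) *\<^sub>R \<eta>' - T \<epsilon> t \<eta>')"
        using norm_triangle_sub[of "T \<epsilon> t \<eta>'" "exp (- 2 * t / \<epsilon>\<^sup>2) *\<^sub>R \<eta>'"] by (simp add: norm_minus_commute)
      also have "\<dots> \<le> exp (- ((2 * t0) * inverse (\<epsilon>\<^sup>2))) * norm \<eta>' + \<epsilon> / 2 * norm \<xi>"
      proof (intro add_mono odd_decay \<eta>' elim t0)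
        have "exp (- 2 * t / \<epsilon>\<^sup>2) \<le> exp (- ((2 * t0) * inverse (\<epsilon>\<^sup>2)))"
          using t by (simp add: divide_inverse mult_right_mono)
        then show "norm (exp (- 2 * t / \<epsilon>\<^sup>2) *\<^sub>R \<eta>') \<le> exp (- ((2 * t0) * inverse (\<epsilon>\<^sup>2))) * norm \<eta>'"
          by (simp add: mult_right_mono)
      qed
      finally have "norm (T \<epsilon> t \<eta>') < e / 2" using elim(1) by simp
      moreover have "norm (T \<epsilon> t (\<eta> - \<eta>')) < e / 2" using T_contraction[OF elim(2) t0, of "\<eta> - \<eta>'"] d by simp
      moreover have "T \<epsilon> t \<eta> = T \<epsilon> t \<eta>' + T \<epsilon> t (\<eta> - \<eta>')" by (simp add: T_diff elim(2) t0)
      ultimately show "norm (T \<epsilon> t \<eta>) < e" using norm_triangle_ineq[of "T \<epsilon> t \<eta>'" "T \<epsilon> t (\<eta> - \<eta>')"] by simp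
    qed
  qed
qed

section \<open>Uniform convergence on compact sets of times\<close>

lemma uniform_limit_L0:
  assumes "\<phi> \<in> L0" "compact K" "K \<subseteq> {0..}"
  shows "uniform_limit K (\<lambda>\<epsilon> t. T \<epsilon> t \<phi>) (\<lambda>t. U t (P \<phi>)) (at_right 0)"
proof (rule uniform_limitI)
  fix e :: real assume "e > 0"
  obtain \<psi> where \<psi>: "\<phi> = J \<psi>" using assms(1) unfolding L0_eq_range_J by blast
  obtain \<tau> where \<tau>: "\<And>t. t \<in> K \<Longrightarrow> t \<le> \<tau>" using compact_bounded_above[OF assms(2)] by blast
  show "\<forall>\<^sub>F \<epsilon> in at_right 0. \<forall>t\<in>K. dist (T \<epsilon> t \<phi>) (U t (P \<phi>)) < e"
    using approximation_on_L0[OF \<open>e > 0\<close>, of \<tau> \<psi>]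
  proof eventually_elim
    case (elim \<epsilon>)
    show ?case
    proof
      fix t assume "t \<in> K"
      then have "t \<in> {0..\<tau>}" using \<tau> assms(3) by auto
      with elim show "dist (T \<epsilon> t \<phi>) (U t (P \<phi>)) < e"
        unfolding P_L0[OF assms(1)] by (simp add: \<psi> dist_norm J_V)
    qed
  qed
qed

text \<open>The symmetric part \<open>P \<phi>\<close> converges by the result on \<open>L0\<close>,
  and the odd remainder \<open>\<phi> - P \<phi>\<close> vanishes away from time 0.\<close>

lemma uniform_limit_positive:
  assumes "compact K" "K \<subseteq> {0<..}"
  shows "uniform_limit K (\<lambda>\<epsilon> t. T \<epsilon> t \<phi>) (\<lambda>t. U t (P \<phi>)) (at_right 0)"
proof (rule uniform_limitI)
  fix e :: real assume "e > 0"
  then have e2: "e / 2 > 0" by simp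
  \<comment> \<open>A compact set of positive times stays away from 0, hence beyond the initial
    layer; the empty set is treated apart because it has no least element.\<close>
  have "\<exists>t0>0. \<forall>t\<in>K. t0 \<le> t"
  proof (cases "K = {}")
    case False
    then obtain t0 where "t0 \<in> K" "\<forall>t\<in>K. t0 \<le> t" using compact_attains_inf[OF assms(1)] by blast
    then show ?thesis using assms(2) by auto
  qed (auto intro: exI[of _ 1])
  then obtain t0 where t0: "t0 > 0" "\<And>t. t \<in> K \<Longrightarrow> t0 \<le> t" by blast
  have "K \<subseteq> {0..}" using assms(2) by auto
  then have L: "\<forall>\<^sub>F \<epsilon> in at_right 0. \<forall>t\<in>K. dist (T \<epsilon> t (P \<phi>)) (U t (P (P \<phi>))) < e / 2"
    using uniform_limitD[OF uniform_limit_L0[OF P_in_L0 assms(1)] e2] by blast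
  have odd: "B (\<phi> - P \<phi>) = - (\<phi> - P \<phi>)"
  proof -
    interpret B: bounded_linear B by (rule bounded_linear_B)
    have "B (P \<phi>) = P \<phi>" using P_in_L0 L0_iff_B by blast
    moreover have "B \<phi> = 2 *\<^sub>R P \<phi> - \<phi>" by (simp add: P_def)
    ultimately show ?thesis by (simp add: B.diff scaleR_2)
  qed
  show "\<forall>\<^sub>F \<epsilon> in at_right 0. \<forall>t\<in>K. dist (T \<epsilon> t \<phi>) (U t (P \<phi>)) < e"
    using L odd_part_vanishes[OF odd e2 t0(1)] eventually_at_right_less[of "0::real"]
  proof eventually_elim
    case (elim \<epsilon>)
    show ?case
    proof
      fix t assume t: "t \<in> K"
      then have "t \<ge> 0" using assms(2) by auto
      then have eq: "T \<epsilon> t \<phi> - U t (P \<phi>) = (T \<epsilon> t (P \<phi>) - U t (P \<phi>)) + T \<epsilon> t (\<phi> - P \<phi>)"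
        using elim(3) by (simp add: T_diff)
      show "dist (T \<epsilon> t \<phi>) (U t (P \<phi>)) < e"
        unfolding dist_norm eq using elim(1)[rule_format, OF t] elim(2)[rule_format, OF t0(2)[OF t]]
          norm_triangle_ineq[of "T \<epsilon> t (P \<phi>) - U t (P \<phi>)" "T \<epsilon> t (\<phi> - P \<phi>)"]
        by (simp add: dist_norm P_L0 P_in_L0)
    qed
  qed
qed

end

theorem theorem5p1:
  fixes p p' q q' p\<^sub>0 q\<^sub>0 \<gamma> :: real
    and T :: "real \<Rightarrow> real \<Rightarrow> S L1 \<Rightarrow> S L1"
    and U :: "real \<Rightarrow> S L1 \<Rightarrow> S L1"
  assumes "p \<ge> 0" "p' \<ge> 0" "q \<ge> 0" "q' \<ge> 0" "p + p' \<le> 1" "q + q' \<le> 1"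
    and "p\<^sub>0 = 1 - p - p'" "q\<^sub>0 = 1 - q - q'"
    and "\<gamma> = p * q\<^sub>0 + q * p\<^sub>0 + p\<^sub>0 * q\<^sub>0" "\<gamma> \<noteq> 0"
    and "\<And>\<epsilon>. \<epsilon> > 0 \<Longrightarrow> generates_on UNIV (G p p' q q' \<epsilon>) (T \<epsilon>)"
    and "generates_on L0 (scale_op (1 / 2) \<Delta>\<^sub>0_tilde) U"
  shows "(\<forall>\<phi>. (\<forall>t>0. ((\<lambda>\<epsilon>. T \<epsilon> t \<phi>) \<longlongrightarrow> U t (P \<phi>)) (at_right 0)) \<and>
              (\<forall>K. compact K \<and> K \<subseteq> {0<..} \<longrightarrow>
                 uniform_limit K (\<lambda>\<epsilon> t. T \<epsilon> t \<phi>) (\<lambda>t. U t (P \<phi>)) (at_right 0))) \<and>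
         (\<forall>\<phi>\<in>L0. (\<forall>t\<ge>0. ((\<lambda>\<epsilon>. T \<epsilon> t \<phi>) \<longlongrightarrow> U t (P \<phi>)) (at_right 0)) \<and>
              (\<forall>K. compact K \<and> K \<subseteq> {0..} \<longrightarrow>
                 uniform_limit K (\<lambda>\<epsilon> t. T \<epsilon> t \<phi>) (\<lambda>t. U t (P \<phi>)) (at_right 0)))"
proof -
  \<comment> \<open>The given combination expands to the determinant of the interface
    system.\<close>
  have "(1 - q') * (1 - p') - p * q = \<gamma>" unfolding assms(9,7,8) by (simp add: algebra_simps)
  then interpret approximation p p' q q' T U using assms by unfold_locales auto
  \<comment> \<open>A limit at a single time is a uniform limit on a one-point compact set.\<close>
  have "((\<lambda>\<epsilon>. T \<epsilon> t \<phi>) \<longlongrightarrow> U t (P \<phi>)) (at_right 0)" if "t > 0" for t \<phi>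
    using tendsto_uniform_limitI[OF uniform_limit_positive[of "{t}"], of t] that by simp
  moreover have "((\<lambda>\<epsilon>. T \<epsilon> t \<phi>) \<longlongrightarrow> U t (P \<phi>)) (at_right 0)" if "t \<ge> 0" "\<phi> \<in> L0" for t \<phi>
    using tendsto_uniform_limitI[OF uniform_limit_L0[OF that(2), of "{t}"], of t] that by simp
  ultimately show ?thesis
    by (intro conjI allI ballI impI) (simp_all add: uniform_limit_positive uniform_limit_L0)
qed

end
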